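(* All irreducible elements of $\mathbb{M}$ are prime. Moreover, if $(\mathcal{Y}_n)_{n\in\mathbb{N}}$ is a sequence of elements of $\mathbb{M}$ such that $\lim_{n\to\infty}(\mathcal{Y}_0\boxplus\cdots\boxplus\mathcal{Y}_n)=\mathcal{Y}$ exists and $\mathcal{X}\in\mathbb{M}$ is an irreducible element such that $\mathcal{X}\le\mathcal{Y}$, then $\mathcal{X}\le\mathcal{Y}_n$ for some $n\in\mathbb{N}$.
   Context: $\mathbb{N}=\{0,1,2,\ldots\}$. A metric measure space is a triple $\mathcal{X}=(X,r_X,\mu_X)$ where $(X,r_X)$ is a complete separable metric space and $\mu_X$ is a Borel probability measure on $X$ with full support. Two such spaces are equivalent if there is an isometry from one onto the other that maps the first probability measure to the second by push-forward. $\mathbb{M}$ denotes the set of equivalence classes, and a class is not distinguished from its representatives. $\mathcal{E}\in\mathbb{M}$ is the class of one-point spaces. For $\mathcal{Y},\mathcal{Z}\in\mathbb{M}$, $\mathcal{Y}\boxplus\mathcal{Z}:=(Y\times Z,\,r_Y\oplus r_Z,\,\mu_Y\otimes\mu_Z)$ with $(r_Y\oplus r_Z)((y',z'),(y'',z''))=r_Y(y',y'')+r_Z(z',z'')$; $(\mathbb{M},\boxplus)$ is a commutative semigroup with identity $\mathcal{E}$. $\mathbb{M}$ carries the topology of the Gromov–Prohorov metric $d_{\mathrm{GPr}}(\mathcal{X},\mathcal{Y}):=\inf d_{\mathrm{Pr}}^{(Z,r_Z)}(\mu_X\circ\phi_X^{-1},\mu_Y\circ\phi_Y^{-1})$, where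 the infimum is over all metric spaces $(Z,r_Z)$ and isometric embeddings $\phi_X:X\to Z$, $\phi_Y:Y\to Z$, and $d_{\mathrm{Pr}}^{(Z,r_Z)}$ is the Prohorov metric on probability measures on $(Z,r_Z)$; limits in $\mathbb{M}$ are with respect to $d_{\mathrm{GPr}}$. Partial order: $\mathcal{Y}\le\mathcal{Z}$ if $\mathcal{Z}=\mathcal{Y}\boxplus\mathcal{X}$ for some $\mathcal{X}\in\mathbb{M}$. An element $\mathcal{X}\in\mathbb{M}$ is irreducible if $\mathcal{X}\ne\mathcal{E}$ and $\mathcal{Y}\le\mathcal{X}$ for $\mathcal{Y}\in\mathbb{M}$ implies that $\mathcal{Y}$ is either $\mathcal{E}$ or $\mathcal{X}$. An element $\mathcal{X}\in\mathbb{M}\setminus\{\mathcal{E}\}$ is prime if $\mathcal{X}\le\mathcal{Y}\boxplus\mathcal{Z}$ for $\mathcal{Y},\mathcal{Z}\in\mathbb{M}$ implies that $\mathcal{X}\le\mathcal{Y}$ or $\mathcal{X}\le\mathcal{Z}$. *)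

theory Defs
  imports "HOL-Probability.Probability"
begin

section \<open>Metric measure spaces\<close>

definition metric_borel :: "'a metric \<Rightarrow> 'a measure" where
  "metric_borel m = sigma (mspace m) {U. openin (mtopology_of m) U}"

text \<open>
  A triple $(X, r_X, \mu_X)$ is a pair: the type \<^typ>\<open>'a metric\<close> bundles the carrier $X$ with
  the metric $r_X$.
\<close>

type_synonym 'a mm_triple = "'a metric \<times> 'a measure"

text \<open>The last conjunct is full support.\<close>

definition mm_space :: "'a mm_triple \<Rightarrow> bool" where
  "mm_space = (\<lambda>(m, \<mu>).
     mcomplete_of m \<and> separable_space (mtopology_of m) \<and>
     sets \<mu> = sets (metric_borel m) \<and> prob_space \<mu> \<and>
     (\<forall>U. openin (mtopology_of m) U \<and> U \<noteq> {} \<longrightarrow> measure \<mu> U > 0))"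

definition isometric_embedding :: "'a metric \<Rightarrow> 'b metric \<Rightarrow> ('a \<Rightarrow> 'b) \<Rightarrow> bool" where
  "isometric_embedding m m' f \<longleftrightarrow> f \<in> mspace m \<rightarrow> mspace m' \<and>
     (\<forall>x\<in>mspace m. \<forall>y\<in>mspace m. mdist m' (f x) (f y) = mdist m x y)"

definition mm_iso :: "'a mm_triple \<Rightarrow> 'b mm_triple \<Rightarrow> bool" where
  "mm_iso = (\<lambda>(m, \<mu>) (m', \<mu>').
     \<exists>f. isometric_embedding m m' f \<and> f ` mspace m = mspace m' \<and>
         distr \<mu> (metric_borel m') f = \<mu>')"

definition l1_metric :: "'a metric \<Rightarrow> 'b metric \<Rightarrow> ('a \<times> 'b) metric" where
  "l1_metric m m' = metric (mspace m \<times> mspace m',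
     \<lambda>(y', z') (y'', z''). mdist m y' y'' + mdist m' z' z'')"

definition mm_sum :: "'a mm_triple \<Rightarrow> 'b mm_triple \<Rightarrow> ('a \<times> 'b) mm_triple" where
  "mm_sum = (\<lambda>(m, \<mu>) (m', \<mu>'). (l1_metric m m', \<mu> \<Otimes>\<^sub>M \<mu>'))"

definition mm_point :: "unit mm_triple" where
  "mm_point = (metric (UNIV, \<lambda>_ _. 0), return (count_space UNIV) ())"


subsection \<open>Borel sets and isometries\<close>

lemma space_metric_borel [simp]: "space (metric_borel m) = mspace m"
  unfolding metric_borel_def using openin_subset[of "mtopology_of m"] 
  by (subst space_measure_of) auto

lemma sets_metric_borel:
  "sets (metric_borel m) = sigma_sets (mspace m) {U. openin (mtopology_of m) U}"
  unfolding metric_borel_def using openin_subset[of "mtopology_of m"] 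
  by (subst sets_measure_of) auto

lemma openin_metric_borel: "openin (mtopology_of m) U \<Longrightarrow> U \<in> sets (metric_borel m)"
  by (auto simp: sets_metric_borel)

lemma closedin_metric_borel: 
  assumes "closedin (mtopology_of m) C" shows "C \<in> sets (metric_borel m)"
proof -
  have "mspace m - C \<in> sets (metric_borel m)" 
    using assms by (auto intro!: openin_metric_borel simp: closedin_def)
  then have "mspace m - (mspace m - C) \<in> sets (metric_borel m)"
    by (metis sets.compl_sets space_metric_borel)
  moreover have "C \<subseteq> mspace m" using closedin_subset[OF assms] by simp
  ultimately show ?thesis by (simp add: double_diff)
qed

lemma continuous_map_measurable:
  assumes "continuous_map (mtopology_of m) (mtopology_of m') f"
  shows "f \<in> measurable (metric_borel m) (metric_borel m')"
proof -
  have "f \<in> measurable (metric_borel m) (sigma (mspace m') {U. openin (mtopology_of m') U})"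
  proof (rule measurable_measure_of)
    show "{U. openin (mtopology_of m') U} \<subseteq> Pow (mspace m')"
      using openin_subset[of "mtopology_of m'"] by auto
    show "f \<in> space (metric_borel m) \<rightarrow> mspace m'"
      using assms by (auto simp: continuous_map_def)
    fix U assume "U \<in> {U. openin (mtopology_of m') U}"
    then have "openin (mtopology_of m) {x \<in> mspace m. f x \<in> U}"
      using openin_continuous_map_preimage[OF assms] by simp
    moreover have "{x \<in> mspace m. f x \<in> U} = f -` U \<inter> space (metric_borel m)" by auto
    ultimately show "f -` U \<inter> space (metric_borel m) \<in> sets (metric_borel m)"
      by (auto intro: openin_metric_borel)
  qed
  then show ?thesis by (simp add: metric_borel_def)
qed

lemma isometric_embedding_Lipschitz:
  "isometric_embedding m m' f \<Longrightarrow> Lipschitz_continuous_map m m' f"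
  unfolding isometric_embedding_def Lipschitz_continuous_map_def
  by (auto intro!: exI[of _ 1])

lemma isometric_embedding_measurable:
  "isometric_embedding m m' f \<Longrightarrow> f \<in> measurable (metric_borel m) (metric_borel m')"
  by (intro continuous_map_measurable Lipschitz_continuous_imp_continuous_map
      isometric_embedding_Lipschitz)

lemma isometric_embedding_inj_on: "isometric_embedding m m' f \<Longrightarrow> inj_on f (mspace m)"
  unfolding isometric_embedding_def by (rule inj_onI) (metis Pi_iff mdist_zero)

lemma isometric_embedding_compose:
  "isometric_embedding m m' f \<Longrightarrow> isometric_embedding m' m'' g \<Longrightarrow> isometric_embedding m m'' (g \<circ> f)"
  unfolding isometric_embedding_def by (auto simp: Pi_iff)

lemma isometric_embedding_inv:
  assumes "isometric_embedding m m' f" "f ` mspace m = mspace m'"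
  shows "isometric_embedding m' m (inv_into (mspace m) f)"
        "inv_into (mspace m) f ` mspace m' = mspace m"
proof -
  show "isometric_embedding m' m (inv_into (mspace m) f)"
    unfolding isometric_embedding_def
  proof (intro conjI ballI funcsetI)
    let ?g = "inv_into (mspace m) f"
    have g: "?g x \<in> mspace m" "f (?g x) = x" if "x \<in> mspace m'" for x
      using that by (simp_all add: assms(2)[symmetric] inv_into_into f_inv_into_f)
    show "?g x \<in> mspace m" if "x \<in> mspace m'" for x by (rule g(1)[OF that])
    show "mdist m (?g x) (?g y) = mdist m' x y" if "x \<in> mspace m'" "y \<in> mspace m'" for x y
      using assms(1) g[OF that(1)] g[OF that(2)] unfolding isometric_embedding_def by metis
  qed
  show "inv_into (mspace m) f ` mspace m' = mspace m"
    using assms isometric_embedding_inj_on[OF assms(1)] by (metis inv_into_image_cancel order_refl)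
qed

lemma mm_space_sets: "mm_space (m, \<mu>) \<Longrightarrow> sets \<mu> = sets (metric_borel m)"
  and mm_space_prob: "mm_space (m, \<mu>) \<Longrightarrow> prob_space \<mu>"
  by (auto simp: mm_space_def)

lemma mm_space_space: "mm_space (m, \<mu>) \<Longrightarrow> space \<mu> = mspace m"
  using sets_eq_imp_space_eq[OF mm_space_sets] by simp

lemma mm_space_measurable:
  assumes "mm_space (m, \<mu>)" "isometric_embedding m m' f"
  shows "f \<in> measurable \<mu> (metric_borel m')"
  using isometric_embedding_measurable[OF assms(2)] 
  unfolding measurable_cong_sets[OF mm_space_sets[OF assms(1)] refl] .

lemma mm_iso_refl: "mm_space A \<Longrightarrow> mm_iso A A"
proof (cases A)
  case (Pair m \<mu>)
  assume A: "mm_space A"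
  have "distr \<mu> (metric_borel m) id = \<mu>"
    using distr_id2[OF mm_space_sets[of m \<mu>, symmetric]] A by (simp add: Pair id_def)
  moreover have "isometric_embedding m m id" by (auto simp: isometric_embedding_def)
  ultimately show ?thesis unfolding Pair mm_iso_def by force
qed

lemma mm_iso_trans:
  assumes "mm_space A" "mm_iso A B" "mm_iso B C" shows "mm_iso A C"
proof -
  obtain m \<mu> m' \<mu>' m'' \<mu>'' where [simp]: "A = (m, \<mu>)" "B = (m', \<mu>')" "C = (m'', \<mu>'')"
    by (metis surj_pair)
  obtain f g where f: "isometric_embedding m m' f" "f ` mspace m = mspace m'"
      "distr \<mu> (metric_borel m') f = \<mu>'"
    and g: "isometric_embedding m' m'' g" "g ` mspace m' = mspace m''"
      "distr \<mu>' (metric_borel m'') g = \<mu>''"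
    using assms unfolding mm_iso_def by auto
  have "distr \<mu> (metric_borel m'') (g \<circ> f) = \<mu>''"
    using distr_distr[OF isometric_embedding_measurable[OF g(1)] mm_space_measurable[OF _ f(1)], of \<mu>] 
      assms(1) f(3) g(3) by simp
  moreover have "(g \<circ> f) ` mspace m = mspace m''" 
    using f(2) g(2) by (metis image_comp)
  ultimately show ?thesis
    using isometric_embedding_compose[OF f(1) g(1)] unfolding mm_iso_def by (auto intro!: exI[of _ "g \<circ> f"])
qed

lemma mm_iso_sym:
  assumes "mm_space A" "mm_iso A B" shows "mm_iso B A"
proof -
  obtain m \<mu> m' \<mu>' where [simp]: "A = (m, \<mu>)" "B = (m', \<mu>')"
    by (metis surj_pair)
  obtain f where f: "isometric_embedding m m' f" "f ` mspace m = mspace m'"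
      "distr \<mu> (metric_borel m') f = \<mu>'"
    using assms unfolding mm_iso_def by auto
  let ?g = "inv_into (mspace m) f"
  note g = isometric_embedding_inv[OF f(1,2)]
  have mm: "mm_space (m, \<mu>)" using assms by simp
  have "distr \<mu>' (metric_borel m) ?g = distr \<mu> (metric_borel m) (?g \<circ> f)"
    using distr_distr[OF isometric_embedding_measurable[OF g(1)] mm_space_measurable[OF mm f(1)]] f(3) by simp
  also have "\<dots> = distr \<mu> \<mu> id"
    using isometric_embedding_inj_on[OF f(1)] mm_space_space[OF mm] mm_space_sets[OF mm]
    by (intro distr_cong) auto
  also have "\<dots> = \<mu>" by (simp add: id_def)
  finally show ?thesis using g unfolding mm_iso_def by auto
qed

text \<open>A metric measure space can be carried over along any injection of its carrier.\<close>

definition mm_relabel :: "('a \<Rightarrow> 'b) \<Rightarrow> 'a mm_triple \<Rightarrow> 'b mm_triple" where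
  "mm_relabel f = (\<lambda>(m, \<mu>). 
     let m' = metric (f ` mspace m, \<lambda>x y. mdist m (inv_into (mspace m) f x) (inv_into (mspace m) f y))
     in (m', distr \<mu> (metric_borel m') f))"

lemma mm_space_iso:
  assumes "mm_space (m, \<mu>)" "isometric_embedding m m' f" "f ` mspace m = mspace m'"
  shows "mm_space (m', distr \<mu> (metric_borel m') f)"
proof -
  note f = assms(2,3)
  note g = isometric_embedding_inv[OF f]
  let ?g = "inv_into (mspace m) f"
  have fmeas: "f \<in> measurable \<mu> (metric_borel m')" by (rule mm_space_measurable[OF assms(1,2)])
  have fc: "continuous_map (mtopology_of m) (mtopology_of m') f" 
    and gc: "continuous_map (mtopology_of m') (mtopology_of m) ?g"
    by (intro Lipschitz_continuous_imp_continuous_map isometric_embedding_Lipschitz f g)+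
  have gC: "Cauchy_continuous_map m' m ?g"
    by (intro Lipschitz_imp_Cauchy_continuous_map isometric_embedding_Lipschitz g)
  interpret M: Metric_space "mspace m" "mdist m" by simp
  interpret M': Metric_space "mspace m'" "mdist m'" by simp
  have cm: "M.mcomplete" and sep: "separable_space (mtopology_of m)"
    and pos: "\<And>U. openin (mtopology_of m) U \<Longrightarrow> U \<noteq> {} \<Longrightarrow> measure \<mu> U > 0"
    and prob: "prob_space \<mu>"
    using assms(1) by (auto simp: mm_space_def mcomplete_of_def)
  have "M'.mcomplete"
    unfolding M'.mcomplete_def
  proof (intro strip)
    fix s assume s: "M'.MCauchy s"
    then have "M.MCauchy (?g \<circ> s)" using gC by (auto simp: Cauchy_continuous_map_def)
    then obtain x where "limitin (mtopology_of m) (?g \<circ> s) x sequentially"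
      using cm by (auto simp: M.mcomplete_def mtopology_of_def)
    then have "limitin (mtopology_of m') (f \<circ> (?g \<circ> s)) (f x) sequentially"
      by (rule continuous_map_limit[OF fc])
    moreover have "f \<circ> (?g \<circ> s) = s"
      using s f(2) by (simp add: M'.MCauchy_def fun_eq_iff image_subset_iff f_inv_into_f)
    ultimately show "\<exists>x. limitin M'.mtopology s x sequentially"
      by (auto simp: mtopology_of_def)
  qed
  moreover have "separable_space (mtopology_of m')"
    using separable_space_continuous_map_image[OF sep fc] f(2) by simp
  moreover have "prob_space (distr \<mu> (metric_borel m') f)"
    by (rule prob_space.prob_space_distr[OF prob fmeas])
  moreover have "measure (distr \<mu> (metric_borel m') f) U > 0"
    if U: "openin (mtopology_of m') U" "U \<noteq> {}" for U
  proof -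
    have "openin (mtopology_of m) {x \<in> mspace m. f x \<in> U}"
      using openin_continuous_map_preimage[OF fc U(1)] by simp
    moreover have "{x \<in> mspace m. f x \<in> U} \<noteq> {}"
    proof -
      obtain y where y: "y \<in> U" using U(2) by blast
      then have "y \<in> f ` mspace m" using openin_subset[OF U(1)] f(2) by auto
      with y show ?thesis by blast
    qed
    ultimately have "measure \<mu> {x \<in> mspace m. f x \<in> U} > 0" by (rule pos)
    moreover have "{x \<in> mspace m. f x \<in> U} = f -` U \<inter> space \<mu>"
      using mm_space_space[OF assms(1)] by auto
    ultimately show ?thesis 
      using measure_distr[OF fmeas openin_metric_borel[OF U(1)]] by simp
  qed
  ultimately show ?thesis by (simp add: mm_space_def mcomplete_of_def)
qed

lemma relabel_metric:
  assumes "inj_on f (mspace m)"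
  defines "m' \<equiv> metric (f ` mspace m, \<lambda>x y. mdist m (inv_into (mspace m) f x) (inv_into (mspace m) f y))"
  shows "isometric_embedding m m' f" "f ` mspace m = mspace m'"
proof -
  interpret M': Metric_space "f ` mspace m" 
    "\<lambda>x y. mdist m (inv_into (mspace m) f x) (inv_into (mspace m) f y)"
    using assms by unfold_locales (auto simp: mdist_commute mdist_triangle inj_on_eq_iff)
  show "isometric_embedding m m' f" "f ` mspace m = mspace m'"
    using assms unfolding m'_def by (auto simp: isometric_embedding_def)
qed

lemma mm_relabel:
  assumes "mm_space A" "inj_on f (mspace (fst A))"
  shows "mm_space (mm_relabel f A)" "mm_iso A (mm_relabel f A)"
proof -
  obtain m \<mu> where [simp]: "A = (m, \<mu>)" by (cases A)
  let ?m = "metric (f ` mspace m, \<lambda>x y. mdist m (inv_into (mspace m) f x) (inv_into (mspace m) f y))"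
  have f: "isometric_embedding m ?m f" "f ` mspace m = mspace ?m" 
    by (rule relabel_metric; use assms in simp)+
  then show "mm_space (mm_relabel f A)" "mm_iso A (mm_relabel f A)"
    using assms mm_space_iso[OF _ f] unfolding mm_relabel_def mm_iso_def by (auto simp: Let_def)
qed

lemma metric_separable_dense:
  assumes "separable_space (mtopology_of m)"
  obtains C where "countable C" "C \<subseteq> mspace m"
    "\<And>x e. x \<in> mspace m \<Longrightarrow> e > 0 \<Longrightarrow> \<exists>c\<in>C. mdist m x c < e"
proof -
  interpret M: Metric_space "mspace m" "mdist m" by simp
  obtain C where C: "countable C" "C \<subseteq> mspace m" "mtopology_of m closure_of C = mspace m"
    using assms by (auto simp: separable_space_def)
  have "\<exists>c\<in>C. mdist m x c < e" if "x \<in> mspace m" "e > 0" for x e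
  proof -
    have "x \<in> M.mtopology closure_of C" using that(1) C(3) by (simp add: mtopology_of_def)
    then have "\<exists>y\<in>C. y \<in> M.mball x e" using that(2) unfolding M.metric_closure_of by blast
    then show ?thesis by auto
  qed
  with C that show ?thesis by blast
qed

text \<open>The distances to the points of a dense sequence determine a point.\<close>

lemma separable_inj_sequences:
  fixes m :: "'a metric"
  assumes "separable_space (mtopology_of m)"
  shows "\<exists>f :: 'a \<Rightarrow> nat \<Rightarrow> real. inj_on f (mspace m)"
proof -
  obtain C where C: "countable C" "C \<subseteq> mspace m"
    and *: "\<And>x e. x \<in> mspace m \<Longrightarrow> e > 0 \<Longrightarrow> \<exists>c\<in>C. mdist m x c < e"
    using metric_separable_dense[OF assms] by blast
  have "inj_on (\<lambda>x n. mdist m x (from_nat_into C n)) (mspace m)"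
  proof (rule inj_onI)
    fix x y assume xy: "x \<in> mspace m" "y \<in> mspace m"
      "(\<lambda>n. mdist m x (from_nat_into C n)) = (\<lambda>n. mdist m y (from_nat_into C n))"
    have eq: "mdist m x c = mdist m y c" if "c \<in> C" for c
      using fun_cong[OF xy(3), of "to_nat_on C c"] that C(1) by simp
    show "x = y"
    proof (rule ccontr)
      assume "x \<noteq> y"
      then have "mdist m x y > 0" using xy by (metis mdist_nonneg mdist_zero order_le_less)
      then obtain c where c: "c \<in> C" "mdist m x c < mdist m x y / 2"
        using *[OF xy(1), of "mdist m x y / 2"] by auto
      have "mdist m x y \<le> mdist m x c + mdist m c y" using xy c C by (intro mdist_triangle) auto
      also have "\<dots> = 2 * mdist m x c" using eq[OF c(1)] by (simp add: mdist_commute)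
      finally show False using c(2) by simp
    qed
  qed
  then show ?thesis by blast
qed

lemma mm_space_representative:
  assumes "mm_space A" shows "\<exists>B :: (nat \<Rightarrow> real) mm_triple. mm_space B \<and> mm_iso A B"
proof -
  have "separable_space (mtopology_of (fst A))" using assms by (cases A) (simp add: mm_space_def)
  then obtain f :: "'a \<Rightarrow> nat \<Rightarrow> real" where "inj_on f (mspace (fst A))"
    using separable_inj_sequences by blast
  from mm_relabel[OF assms this] show ?thesis by blast
qed



subsection \<open>Sums\<close>

lemma Metric_space_l1: "Metric_space (mspace m \<times> mspace m')
    (\<lambda>(y', z') (y'', z''). mdist m y' y'' + mdist m' z' z'')"
proof
  fix x y z assume "x \<in> mspace m \<times> mspace m'" "y \<in> mspace m \<times> mspace m'" "z \<in> mspace m \<times> mspace m'"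
  then have "mdist m (fst x) (fst z) \<le> mdist m (fst x) (fst y) + mdist m (fst y) (fst z)"
    "mdist m' (snd x) (snd z) \<le> mdist m' (snd x) (snd y) + mdist m' (snd y) (snd z)"
    by (auto intro!: mdist_triangle)
  then show "(case x of (y', z') \<Rightarrow> \<lambda>(y'', z''). mdist m y' y'' + mdist m' z' z'') z
     \<le> (case x of (y', z') \<Rightarrow> \<lambda>(y'', z''). mdist m y' y'' + mdist m' z' z'') y + 
       (case y of (y', z') \<Rightarrow> \<lambda>(y'', z''). mdist m y' y'' + mdist m' z' z'') z"
    by (simp add: case_prod_unfold)
qed (auto simp: mdist_commute add_nonneg_eq_0_iff)

lemma mspace_l1_metric [simp]: "mspace (l1_metric m m') = mspace m \<times> mspace m'"
  unfolding l1_metric_def by (rule Metric_space.mspace_metric[OF Metric_space_l1])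

lemma mdist_l1_metric [simp]:
  "mdist (l1_metric m m') = (\<lambda>(y', z') (y'', z''). mdist m y' y'' + mdist m' z' z'')"
  unfolding l1_metric_def by (rule Metric_space.mdist_metric[OF Metric_space_l1])

lemma l1_metric_Lipschitz:
  "Lipschitz_continuous_map (l1_metric m m') (prod_metric m m') id"
  "Lipschitz_continuous_map (prod_metric m m') (l1_metric m m') id"
proof -
  interpret Metric_space12 "mspace m" "mdist m" "mspace m'" "mdist m'" 
    by (rule Metric_space12_mspace_mdist)
  show "Lipschitz_continuous_map (l1_metric m m') (prod_metric m m') id"
    unfolding Lipschitz_continuous_map_def
    by (auto intro!: exI[of _ 1] prod_metric_le_components)
  show "Lipschitz_continuous_map (prod_metric m m') (l1_metric m m') id"
    unfolding Lipschitz_continuous_map_def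
    by (auto intro!: exI[of _ 2]) (smt (verit) component_le_prod_metric)
qed

lemma mtopology_of_l1_metric:
  "mtopology_of (l1_metric m m') = prod_topology (mtopology_of m) (mtopology_of m')"
proof -
  interpret Metric_space12 "mspace m" "mdist m" "mspace m'" "mdist m'" 
    by (rule Metric_space12_mspace_mdist)
  have "mtopology_of (l1_metric m m') = mtopology_of (prod_metric m m')"
    using l1_metric_Lipschitz[of m m', THEN Lipschitz_continuous_imp_continuous_map]
      topology_finer_continuous_id[of "mtopology_of (l1_metric m m')" "mtopology_of (prod_metric m m')"]
      topology_finer_continuous_id[of "mtopology_of (prod_metric m m')" "mtopology_of (l1_metric m m')"]
    unfolding topology_eq by auto
  then show ?thesis
    using mtopology_prod_metric by (simp add: mtopology_of_def)
qed

lemma mcomplete_of_l1_metric: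
  assumes "mcomplete_of m" "mcomplete_of m'" shows "mcomplete_of (l1_metric m m')"
proof -
  interpret Metric_space12 "mspace m" "mdist m" "mspace m'" "mdist m'" 
    by (rule Metric_space12_mspace_mdist)
  interpret L: Metric_space "mspace (l1_metric m m')" "mdist (l1_metric m m')" 
    by (rule Metric_space_mspace_mdist)
  have complete: "Prod_metric.mcomplete" 
    using assms mcomplete_prod_metric by (simp add: mcomplete_of_def)
  have "L.mcomplete"
    unfolding L.mcomplete_def
  proof (intro strip)
    fix s assume "L.MCauchy s"
    then have "Prod_metric.MCauchy s"
      using Lipschitz_imp_Cauchy_continuous_map[OF l1_metric_Lipschitz(1)[of m m']]
      unfolding Cauchy_continuous_map_def by force
    then show "\<exists>x. limitin L.mtopology s x sequentially"
      using complete mtopology_of_l1_metric[of m m'] mtopology_prod_metric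
      unfolding Prod_metric.mcomplete_def mtopology_of_def by metis
  qed
  then show ?thesis by (simp add: mcomplete_of_def)
qed

lemma separable_prod_topology:
  assumes "separable_space X" "separable_space Y" shows "separable_space (prod_topology X Y)"
proof -
  obtain C D where "countable C" "C \<subseteq> topspace X" "X closure_of C = topspace X"
    "countable D" "D \<subseteq> topspace Y" "Y closure_of D = topspace Y"
    using assms unfolding separable_space_def by metis
  then show ?thesis
    unfolding separable_space_def
    by (intro exI[of _ "C \<times> D"]) (auto simp: closure_of_Times)
qed

lemma separable_metric_second_countable:
  assumes "separable_space (mtopology_of m)" shows "second_countable (mtopology_of m)"
proof -
  interpret M: Metric_space "mspace m" "mdist m" by simp
  obtain C where C: "countable C" "C \<subseteq> mspace m"
    and dense: "\<And>x e. x \<in> mspace m \<Longrightarrow> e > 0 \<Longrightarrow> \<exists>c\<in>C. mdist m x c < e"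
    using metric_separable_dense[OF assms] by blast
  let ?B = "(\<lambda>(c, q). mball_of m c (real_of_rat q)) ` (C \<times> UNIV)"
  have "\<exists>V\<in>?B. x \<in> V \<and> V \<subseteq> U" if U: "openin (mtopology_of m) U" "x \<in> U" for U x
  proof -
    have x: "x \<in> mspace m" using U openin_subset[OF U(1)] by auto
    obtain r where r: "r > 0" "mball_of m x r \<subseteq> U"
      using U unfolding mtopology_of_def M.openin_mtopology mball_of_def by blast
    obtain q where q: "r / 3 < real_of_rat q" "real_of_rat q < r / 2"
      using of_rat_dense[of "r / 3" "r / 2"] r(1) by auto
    obtain c where c: "c \<in> C" "mdist m x c < r / 3" using dense[OF x, of "r / 3"] r(1) by auto
    have cm: "c \<in> mspace m" using c C by auto
    have "x \<in> mball_of m c (real_of_rat q)" using c q x cm by (simp add: mdist_commute)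
    moreover have "mball_of m c (real_of_rat q) \<subseteq> mball_of m x r"
    proof
      fix y assume y: "y \<in> mball_of m c (real_of_rat q)"
      then have "mdist m x y \<le> mdist m x c + mdist m c y" 
        using x cm by (intro mdist_triangle) auto
      then show "y \<in> mball_of m x r" using y c q x by auto
    qed
    ultimately show ?thesis using c(1) r(2) by force
  qed
  moreover have "openin (mtopology_of m) V" if "V \<in> ?B" for V
    using that by (auto simp: mtopology_of_def mball_of_def)
  ultimately show ?thesis
    unfolding second_countable_def using C(1) by (intro exI[of _ ?B]) auto
qed

lemma sets_metric_borel_l1:
  assumes "separable_space (mtopology_of m)" "separable_space (mtopology_of m')"
  shows "sets (metric_borel (l1_metric m m')) = sets (metric_borel m \<Otimes>\<^sub>M metric_borel m')"
proof
  let ?P = "metric_borel m \<Otimes>\<^sub>M metric_borel m'"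
  have "fst \<in> measurable (metric_borel (l1_metric m m')) (metric_borel m)"
    "snd \<in> measurable (metric_borel (l1_metric m m')) (metric_borel m')"
    by (intro continuous_map_measurable; simp add: mtopology_of_l1_metric continuous_map_fst continuous_map_snd)+
  note meas = this
  show "sets ?P \<subseteq> sets (metric_borel (l1_metric m m'))"
  proof (rule sets_pair_in_sets)
    fix a b assume ab: "a \<in> sets (metric_borel m)" "b \<in> sets (metric_borel m')"
    have "a \<times> b = (fst -` a \<inter> space (metric_borel (l1_metric m m'))) \<inter> 
        (snd -` b \<inter> space (metric_borel (l1_metric m m')))"
      using ab[THEN sets.sets_into_space] by auto
    then show "a \<times> b \<in> sets (metric_borel (l1_metric m m'))"
      using measurable_sets[OF meas(1) ab(1)] measurable_sets[OF meas(2) ab(2)] by auto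
  qed
  have "U \<in> sets ?P" if U: "openin (mtopology_of (l1_metric m m')) U" for U
  proof -
    obtain \<B> where \<B>: "countable \<B>" "\<And>V. V \<in> \<B> \<Longrightarrow> openin (mtopology_of m) V"
      "\<And>U x. openin (mtopology_of m) U \<Longrightarrow> x \<in> U \<Longrightarrow> \<exists>V\<in>\<B>. x \<in> V \<and> V \<subseteq> U"
      using separable_metric_second_countable[OF assms(1)] unfolding second_countable_def by metis
    obtain \<C> where \<C>: "countable \<C>" "\<And>V. V \<in> \<C> \<Longrightarrow> openin (mtopology_of m') V"
      "\<And>U x. openin (mtopology_of m') U \<Longrightarrow> x \<in> U \<Longrightarrow> \<exists>V\<in>\<C>. x \<in> V \<and> V \<subseteq> U"
      using separable_metric_second_countable[OF assms(2)] unfolding second_countable_def by metis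
    let ?I = "{p \<in> \<B> \<times> \<C>. fst p \<times> snd p \<subseteq> U}"
    have "U \<subseteq> (\<Union>p\<in>?I. fst p \<times> snd p)"
    proof
      fix z assume "z \<in> U"
      then obtain x y V W where z: "z = (x, y)" "openin (mtopology_of m) V" "openin (mtopology_of m') W"
        "x \<in> V" "y \<in> W" "V \<times> W \<subseteq> U"
        using U unfolding mtopology_of_l1_metric openin_prod_topology_alt by (metis surj_pair)
      obtain V' W' where "V' \<in> \<B>" "x \<in> V'" "V' \<subseteq> V" "W' \<in> \<C>" "y \<in> W'" "W' \<subseteq> W"
        using \<B>(3)[OF z(2,4)] \<C>(3)[OF z(3,5)] by blast
      then show "z \<in> (\<Union>p\<in>?I. fst p \<times> snd p)"
        using z by (intro UN_I[of "(V', W')"]) auto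
    qed
    then have "U = (\<Union>p\<in>?I. fst p \<times> snd p)" by auto
    also have "\<dots> \<in> sets ?P"
    proof (rule sets.countable_UN')
      show "countable ?I" 
        using countable_SIGMA[OF \<B>(1) \<C>(1)] countable_subset[of ?I "\<B> \<times> \<C>"] by blast
    next
      show "(\<lambda>p. fst p \<times> snd p) ` ?I \<subseteq> sets ?P" 
        using \<B>(2) \<C>(2) by (auto intro!: pair_measureI openin_metric_borel)
    qed
    finally show ?thesis .
  qed
  moreover have "space ?P = mspace (l1_metric m m')" by (simp add: space_pair_measure)
  ultimately show "sets (metric_borel (l1_metric m m')) \<subseteq> sets ?P"
    using sets.sigma_sets_subset[of "{U. openin (mtopology_of (l1_metric m m')) U}" ?P]
    unfolding sets_metric_borel[of "l1_metric m m'"] by auto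
qed

lemma mm_sum_space:
  assumes "mm_space A" "mm_space B" shows "mm_space (mm_sum A B)"
proof -
  obtain m \<mu> m' \<mu>' where AB [simp]: "A = (m, \<mu>)" "B = (m', \<mu>')" by (metis surj_pair)
  have A: "mm_space (m, \<mu>)" and B: "mm_space (m', \<mu>')" using assms by auto
  note sA = mm_space_sets[OF A] and sB = mm_space_sets[OF B]
  interpret P: prob_space \<mu> using A by (rule mm_space_prob)
  interpret P': prob_space \<mu>' using B by (rule mm_space_prob)
  interpret PP: pair_prob_space \<mu> \<mu>' ..
  have sep: "separable_space (mtopology_of m)" "separable_space (mtopology_of m')"
    using A B by (auto simp: mm_space_def)
  have sets: "sets (\<mu> \<Otimes>\<^sub>M \<mu>') = sets (metric_borel (l1_metric m m'))"
    using sets_metric_borel_l1[OF sep] sets_pair_measure_cong[OF sA sB] by simp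
  have "measure (\<mu> \<Otimes>\<^sub>M \<mu>') U > 0" if U: "openin (mtopology_of (l1_metric m m')) U" "U \<noteq> {}" for U
  proof -
    obtain x y V W where V: "openin (mtopology_of m) V" "openin (mtopology_of m') W"
        "x \<in> V" "y \<in> W" "V \<times> W \<subseteq> U"
      using U unfolding mtopology_of_l1_metric openin_prod_topology_alt by (metis ex_in_conv surj_pair)
    have "measure \<mu> V > 0" "measure \<mu>' W > 0" 
      using A B V by (auto simp: mm_space_def)
    then have "0 < measure (\<mu> \<Otimes>\<^sub>M \<mu>') (V \<times> W)"
      using P'.emeasure_pair_measure_Times[of V \<mu> W] V(1,2) sA sB
      by (simp add: measure_def enn2real_mult openin_metric_borel)
    also have "\<dots> \<le> measure (\<mu> \<Otimes>\<^sub>M \<mu>') U"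
      using V U sets by (intro PP.P.finite_measure_mono) (auto intro!: openin_metric_borel)
    finally show ?thesis .
  qed
  then show ?thesis
    using A B sets mcomplete_of_l1_metric[of m m'] separable_prod_topology[OF sep] PP.P.prob_space_axioms
    by (auto simp: mm_sum_def mm_space_def mtopology_of_l1_metric)
qed

lemma mm_sum_cong:
  assumes "mm_space A" "mm_space B" "mm_space A'" "mm_space B'" "mm_iso A A'" "mm_iso B B'" 
  shows "mm_iso (mm_sum A B) (mm_sum A' B')"
proof -
  obtain m \<mu> n \<nu> m' \<mu>' n' \<nu>' where AB [simp]: "A = (m, \<mu>)" "B = (n, \<nu>)" "A' = (m', \<mu>')" "B' = (n', \<nu>')"
    by (metis surj_pair)
  obtain f g where f: "isometric_embedding m m' f" "f ` mspace m = mspace m'"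
      "distr \<mu> (metric_borel m') f = \<mu>'"
    and g: "isometric_embedding n n' g" "g ` mspace n = mspace n'"
      "distr \<nu> (metric_borel n') g = \<nu>'"
    using assms unfolding mm_iso_def by auto
  let ?h = "\<lambda>(x, y). (f x, g y)"
  have "mm_space (n', \<nu>')" "mm_space (m, \<mu>)" "mm_space (n, \<nu>)" using assms by auto
  note mm = this
  have "isometric_embedding (l1_metric m n) (l1_metric m' n') ?h"
    using f(1) g(1) by (auto simp: isometric_embedding_def)
  moreover have "?h ` mspace (l1_metric m n) = mspace (l1_metric m' n')"
    using f(2) g(2) by (simp add: image_paired_Times)
  moreover have "distr (\<mu> \<Otimes>\<^sub>M \<nu>) (metric_borel (l1_metric m' n')) ?h = \<mu>' \<Otimes>\<^sub>M \<nu>'"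
  proof -
    have "\<mu>' \<Otimes>\<^sub>M \<nu>' = distr (\<mu> \<Otimes>\<^sub>M \<nu>) (metric_borel m' \<Otimes>\<^sub>M metric_borel n') ?h"
      using pair_measure_distr[OF mm_space_measurable[OF mm(2) f(1)] mm_space_measurable[OF mm(3) g(1)]]
        prob_space_imp_sigma_finite[OF mm_space_prob[OF mm(1)]] f(3) g(3) by simp
    also have "\<dots> = distr (\<mu> \<Otimes>\<^sub>M \<nu>) (metric_borel (l1_metric m' n')) ?h"
      using assms by (intro distr_cong sets_metric_borel_l1[symmetric]) (auto simp: mm_space_def)
    finally show ?thesis ..
  qed
  ultimately show ?thesis unfolding mm_iso_def mm_sum_def by auto
qed

lemma mm_sum_commute:
  assumes "mm_space A" "mm_space B" shows "mm_iso (mm_sum A B) (mm_sum B A)"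
proof -
  obtain m \<mu> n \<nu> where [simp]: "A = (m, \<mu>)" "B = (n, \<nu>)" by (metis surj_pair)
  have A: "mm_space (m, \<mu>)" and B: "mm_space (n, \<nu>)" using assms by auto
  interpret P: prob_space \<mu> using A by (rule mm_space_prob)
  interpret P': prob_space \<nu> using B by (rule mm_space_prob)
  interpret PP: pair_prob_space \<nu> \<mu> ..
  let ?h = "\<lambda>(x, y). (y, x)"
  have "distr (\<mu> \<Otimes>\<^sub>M \<nu>) (metric_borel (l1_metric n m)) ?h = distr (\<mu> \<Otimes>\<^sub>M \<nu>) (\<nu> \<Otimes>\<^sub>M \<mu>) ?h"
    using mm_space_sets[OF mm_sum_space[OF assms(2,1), unfolded mm_sum_def, simplified]]
    by (intro distr_cong) auto
  also have "\<dots> = \<nu> \<Otimes>\<^sub>M \<mu>" by (rule PP.distr_pair_swap[symmetric])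
  finally show ?thesis
    unfolding mm_iso_def mm_sum_def
    by (auto intro!: exI[of _ ?h] simp: isometric_embedding_def)
qed

lemma distr_pair_assoc:
  assumes "prob_space M1" "prob_space M2" "prob_space M3"
  shows "distr ((M1 \<Otimes>\<^sub>M M2) \<Otimes>\<^sub>M M3) (M1 \<Otimes>\<^sub>M (M2 \<Otimes>\<^sub>M M3)) (\<lambda>((x, y), z). (x, (y, z))) 
    = M1 \<Otimes>\<^sub>M (M2 \<Otimes>\<^sub>M M3)" (is "?D = ?P")
proof -
  interpret M1: prob_space M1 by fact
  interpret M2: prob_space M2 by fact
  interpret M3: prob_space M3 by fact
  interpret M23: pair_prob_space M2 M3 ..
  interpret M12: pair_prob_space M1 M2 ..
  have "(\<lambda>w. (fst (fst w), (snd (fst w), snd w))) \<in> measurable ((M1 \<Otimes>\<^sub>M M2) \<Otimes>\<^sub>M M3) ?P" by measurable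
  then have [measurable]: "(\<lambda>((x, y), z). (x, (y, z))) \<in> measurable ((M1 \<Otimes>\<^sub>M M2) \<Otimes>\<^sub>M M3) ?P"
    by (simp add: case_prod_beta')
  have "M1 \<Otimes>\<^sub>M (M2 \<Otimes>\<^sub>M M3) = ?D"
  proof (rule pair_measure_eqI)
    fix A B assume A [measurable]: "A \<in> sets M1" and B [measurable]: "B \<in> sets (M2 \<Otimes>\<^sub>M M3)"
    have "emeasure ?D (A \<times> B) = 
        emeasure ((M1 \<Otimes>\<^sub>M M2) \<Otimes>\<^sub>M M3) ((\<lambda>((x, y), z). (x, (y, z))) -` (A \<times> B) \<inter> space ((M1 \<Otimes>\<^sub>M M2) \<Otimes>\<^sub>M M3))"
      by (rule emeasure_distr) measurable
    also have "\<dots> = (\<integral>\<^sup>+ xy. emeasure M3 (Pair xy -` ((\<lambda>((x, y), z). (x, (y, z))) -` (A \<times> B) \<inter> space ((M1 \<Otimes>\<^sub>M M2) \<Otimes>\<^sub>M M3))) \<partial>(M1 \<Otimes>\<^sub>M M2))"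
      by (rule M3.emeasure_pair_measure_alt) measurable
    also have "\<dots> = (\<integral>\<^sup>+ xy. indicator A (fst xy) * emeasure M3 (Pair (snd xy) -` B) \<partial>(M1 \<Otimes>\<^sub>M M2))"
    proof (rule nn_integral_cong)
      fix xy assume xy: "xy \<in> space (M1 \<Otimes>\<^sub>M M2)"
      have "Pair xy -` ((\<lambda>((x, y), z). (x, (y, z))) -` (A \<times> B) \<inter> space ((M1 \<Otimes>\<^sub>M M2) \<Otimes>\<^sub>M M3)) =
          (if fst xy \<in> A then Pair (snd xy) -` B else {})"
        using xy sets.sets_into_space[OF B] by (auto simp: space_pair_measure)
      then show "emeasure M3 (Pair xy -` ((\<lambda>((x, y), z). (x, (y, z))) -` (A \<times> B) \<inter> space ((M1 \<Otimes>\<^sub>M M2) \<Otimes>\<^sub>M M3))) =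
          indicator A (fst xy) * emeasure M3 (Pair (snd xy) -` B)"
        by simp
    qed
    also have "\<dots> = (\<integral>\<^sup>+ x. \<integral>\<^sup>+ y. indicator A x * emeasure M3 (Pair y -` B) \<partial>M2 \<partial>M1)"
    proof (subst M2.nn_integral_fst[symmetric])
      have [measurable]: "(\<lambda>xy. emeasure M3 (Pair (snd xy) -` B)) \<in> borel_measurable (M1 \<Otimes>\<^sub>M M2)"
        by (rule measurable_compose[OF measurable_snd M3.measurable_emeasure_Pair[OF B]])
      show "(\<lambda>xy. indicator A (fst xy) * emeasure M3 (Pair (snd xy) -` B)) \<in> borel_measurable (M1 \<Otimes>\<^sub>M M2)"
        by measurable
    qed simp
    also have "\<dots> = (\<integral>\<^sup>+ x. indicator A x * emeasure (M2 \<Otimes>\<^sub>M M3) B \<partial>M1)"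
      using M3.measurable_emeasure_Pair[OF B] 
      by (simp add: nn_integral_cmult M3.emeasure_pair_measure_alt[OF B])
    also have "\<dots> = emeasure M1 A * emeasure (M2 \<Otimes>\<^sub>M M3) B"
      by (simp add: nn_integral_multc)
    finally show "emeasure M1 A * emeasure (M2 \<Otimes>\<^sub>M M3) B = emeasure ?D (A \<times> B)" ..
  qed (auto intro: prob_space_imp_sigma_finite M1.prob_space_axioms M23.P.prob_space_axioms)
  then show ?thesis ..
qed

lemma mm_sum_assoc:
  assumes "mm_space A" "mm_space B" "mm_space C" 
  shows "mm_iso (mm_sum (mm_sum A B) C) (mm_sum A (mm_sum B C))"
proof -
  obtain m \<mu> n \<nu> l \<rho> where [simp]: "A = (m, \<mu>)" "B = (n, \<nu>)" "C = (l, \<rho>)" by (metis surj_pair)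
  have A: "mm_space (m, \<mu>)" and B: "mm_space (n, \<nu>)" and C: "mm_space (l, \<rho>)" using assms by auto
  let ?h = "\<lambda>((x, y), z). (x, (y, z))"
  have "distr ((\<mu> \<Otimes>\<^sub>M \<nu>) \<Otimes>\<^sub>M \<rho>) (metric_borel (l1_metric m (l1_metric n l))) ?h = 
      distr ((\<mu> \<Otimes>\<^sub>M \<nu>) \<Otimes>\<^sub>M \<rho>) (\<mu> \<Otimes>\<^sub>M (\<nu> \<Otimes>\<^sub>M \<rho>)) ?h"
    using mm_space_sets[OF mm_sum_space[OF assms(1) mm_sum_space[OF assms(2,3)], unfolded mm_sum_def, simplified]]
    by (intro distr_cong) auto
  also have "\<dots> = \<mu> \<Otimes>\<^sub>M (\<nu> \<Otimes>\<^sub>M \<rho>)" 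
    by (intro distr_pair_assoc mm_space_prob[OF A] mm_space_prob[OF B] mm_space_prob[OF C])
  finally show ?thesis
    unfolding mm_iso_def mm_sum_def
    by (auto intro!: exI[of _ ?h] simp: isometric_embedding_def image_iff)
qed

lemma Metric_space_point: "Metric_space (UNIV :: unit set) (\<lambda>_ _. 0)"
  by unfold_locales auto

lemma mspace_point [simp]: "mspace (metric (UNIV :: unit set, \<lambda>_ _. 0)) = UNIV"
  and mdist_point [simp]: "mdist (metric (UNIV :: unit set, \<lambda>_ _. 0)) = (\<lambda>_ _. 0)"
  using Metric_space.mspace_metric[OF Metric_space_point] Metric_space.mdist_metric[OF Metric_space_point] 
  by auto

lemma mm_point_space: "mm_space mm_point"
proof -
  let ?m = "metric (UNIV :: unit set, \<lambda>_ _. 0)"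
  have UNIV_eq: "U = UNIV" if "U \<noteq> {}" for U :: "unit set" using that by auto
  have "openin (mtopology_of ?m) U" for U
  proof (cases "U = {}")
    case False
    then have "U = topspace (mtopology_of ?m)" by (simp add: UNIV_eq[of U])
    then show ?thesis by (metis openin_topspace)
  qed simp
  then have "sets (metric_borel ?m) = UNIV"
    by (auto intro: openin_metric_borel)
  moreover have "mcomplete_of ?m"
    by (simp add: mcomplete_of_def Metric_space.mcomplete_def[OF Metric_space_point]
        Metric_space.limitin_metric[OF Metric_space_point])
  moreover have "separable_space (mtopology_of ?m)"
    unfolding separable_space_def 
    by (intro exI[of _ UNIV]) (use closure_of_topspace[of "mtopology_of ?m"] in auto)
  moreover have "measure (return (count_space UNIV) ()) U > 0" if "U \<noteq> {}" for U
    using UNIV_eq[OF that] by (simp add: measure_return)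
  ultimately show ?thesis
    by (auto simp: mm_point_def mm_space_def intro!: prob_space_return)
qed

lemma mm_sum_point:
  assumes "mm_space A" shows "mm_iso (mm_sum mm_point A) A"
proof -
  obtain m \<mu> where [simp]: "A = (m, \<mu>)" by (metis surj_pair)
  have A: "mm_space (m, \<mu>)" using assms by auto
  interpret P: prob_space \<mu> using A by (rule mm_space_prob)
  interpret E: prob_space "return (count_space (UNIV :: unit set)) ()" by (rule prob_space_return) simp
  have "distr (return (count_space UNIV) () \<Otimes>\<^sub>M \<mu>) (metric_borel m) snd = 
      distr (return (count_space UNIV) () \<Otimes>\<^sub>M \<mu>) \<mu> snd"
    using mm_space_sets[OF A] by (intro distr_cong) auto
  also have "\<dots> = \<mu>" 
  proof (rule measure_eqI)
    fix S assume "S \<in> sets (distr (return (count_space UNIV) () \<Otimes>\<^sub>M \<mu>) \<mu> snd)"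
    then have S: "S \<in> sets \<mu>" by simp
    have "snd -` S \<inter> space (return (count_space (UNIV :: unit set)) () \<Otimes>\<^sub>M \<mu>) = UNIV \<times> S"
      using sets.sets_into_space[OF S] by (auto simp: space_pair_measure)
    then show "emeasure (distr (return (count_space UNIV) () \<Otimes>\<^sub>M \<mu>) \<mu> snd) S = emeasure \<mu> S"
      using S by (simp add: emeasure_distr P.emeasure_pair_measure_Times)
  qed simp
  finally show ?thesis
    unfolding mm_iso_def mm_sum_def mm_point_def
    by (auto intro!: exI[of _ snd] simp: isometric_embedding_def)
qed



section \<open>Isomorphism classes\<close>

text \<open>
  A separable metric space has at most the cardinality of the continuum, so by
  \<open>mm_space_representative\<close> every metric measure space, over whatever type, has an isomorphic
  copy whose points are elements of \<^typ>\<open>nat \<Rightarrow> real\<close>. The set $\mathbb{M}$ is therefore the type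
  of isomorphism classes of such copies, and \<open>mm_class_of\<close> assigns to a space over any type its
  class.
\<close>

quotient_type mm_class = "(nat \<Rightarrow> real) mm_triple" / partial: "\<lambda>A B. mm_space A \<and> mm_space B \<and> mm_iso A B"
proof (rule part_equivpI)
  show "\<exists>A :: (nat \<Rightarrow> real) mm_triple. mm_space A \<and> mm_space A \<and> mm_iso A A"
    using mm_space_representative[OF mm_point_space] mm_iso_refl by blast
  show "symp (\<lambda>A B :: (nat \<Rightarrow> real) mm_triple. mm_space A \<and> mm_space B \<and> mm_iso A B)"
    by (rule sympI) (use mm_iso_sym in blast)
  show "transp (\<lambda>A B :: (nat \<Rightarrow> real) mm_triple. mm_space A \<and> mm_space B \<and> mm_iso A B)"
    by (rule transpI) (use mm_iso_trans in blast)
qed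

definition mm_class_of :: "'a mm_triple \<Rightarrow> mm_class" where
  "mm_class_of A = abs_mm_class (SOME B. mm_space B \<and> mm_iso A B)"

lemma mm_space_rep [simp]: "mm_space (rep_mm_class X)"
  using Quotient3_rep_reflp[OF Quotient3_mm_class, of X] by simp

lemma mm_class_of_eq_iff:
  assumes "mm_space A" "mm_space B" 
  shows "mm_class_of A = mm_class_of B \<longleftrightarrow> mm_iso A B"
proof -
  define A' :: "(nat \<Rightarrow> real) mm_triple" where "A' = (SOME C. mm_space C \<and> mm_iso A C)"
  define B' :: "(nat \<Rightarrow> real) mm_triple" where "B' = (SOME C. mm_space C \<and> mm_iso B C)"
  have A': "mm_space A'" "mm_iso A A'" 
    using someI_ex[OF mm_space_representative[OF assms(1)]] by (auto simp: A'_def)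
  have B': "mm_space B'" "mm_iso B B'" 
    using someI_ex[OF mm_space_representative[OF assms(2)]] by (auto simp: B'_def)
  have "mm_class_of A = mm_class_of B \<longleftrightarrow> mm_iso A' B'"
    using Quotient3_rel[OF Quotient3_mm_class, of A' B'] A'(1) B'(1)
      mm_iso_refl[OF A'(1)] mm_iso_refl[OF B'(1)]
    unfolding mm_class_of_def A'_def[symmetric] B'_def[symmetric] by blast
  also have "\<dots> \<longleftrightarrow> mm_iso A B"
    using A' B' assms mm_iso_trans mm_iso_sym by metis
  finally show ?thesis .
qed

lemma mm_class_of_rep [simp]: "mm_class_of (rep_mm_class X) = X"
proof -
  define B :: "(nat \<Rightarrow> real) mm_triple" where "B = (SOME B. mm_space B \<and> mm_iso (rep_mm_class X) B)"
  have B: "mm_space B" "mm_iso (rep_mm_class X) B"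
    using someI_ex[OF mm_space_representative[OF mm_space_rep, of X]] by (auto simp: B_def)
  then have "abs_mm_class (rep_mm_class X) = abs_mm_class B"
    using Quotient3_rel[OF Quotient3_mm_class, of "rep_mm_class X" B]
      mm_iso_refl[OF B(1)] mm_iso_refl[OF mm_space_rep[of X]] mm_space_rep[of X] by blast
  then show ?thesis
    unfolding mm_class_of_def B_def[symmetric] Quotient3_abs_rep[OF Quotient3_mm_class] by (rule sym)
qed

lemma mm_iso_rep: "mm_space A \<Longrightarrow> mm_iso A (rep_mm_class (mm_class_of A))"
  using mm_class_of_eq_iff[of A "rep_mm_class (mm_class_of A)"] by simp

text \<open>The operation $\boxplus$ is written \<open>+\<close>, and the class of one-point spaces is \<open>0\<close>.\<close>

instantiation mm_class :: comm_monoid_add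
begin

definition "0 = mm_class_of mm_point"

definition "X + Y = mm_class_of (mm_sum (rep_mm_class X) (rep_mm_class Y))"

lemma mm_class_of_sum:
  "mm_space A \<Longrightarrow> mm_space B \<Longrightarrow> mm_class_of (mm_sum A B) = mm_class_of A + mm_class_of B"
  unfolding plus_mm_class_def
  by (subst mm_class_of_eq_iff) (auto intro!: mm_sum_space mm_sum_cong mm_iso_rep)

instance
proof
  fix X Y Z :: mm_class
  let ?X = "rep_mm_class X" and ?Y = "rep_mm_class Y" and ?Z = "rep_mm_class Z"
  have "mm_class_of (mm_sum (mm_sum ?X ?Y) ?Z) = mm_class_of (mm_sum ?X (mm_sum ?Y ?Z))"
    by (subst mm_class_of_eq_iff) (auto intro!: mm_sum_space mm_sum_assoc)
  then show "X + Y + Z = X + (Y + Z)" by (simp add: mm_class_of_sum mm_sum_space)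
  have "mm_class_of (mm_sum ?X ?Y) = mm_class_of (mm_sum ?Y ?X)"
    by (subst mm_class_of_eq_iff) (auto intro!: mm_sum_space mm_sum_commute)
  then show "X + Y = Y + X" by (simp add: mm_class_of_sum)
  have "mm_class_of (mm_sum mm_point ?X) = mm_class_of ?X"
    by (subst mm_class_of_eq_iff) (auto intro!: mm_sum_space mm_sum_point mm_point_space)
  then show "0 + X = X" by (simp add: mm_class_of_sum mm_point_space zero_mm_class_def)
qed

end

definition mm_le :: "mm_class \<Rightarrow> mm_class \<Rightarrow> bool" (infix "\<preceq>" 50) where
  "Y \<preceq> Z \<longleftrightarrow> (\<exists>X. Z = Y + X)"

definition mm_irreducible :: "mm_class \<Rightarrow> bool" where
  "mm_irreducible X \<longleftrightarrow> X \<noteq> 0 \<and> (\<forall>Y. Y \<preceq> X \<longrightarrow> Y = 0 \<or> Y = X)"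

definition mm_prime :: "mm_class \<Rightarrow> bool" where
  "mm_prime X \<longleftrightarrow> X \<noteq> 0 \<and> (\<forall>Y Z. X \<preceq> Y + Z \<longrightarrow> X \<preceq> Y \<or> X \<preceq> Z)"


section \<open>The Gromov--Prohorov metric\<close>

definition thickening :: "'a metric \<Rightarrow> real \<Rightarrow> 'a set \<Rightarrow> 'a set" where
  "thickening m e A = (\<Union>a\<in>A. mball_of m a e)"

definition prohorov_dist :: "'a metric \<Rightarrow> 'a measure \<Rightarrow> 'a measure \<Rightarrow> real" where
  "prohorov_dist m \<mu> \<nu> = Inf {e. e > 0 \<and> (\<forall>A\<in>sets (metric_borel m).
     measure \<mu> A \<le> measure \<nu> (thickening m e A) + e \<and>
     measure \<nu> A \<le> measure \<mu> (thickening m e A) + e)}"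

text \<open>
  The ambient space may be taken over \<^typ>\<open>nat \<Rightarrow> real\<close>: by \<open>prohorov_ambient\<close> below, the Prohorov
  distance obtained in an ambient metric space over an arbitrary type is also obtained in one
  over \<^typ>\<open>nat \<Rightarrow> real\<close>.
\<close>

definition gpr_triple :: "'a mm_triple \<Rightarrow> 'b mm_triple \<Rightarrow> real" where
  "gpr_triple = (\<lambda>(m, \<mu>) (m', \<mu>').
     Inf {prohorov_dist z (distr \<mu> (metric_borel z) \<phi>) (distr \<mu>' (metric_borel z) \<psi>) 
       | (z :: (nat \<Rightarrow> real) metric) \<phi> \<psi>. 
         isometric_embedding m z \<phi> \<and> isometric_embedding m' z \<psi>})"

definition gromov_prohorov :: "mm_class \<Rightarrow> mm_class \<Rightarrow> real" where
  "gromov_prohorov X Y = gpr_triple (rep_mm_class X) (rep_mm_class Y)"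

definition mm_tendsto :: "(nat \<Rightarrow> mm_class) \<Rightarrow> mm_class \<Rightarrow> bool" where
  "mm_tendsto S X \<longleftrightarrow> (\<lambda>n. gromov_prohorov (S n) X) \<longlonglongrightarrow> 0"
lemma embedding_pullback:
  assumes "mm_space (k, \<kappa>)" "mm_iso (k, \<kappa>) (k', \<kappa>')" "isometric_embedding k' z \<phi>"
  shows "\<exists>\<phi>'. isometric_embedding k z \<phi>' \<and> distr \<kappa> (metric_borel z) \<phi>' = distr \<kappa>' (metric_borel z) \<phi>"
proof -
  obtain f where f: "isometric_embedding k k' f" "distr \<kappa> (metric_borel k') f = \<kappa>'"
    using assms(2) unfolding mm_iso_def by auto
  have "distr \<kappa>' (metric_borel z) \<phi> = distr \<kappa> (metric_borel z) (\<phi> \<circ> f)"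
    using distr_distr[OF isometric_embedding_measurable[OF assms(3)] mm_space_measurable[OF assms(1) f(1)]] f(2)
    by simp
  then show ?thesis using isometric_embedding_compose[OF f(1) assms(3)] by metis
qed

lemma gpr_triple_cong:
  assumes "mm_space A" "mm_space B" "mm_space A'" "mm_space B'" "mm_iso A A'" "mm_iso B B'"
  shows "gpr_triple A B = gpr_triple A' B'"
proof -
  obtain m \<mu> n \<nu> m' \<mu>' n' \<nu>' where AB: "A = (m, \<mu>)" "B = (n, \<nu>)" "A' = (m', \<mu>')" "B' = (n', \<nu>')"
    by (metis surj_pair)
  note mm = assms[unfolded AB]
  note sym = mm_iso_sym[OF mm(1,5)] mm_iso_sym[OF mm(2,6)]
  have "{prohorov_dist z (distr \<mu> (metric_borel z) \<phi>) (distr \<nu> (metric_borel z) \<psi>) 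
       | (z :: (nat \<Rightarrow> real) metric) \<phi> \<psi>. isometric_embedding m z \<phi> \<and> isometric_embedding n z \<psi>} =
    {prohorov_dist z (distr \<mu>' (metric_borel z) \<phi>) (distr \<nu>' (metric_borel z) \<psi>) 
       | (z :: (nat \<Rightarrow> real) metric) \<phi> \<psi>. isometric_embedding m' z \<phi> \<and> isometric_embedding n' z \<psi>}"
    (is "?L = ?R")
  proof (intro subset_antisym subsetI)
    fix x assume "x \<in> ?L"
    then obtain z :: "(nat \<Rightarrow> real) metric" and \<phi> \<psi> where 
      x: "x = prohorov_dist z (distr \<mu> (metric_borel z) \<phi>) (distr \<nu> (metric_borel z) \<psi>)"
      and emb: "isometric_embedding m z \<phi>" "isometric_embedding n z \<psi>" by blast
    obtain \<phi>' where "isometric_embedding m' z \<phi>'" 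
      "distr \<mu>' (metric_borel z) \<phi>' = distr \<mu> (metric_borel z) \<phi>"
      using embedding_pullback[OF mm(3) sym(1) emb(1)] by blast
    moreover obtain \<psi>' where "isometric_embedding n' z \<psi>'" 
      "distr \<nu>' (metric_borel z) \<psi>' = distr \<nu> (metric_borel z) \<psi>"
      using embedding_pullback[OF mm(4) sym(2) emb(2)] by blast
    ultimately show "x \<in> ?R" 
      unfolding mem_Collect_eq x by (intro exI[of _ z] exI[of _ \<phi>'] exI[of _ \<psi>']) simp
  next
    fix x assume "x \<in> ?R"
    then obtain z :: "(nat \<Rightarrow> real) metric" and \<phi> \<psi> where 
      x: "x = prohorov_dist z (distr \<mu>' (metric_borel z) \<phi>) (distr \<nu>' (metric_borel z) \<psi>)"
      and emb: "isometric_embedding m' z \<phi>" "isometric_embedding n' z \<psi>" by blast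
    obtain \<phi>' where "isometric_embedding m z \<phi>'" 
      "distr \<mu> (metric_borel z) \<phi>' = distr \<mu>' (metric_borel z) \<phi>"
      using embedding_pullback[OF mm(1,5) emb(1)] by blast
    moreover obtain \<psi>' where "isometric_embedding n z \<psi>'" 
      "distr \<nu> (metric_borel z) \<psi>' = distr \<nu>' (metric_borel z) \<psi>"
      using embedding_pullback[OF mm(2,6) emb(2)] by blast
    ultimately show "x \<in> ?L" 
      unfolding mem_Collect_eq x by (intro exI[of _ z] exI[of _ \<phi>'] exI[of _ \<psi>']) simp
  qed
  then show ?thesis by (simp add: gpr_triple_def AB)
qed

lemma gromov_prohorov_class_of:
  "mm_space A \<Longrightarrow> mm_space B \<Longrightarrow> gromov_prohorov (mm_class_of A) (mm_class_of B) = gpr_triple A B"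
  unfolding gromov_prohorov_def
  by (rule gpr_triple_cong) (auto intro: mm_iso_sym mm_iso_rep)


subsection \<open>Independence of the type of the ambient space\<close>

lemma openin_thickening: "openin (mtopology_of m) (thickening m e A)"
  unfolding thickening_def mtopology_of_def mball_of_def
  by (intro openin_Union) (auto intro: Metric_space.openin_mball)

lemma embedding_image_borel:
  assumes e: "isometric_embedding m' m e" and closed: "closedin (mtopology_of m) (e ` mspace m')"
    and A: "A \<in> sets (metric_borel m')"
  shows "e ` A \<in> sets (metric_borel m)"
  using A unfolding sets_metric_borel[of m']
proof (induction rule: sigma_sets.induct)
  case (Basic U)
  then have U: "openin (mtopology_of m') U" by simp
  interpret M': Metric_space "mspace m'" "mdist m'" by simp
  let ?I = "{(u, r). u \<in> U \<and> mball_of m' u r \<subseteq> U}"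
  have "openin (mtopology_of m) (\<Union>(u, r)\<in>?I. mball_of m (e u) r)"
    unfolding mtopology_of_def mball_of_def
    by (intro openin_Union) (auto intro: Metric_space.openin_mball)
  moreover have "e ` U = e ` mspace m' \<inter> (\<Union>(u, r)\<in>?I. mball_of m (e u) r)"
  proof (intro subset_antisym subsetI)
    fix x assume "x \<in> e ` U"
    then obtain u where u: "u \<in> U" "x = e u" by blast
    obtain r where r: "r > 0" "mball_of m' u r \<subseteq> U"
      using U u(1) unfolding mtopology_of_def M'.openin_mtopology mball_of_def by blast
    have um: "u \<in> mspace m'" using U u(1) openin_subset by fastforce
    then have "e u \<in> mball_of m (e u) r" 
      using e r(1) by (auto simp: isometric_embedding_def)
    then show "x \<in> e ` mspace m' \<inter> (\<Union>(u, r)\<in>?I. mball_of m (e u) r)"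
      using u r um by blast
  next
    fix x assume "x \<in> e ` mspace m' \<inter> (\<Union>(u, r)\<in>?I. mball_of m (e u) r)"
    then obtain y u r where y: "y \<in> mspace m'" "x = e y" "u \<in> U" "mball_of m' u r \<subseteq> U" 
      "e y \<in> mball_of m (e u) r" by blast
    have "u \<in> mspace m'" using U y(3) openin_subset by fastforce
    then have "y \<in> mball_of m' u r" 
      using e y(1,5) by (auto simp: isometric_embedding_def)
    then show "x \<in> e ` U" using y by blast
  qed
  ultimately show ?case
    using closedin_metric_borel[OF closed] openin_metric_borel[of m] by auto
next
  case (Compl A)
  then have "A \<subseteq> mspace m'"
    using sigma_sets_into_sp[of "{U. openin (mtopology_of m') U}" "mspace m'" A] openin_subset[of "mtopology_of m'"] 
    by auto
  then have "e ` (mspace m' - A) = e ` mspace m' - e ` A"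
    by (intro inj_on_image_set_diff[OF isometric_embedding_inj_on[OF e]]) auto
  then show ?case using Compl.IH closedin_metric_borel[OF closed] by auto
qed (auto simp: image_UN)

lemma prohorov_closed_embedding:
  assumes e: "isometric_embedding m' m e" and closed: "closedin (mtopology_of m) (e ` mspace m')"
    and \<mu>: "finite_measure \<mu>" "sets \<mu> = sets (metric_borel m')"
    and \<nu>: "finite_measure \<nu>" "sets \<nu> = sets (metric_borel m')"
  shows "prohorov_dist m (distr \<mu> (metric_borel m) e) (distr \<nu> (metric_borel m) e) = prohorov_dist m' \<mu> \<nu>"
proof -
  let ?P = "\<lambda>\<mu> \<nu> r. \<forall>A\<in>sets (metric_borel m'). measure \<mu> A \<le> measure \<nu> (thickening m' r A) + r"
  let ?Q = "\<lambda>\<mu> \<nu> r. \<forall>A\<in>sets (metric_borel m). measure (distr \<mu> (metric_borel m) e) A \<le> 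
      measure (distr \<nu> (metric_borel m) e) (thickening m r A) + r"
  have ball: "e x \<in> mball_of m (e a) r \<longleftrightarrow> x \<in> mball_of m' a r" 
    if "a \<in> mspace m'" "x \<in> mspace m'" for a x r
    using e that by (auto simp: isometric_embedding_def)
  have thick: "e -` thickening m r (e ` B) \<inter> mspace m' = thickening m' r B" if B: "B \<subseteq> mspace m'" for B r
  proof (intro subset_antisym subsetI)
    fix x assume x: "x \<in> e -` thickening m r (e ` B) \<inter> mspace m'"
    then obtain b where b: "b \<in> B" "e x \<in> mball_of m (e b) r" unfolding thickening_def by blast
    then have "x \<in> mball_of m' b r" using ball[of b x r] x B by blast
    with b(1) show "x \<in> thickening m' r B" unfolding thickening_def by blast
  next
    fix x assume "x \<in> thickening m' r B"
    then obtain b where b: "b \<in> B" "x \<in> mball_of m' b r" unfolding thickening_def by blast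
    then have x: "x \<in> mspace m'" by simp
    then have "e x \<in> mball_of m (e b) r" using ball[of b x r] b B by blast
    with b(1) x show "x \<in> e -` thickening m r (e ` B) \<inter> mspace m'" unfolding thickening_def by blast
  qed
  have *: "?P \<mu> \<nu> r \<longleftrightarrow> ?Q \<mu> \<nu> r" 
    if "sets \<mu> = sets (metric_borel m')" "sets \<nu> = sets (metric_borel m')" "finite_measure \<nu>" for \<mu> \<nu> r
  proof -
    interpret \<nu>: finite_measure \<nu> by fact
    have sp: "space \<mu> = mspace m'" "space \<nu> = mspace m'" 
      using sets_eq_imp_space_eq[OF that(1)] sets_eq_imp_space_eq[OF that(2)] by simp_all
    have meas: "e \<in> measurable \<mu> (metric_borel m)" "e \<in> measurable \<nu> (metric_borel m)"
      using isometric_embedding_measurable[OF e] 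
      by (simp_all add: measurable_cong_sets[OF that(1) refl] measurable_cong_sets[OF that(2) refl])
    have distr_thick: "measure (distr \<nu> (metric_borel m) e) (thickening m r A) = 
        measure \<nu> (e -` thickening m r A \<inter> mspace m')" for A
      using measure_distr[OF meas(2) openin_metric_borel[OF openin_thickening]] sp by simp
    show ?thesis
    proof (intro iffI ballI)
      fix A assume P: "?P \<mu> \<nu> r" and A: "A \<in> sets (metric_borel m)"
      let ?A = "e -` A \<inter> mspace m'"
      have A': "?A \<in> sets (metric_borel m')" 
        using measurable_sets[OF isometric_embedding_measurable[OF e] A] by simp
      have "measure (distr \<mu> (metric_borel m) e) A = measure \<mu> ?A"
        using measure_distr[OF meas(1) A] sp by simp
      also have "\<dots> \<le> measure \<nu> (thickening m' r ?A) + r" using P A' by blast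
      also have "measure \<nu> (thickening m' r ?A) \<le> measure \<nu> (e -` thickening m r A \<inter> mspace m')"
      proof (rule \<nu>.finite_measure_mono)
        show "thickening m' r ?A \<subseteq> e -` thickening m r A \<inter> mspace m'"
          unfolding thick[of ?A r, symmetric, simplified] by (auto simp: thickening_def)
        show "e -` thickening m r A \<inter> mspace m' \<in> sets \<nu>"
          using measurable_sets[OF meas(2) openin_metric_borel[OF openin_thickening]] sp by simp
      qed
      finally show "measure (distr \<mu> (metric_borel m) e) A \<le> 
          measure (distr \<nu> (metric_borel m) e) (thickening m r A) + r"
        by (simp add: distr_thick)
    next
      fix A assume Q: "?Q \<mu> \<nu> r" and A: "A \<in> sets (metric_borel m')"
      have sub: "A \<subseteq> mspace m'" using sets.sets_into_space[OF A] by simp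
      have eA: "e ` A \<in> sets (metric_borel m)" by (rule embedding_image_borel[OF e closed A])
      have "e -` (e ` A) \<inter> mspace m' = A"
        using isometric_embedding_inj_on[OF e] sub by (auto dest: inj_onD)
      then have "measure \<mu> A = measure (distr \<mu> (metric_borel m) e) (e ` A)"
        using measure_distr[OF meas(1) eA] sp by simp
      also have "\<dots> \<le> measure (distr \<nu> (metric_borel m) e) (thickening m r (e ` A)) + r"
        using Q eA by blast
      also have "e -` thickening m r (e ` A) \<inter> mspace m' = thickening m' r A"
        by (rule thick[OF sub])
      then have "measure (distr \<nu> (metric_borel m) e) (thickening m r (e ` A)) = measure \<nu> (thickening m' r A)"
        by (simp add: distr_thick)
      finally show "measure \<mu> A \<le> measure \<nu> (thickening m' r A) + r" .
    qed
  qed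
  show ?thesis
    unfolding prohorov_dist_def ball_conj_distrib
    using *[OF \<mu>(2) \<nu>(2,1)] *[OF \<nu>(2) \<mu>(2,1)] by simp
qed

lemma embedding_image_closed:
  assumes A: "mm_space (m, \<mu>)" and f: "isometric_embedding m z f"
  shows "closedin (mtopology_of z) (f ` mspace m)"
proof -
  let ?s = "submetric z (f ` mspace m)"
  have sub: "f ` mspace m \<subseteq> mspace z" using f by (auto simp: isometric_embedding_def)
  then have eq: "f ` mspace m = mspace ?s" by auto
  have "isometric_embedding m ?s f" using f by (auto simp: isometric_embedding_def)
  then have "mcomplete_of ?s"
    using mm_space_iso[OF A _ eq] by (auto simp: mm_space_def)
  interpret Z: Submetric "mspace z" "mdist z" "f ` mspace m" 
    using sub by (simp add: Submetric_def Submetric_axioms_def)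
  show ?thesis
    using Z.mcomplete_imp_closedin \<open>mcomplete_of ?s\<close> sub
    by (simp add: mcomplete_of_def mtopology_of_def Int_absorb2)
qed

lemma prohorov_ambient:
  fixes m :: "'a metric" and m' :: "'b metric" and z :: "'z metric"
  assumes A: "mm_space (m, \<mu>)" and B: "mm_space (m', \<mu>')"
    and \<phi>: "isometric_embedding m z \<phi>" and \<psi>: "isometric_embedding m' z \<psi>"
  shows "\<exists>(z' :: (nat \<Rightarrow> real) metric) \<phi>' \<psi>'.
    isometric_embedding m z' \<phi>' \<and> isometric_embedding m' z' \<psi>' \<and>
    prohorov_dist z' (distr \<mu> (metric_borel z') \<phi>') (distr \<mu>' (metric_borel z') \<psi>') =
    prohorov_dist z (distr \<mu> (metric_borel z) \<phi>) (distr \<mu>' (metric_borel z) \<psi>)"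
proof -
  let ?S = "\<phi> ` mspace m \<union> \<psi> ` mspace m'"
  let ?s = "submetric z ?S"
  have S: "?S \<subseteq> mspace z" using \<phi> \<psi> by (auto simp: isometric_embedding_def)
  have s: "mspace ?s = ?S" using S by auto
  have sep: "separable_space (mtopology_of m)" "separable_space (mtopology_of m')"
    using A B by (simp_all add: mm_space_def)
  obtain g :: "'a \<Rightarrow> nat \<Rightarrow> real" where g: "inj_on g (mspace m)"
    using separable_inj_sequences[OF sep(1)] by blast
  obtain g' :: "'b \<Rightarrow> nat \<Rightarrow> real" where g': "inj_on g' (mspace m')"
    using separable_inj_sequences[OF sep(2)] by blast
  define f where "f x = (if x \<in> \<phi> ` mspace m then case_nat 0 (g (inv_into (mspace m) \<phi> x))
     else case_nat (1 :: real) (g' (inv_into (mspace m') \<psi> x)))" for x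
  have case_nat_inj: "case_nat a h = case_nat b k \<longleftrightarrow> a = b \<and> h = k" for a b :: real and h k
  proof
    assume eq: "case_nat a h = case_nat b k"
    have "h n = k n" for n using fun_cong[OF eq, of "Suc n"] by simp
    then show "a = b \<and> h = k" using fun_cong[OF eq, of 0] by auto
  qed simp
  have inj: "inj_on f (mspace ?s)"
    unfolding s
  proof (rule inj_onI)
    fix x y assume xy: "x \<in> ?S" "y \<in> ?S" "f x = f y"
    show "x = y"
    proof (cases "x \<in> \<phi> ` mspace m")
      case True
      with xy have y: "y \<in> \<phi> ` mspace m" "g (inv_into (mspace m) \<phi> x) = g (inv_into (mspace m) \<phi> y)"
        by (auto simp: f_def case_nat_inj split: if_splits)
      then have "inv_into (mspace m) \<phi> x = inv_into (mspace m) \<phi> y"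
        using inj_onD[OF g] True by (meson inv_into_into)
      then show ?thesis using True y(1) by (metis f_inv_into_f)
    next
      case False
      with xy have x: "x \<in> \<psi> ` mspace m'" and y: "y \<in> \<psi> ` mspace m'" 
        and eq: "g' (inv_into (mspace m') \<psi> x) = g' (inv_into (mspace m') \<psi> y)"
        by (auto simp: f_def case_nat_inj split: if_splits)
      then have "inv_into (mspace m') \<psi> x = inv_into (mspace m') \<psi> y"
        using inj_onD[OF g' eq] by (meson inv_into_into)
      then show ?thesis using x y by (metis f_inv_into_f)
    qed
  qed
  obtain z' :: "(nat \<Rightarrow> real) metric" where f: "isometric_embedding ?s z' f" "f ` mspace ?s = mspace z'"
    using relabel_metric[OF inj] by blast
  let ?e = "inv_into (mspace ?s) f"
  note e = isometric_embedding_inv[OF f]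
  have incl: "isometric_embedding m ?s \<phi>" "isometric_embedding m' ?s \<psi>"
    using \<phi> \<psi> by (auto simp: isometric_embedding_def)
  have emb: "isometric_embedding m z' (f \<circ> \<phi>)" "isometric_embedding m' z' (f \<circ> \<psi>)"
    using incl f(1) isometric_embedding_compose by blast+
  have ez: "isometric_embedding z' z ?e" using e(1) by (auto simp: isometric_embedding_def)
  have closed: "closedin (mtopology_of z) (?e ` mspace z')"
    unfolding trans[OF e(2) s] by (intro closedin_Un embedding_image_closed[OF A \<phi>] embedding_image_closed[OF B \<psi>])
  have pull: "distr (distr \<kappa> (metric_borel z') (f \<circ> \<theta>)) (metric_borel z) ?e = distr \<kappa> (metric_borel z) \<theta>"
    if C: "mm_space (k, \<kappa>)" "isometric_embedding k ?s \<theta>" "isometric_embedding k z' (f \<circ> \<theta>)" 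
    for k :: "'k metric" and \<kappa> \<theta>
  proof -
    have "distr (distr \<kappa> (metric_borel z') (f \<circ> \<theta>)) (metric_borel z) ?e = 
        distr \<kappa> (metric_borel z) (?e \<circ> (f \<circ> \<theta>))"
      by (rule distr_distr[OF isometric_embedding_measurable[OF ez] mm_space_measurable[OF C(1,3)]])
    also have "\<dots> = distr \<kappa> (metric_borel z) \<theta>"
    proof (rule distr_cong)
      fix x assume "x \<in> space \<kappa>"
      then have "\<theta> x \<in> mspace ?s"
        using C(2) mm_space_space[OF C(1)] by (auto simp: isometric_embedding_def)
      then show "(?e \<circ> (f \<circ> \<theta>)) x = \<theta> x" using inj by simp
    qed simp_all
    finally show ?thesis .
  qed
  have "prohorov_dist z (distr (distr \<mu> (metric_borel z') (f \<circ> \<phi>)) (metric_borel z) ?e) 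
      (distr (distr \<mu>' (metric_borel z') (f \<circ> \<psi>)) (metric_borel z) ?e) = 
    prohorov_dist z' (distr \<mu> (metric_borel z') (f \<circ> \<phi>)) (distr \<mu>' (metric_borel z') (f \<circ> \<psi>))"
    using prob_space.prob_space_distr[OF mm_space_prob[OF A] mm_space_measurable[OF A emb(1)]]
      prob_space.prob_space_distr[OF mm_space_prob[OF B] mm_space_measurable[OF B emb(2)]]
    by (intro prohorov_closed_embedding[OF ez closed]) (auto simp: prob_space_def)
  then show ?thesis
    using emb unfolding pull[OF A incl(1) emb(1)] pull[OF B incl(2) emb(2)] by metis
qed

end

theory Submission
  imports Defs
begin

text \<open>
  Why irreducible elements are prime. In an $\ell_1$ sum $\mathcal{Y}\boxplus\mathcal{Z}$ the fibre through a
  base point in the direction of $\mathcal{Y}$ is a gated set: the distance from $x$ to any point of the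
  fibre is the distance to the projection of $x$ plus the distance from there. If one space is written as
  a sum in two ways, the projections onto the fibres through one common point are therefore four gate maps, and gate
  maps of gated sets with a common point commute (\<open>splitting_commute\<close>). Commuting projections cut
  both decompositions into the same four pieces, and the pieces are independent because each composite
  projection is a function of either of its two factors. This is the Riesz refinement property
  (\<open>refinement\<close>), from which primality is immediate.

  For an infinite sum with limit $\mathcal{Y}$, the set of spaces that have a fixed summand is
  closed (\<open>summand_of_limit\<close>), so each partial sum $\mathcal{S}_n$ is a summand of $\mathcal{Y}$. If
  $\mathcal{X}$ is irreducible and below no $\mathcal{Y}_n$, primality puts $\mathcal{X}$ into the
  complement of $\mathcal{S}_n$ for every $n$, that is $\mathcal{Y} = \mathcal{S}_n \boxplus \mathcal{X} \boxplus
  \mathcal{W}_n$. The largest mass that a set of diameter at most $r$ can carry is submultiplicative for $\boxplus$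
  and nearly continuous for the Gromov--Prohorov distance; since it is below 1 for $\mathcal{X}$ at small
  scales, such a decomposition for all $n$ would make it vanish for $\mathcal{Y}$
  (\<open>constant_tail_zero\<close>), which is absurd.

  The proof that having a given summand is a closed property avoids compactness theorems. If
  $\mathcal{A}\boxplus\mathcal{T}_n$ converges to $\mathcal{Y}$, the points of $\mathcal{Y}$ are the limits, along an
  ultrafilter, of sequences of points of the approximating spaces. Such a sequence converges exactly if the balls
  around its members keep their mass. In a sum this condition can be checked coordinatewise, so the
  coordinate in $\mathcal{A}$ converges too and may be replaced by an arbitrary
  point of $\mathcal{A}$. This defines on $\mathcal{Y}$ a projection to $\mathcal{A}$ and a
  retraction onto a fibre, which together are the required decomposition.
\<close>

section \<open>Recognising sums\<close>

lemma mdist_self [simp]: "x \<in> mspace m \<Longrightarrow> mdist m x x = 0"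
  by simp

definition short_map :: "'a metric \<Rightarrow> 'b metric \<Rightarrow> ('a \<Rightarrow> 'b) \<Rightarrow> bool" where
  "short_map m m' f \<longleftrightarrow> f \<in> mspace m \<rightarrow> mspace m' \<and>
     (\<forall>x\<in>mspace m. \<forall>y\<in>mspace m. mdist m' (f x) (f y) \<le> mdist m x y)"

lemma short_map_continuous:
  "short_map m m' f \<Longrightarrow> continuous_map (mtopology_of m) (mtopology_of m') f"
  by (intro Lipschitz_continuous_imp_continuous_map)
    (auto simp: short_map_def Lipschitz_continuous_map_def intro!: exI[of _ 1])

lemma short_map_open_preimage:
  assumes "short_map m m' f" "openin (mtopology_of m') V" 
  shows "openin (mtopology_of m) {x \<in> mspace m. f x \<in> V}"
  using openin_continuous_map_preimage[OF short_map_continuous[OF assms(1)] assms(2)] by simp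

lemma short_map_measurable:
  assumes "mm_space (m, \<mu>)" "short_map m m' f" shows "f \<in> measurable \<mu> (metric_borel m')"
  using continuous_map_measurable[OF short_map_continuous[OF assms(2)]]
  unfolding measurable_cong_sets[OF mm_space_sets[OF assms(1)] refl] .

text \<open>
  Rectangles of open sets are stable under intersection and generate the Borel sets of the sum,
  because both summands are separable. So the product formula on such rectangles
  already identifies the measure.
\<close>

lemma mm_sum_criterion:
  assumes X: "mm_space (m, \<mu>)" and Y: "mm_space (m1, \<mu>1)" and Z: "mm_space (m2, \<mu>2)"
    and f: "f \<in> mspace m \<rightarrow> mspace m1" and g: "g \<in> mspace m \<rightarrow> mspace m2"
    and dist: "\<And>x y. x \<in> mspace m \<Longrightarrow> y \<in> mspace m \<Longrightarrow>
      mdist m x y = mdist m1 (f x) (f y) + mdist m2 (g x) (g y)"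
    and onto: "\<And>p q. p \<in> mspace m1 \<Longrightarrow> q \<in> mspace m2 \<Longrightarrow> \<exists>x\<in>mspace m. f x = p \<and> g x = q"
    and prod: "\<And>V W. openin (mtopology_of m1) V \<Longrightarrow> openin (mtopology_of m2) W \<Longrightarrow>
      measure \<mu> {x \<in> mspace m. f x \<in> V \<and> g x \<in> W} = measure \<mu>1 V * measure \<mu>2 W"
  shows "mm_iso (m, \<mu>) (mm_sum (m1, \<mu>1) (m2, \<mu>2))"
proof -
  let ?h = "\<lambda>x. (f x, g x)" and ?l = "l1_metric m1 m2"
  note sX = mm_space_sets[OF X] and sY = mm_space_sets[OF Y] and sZ = mm_space_sets[OF Z]
  have sep: "separable_space (mtopology_of m1)" "separable_space (mtopology_of m2)"
    using Y Z by (auto simp: mm_space_def)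
  have h: "isometric_embedding m ?l ?h"
    using f g dist by (auto simp: isometric_embedding_def)
  have "?h ` mspace m = mspace ?l"
  proof
    show "?h ` mspace m \<subseteq> mspace ?l" using f g by auto
    show "mspace ?l \<subseteq> ?h ` mspace m"
    proof clarsimp
      fix p q assume "p \<in> mspace m1" "q \<in> mspace m2"
      from onto[OF this] show "(p, q) \<in> ?h ` mspace m" by auto
    qed
  qed
  moreover have "distr \<mu> (metric_borel ?l) ?h = \<mu>1 \<Otimes>\<^sub>M \<mu>2"
  proof -
    interpret P: prob_space \<mu> by (rule mm_space_prob[OF X])
    interpret P1: prob_space \<mu>1 by (rule mm_space_prob[OF Y])
    interpret P2: prob_space \<mu>2 by (rule mm_space_prob[OF Z])
    interpret PP: pair_prob_space \<mu>1 \<mu>2 ..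
    let ?E = "{V \<times> W | V W. V \<in> {V. openin (mtopology_of m1) V} \<and> W \<in> {W. openin (mtopology_of m2) W}}"
    have hm: "?h \<in> measurable \<mu> (metric_borel ?l)" by (rule mm_space_measurable[OF X h])
    have sets12: "sets (\<mu>1 \<Otimes>\<^sub>M \<mu>2) = sets (metric_borel m1 \<Otimes>\<^sub>M metric_borel m2)"
      by (rule sets_pair_measure_cong[OF sY sZ])
    have top: "openin (mtopology_of m1) (mspace m1)" "openin (mtopology_of m2) (mspace m2)"
      using openin_topspace[of "mtopology_of m1"] openin_topspace[of "mtopology_of m2"] by simp_all
    have open_sub: "V \<subseteq> mspace m1" if "openin (mtopology_of m1) V" for V
      using openin_subset[OF that] by simp
    have open_sub': "V \<subseteq> mspace m2" if "openin (mtopology_of m2) V" for V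
      using openin_subset[OF that] by simp
    have E_sub: "?E \<subseteq> Pow (mspace m1 \<times> mspace m2)" using open_sub open_sub' by fastforce
    have "sets (metric_borel m1 \<Otimes>\<^sub>M metric_borel m2) = 
        sets (sigma (space (metric_borel m1) \<times> space (metric_borel m2)) ?E)"
      by (rule sets_pair_eq[of _ _ "{mspace m1}" _ _ "{mspace m2}"])
        (use open_sub open_sub' top in \<open>auto simp: sets_metric_borel\<close>)
    then have gen: "sets (metric_borel m1 \<Otimes>\<^sub>M metric_borel m2) = sigma_sets (mspace m1 \<times> mspace m2) ?E"
      using E_sub by (simp add: sets_measure_of)
    have sets_l: "sets (metric_borel ?l) = sigma_sets (mspace m1 \<times> mspace m2) ?E"
      using sets_metric_borel_l1[OF sep] gen by simp
    show ?thesis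
    proof (rule measure_eqI_generator_eq[where E = ?E and \<Omega> = "mspace m1 \<times> mspace m2" 
          and A = "\<lambda>_. mspace m1 \<times> mspace m2"])
      show "Int_stable ?E"
      proof (rule Int_stableI)
        fix P Q assume "P \<in> ?E" "Q \<in> ?E"
        then obtain V W V' W' where "P = V \<times> W" "Q = V' \<times> W'"
          "openin (mtopology_of m1) V" "openin (mtopology_of m2) W"
          "openin (mtopology_of m1) V'" "openin (mtopology_of m2) W'" by blast
        then have "P \<inter> Q = (V \<inter> V') \<times> (W \<inter> W')" "openin (mtopology_of m1) (V \<inter> V')" 
          "openin (mtopology_of m2) (W \<inter> W')" by auto
        then show "P \<inter> Q \<in> ?E" by blast
      qed
      show "?E \<subseteq> Pow (mspace m1 \<times> mspace m2)" by (rule E_sub)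
      show "range (\<lambda>_. mspace m1 \<times> mspace m2) \<subseteq> ?E" using top by auto
      show "sets (distr \<mu> (metric_borel ?l) ?h) = sigma_sets (mspace m1 \<times> mspace m2) ?E"
        using sets_l by simp
      show "sets (\<mu>1 \<Otimes>\<^sub>M \<mu>2) = sigma_sets (mspace m1 \<times> mspace m2) ?E"
        using sets12 gen by simp
      show "emeasure (distr \<mu> (metric_borel ?l) ?h) (mspace m1 \<times> mspace m2) \<noteq> \<infinity>" for i :: nat
        using prob_space.finite_measure[OF P.prob_space_distr[OF hm]] finite_measure.emeasure_finite
        by auto
      fix R assume "R \<in> ?E"
      then obtain V W where R: "R = V \<times> W" "openin (mtopology_of m1) V" "openin (mtopology_of m2) W"
        by blast
      then have VW: "V \<in> sets \<mu>1" "W \<in> sets \<mu>2" by (simp_all add: sY sZ openin_metric_borel)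
      have "R \<in> sets (metric_borel ?l)" using \<open>R \<in> ?E\<close> unfolding sets_l by blast
      then have "emeasure (distr \<mu> (metric_borel ?l) ?h) R = emeasure \<mu> (?h -` R \<inter> space \<mu>)"
        by (rule emeasure_distr[OF hm])
      also have "?h -` R \<inter> space \<mu> = {x \<in> mspace m. f x \<in> V \<and> g x \<in> W}"
        using mm_space_space[OF X] R(1) by auto
      also have "emeasure \<mu> \<dots> = ennreal (measure \<mu>1 V * measure \<mu>2 W)"
        by (simp add: P.emeasure_eq_measure prod R)
      also have "\<dots> = emeasure (\<mu>1 \<Otimes>\<^sub>M \<mu>2) R"
        using VW by (simp add: R(1) P2.emeasure_pair_measure_Times P1.emeasure_eq_measure 
            P2.emeasure_eq_measure ennreal_mult)
      finally show "emeasure (distr \<mu> (metric_borel ?l) ?h) R = emeasure (\<mu>1 \<Otimes>\<^sub>M \<mu>2) R" .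
    qed auto
  qed
  ultimately show ?thesis using h by (auto simp: mm_iso_def mm_sum_def)
qed

section \<open>Retracts\<close>

definition short_retraction :: "'a metric \<Rightarrow> ('a \<Rightarrow> 'a) \<Rightarrow> bool" where
  "short_retraction m f \<longleftrightarrow> short_map m m f \<and> (\<forall>x\<in>mspace m. f (f x) = f x)"

text \<open>
  Summands of a space are realised inside the space itself, as images of retractions carrying the law
  of the retraction. Then the summands of two decompositions live on the same type and can be
  compared point by point.
\<close>

definition mm_retract :: "'a mm_triple \<Rightarrow> ('a \<Rightarrow> 'a) \<Rightarrow> 'a mm_triple" where
  "mm_retract = (\<lambda>(m, \<mu>) f. (submetric m (f ` mspace m), 
     distr \<mu> (metric_borel (submetric m (f ` mspace m))) f))"

lemma mm_retract_cong:
  assumes "mm_space (m, \<mu>)" "\<And>x. x \<in> mspace m \<Longrightarrow> f x = g x"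
  shows "mm_retract (m, \<mu>) f = mm_retract (m, \<mu>) g"
proof -
  have "f ` mspace m = g ` mspace m" using assms(2) by simp
  then show ?thesis
    using assms(2) mm_space_space[OF assms(1)] by (auto simp: mm_retract_def intro!: distr_cong)
qed

lemma short_retraction_image:
  "short_retraction m f \<Longrightarrow> f ` mspace m \<subseteq> mspace m"
  "short_retraction m f \<Longrightarrow> f ` mspace m = {x \<in> mspace m. f x = x}"
  by (auto simp: short_retraction_def short_map_def image_iff)
    (metis)

text \<open>
  Completeness holds because the image is the set of fixed points of \<open>f\<close>, hence closed.
\<close>

lemma mm_space_retract:
  assumes X: "mm_space (m, \<mu>)" and f: "short_retraction m f"
  shows "mm_space (mm_retract (m, \<mu>) f)" 
    "short_map m (submetric m (f ` mspace m)) f"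
proof -
  let ?S = "f ` mspace m" let ?s = "submetric m ?S"
  note im = short_retraction_image[OF f]
  have ms: "mspace ?s = ?S" using im(1) by auto
  show f': "short_map m ?s f" using f im(1) by (auto simp: short_retraction_def short_map_def)
  have fc: "continuous_map (mtopology_of m) (mtopology_of ?s) f"
    by (rule short_map_continuous[OF f'])
  have fmeas: "f \<in> measurable \<mu> (metric_borel ?s)" by (rule short_map_measurable[OF X f'])
  interpret P: prob_space \<mu> by (rule mm_space_prob[OF X])
  have "closedin (mtopology_of m) ?S"
  proof -
    have "Hausdorff_space (mtopology_of m)"
      using Metric_space.Hausdorff_space_mtopology[OF Metric_space_mspace_mdist[of m]] 
      by (simp add: mtopology_of_def)
    then have "closedin (mtopology_of m) {x \<in> topspace (mtopology_of m). f x = id x}"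
      using f by (intro closedin_continuous_maps_eq short_map_continuous) 
        (auto simp: short_retraction_def intro: short_map_continuous)
    then show ?thesis using im(2) by simp
  qed
  then have "mcomplete_of ?s"
    using X Submetric.closedin_mcomplete_imp_mcomplete[of "mspace m" "mdist m" ?S] im(1)
    by (auto simp: mm_space_def mcomplete_of_def mtopology_of_def Submetric_def Submetric_axioms_def
        Int_absorb2)
  moreover have "separable_space (mtopology_of ?s)"
  proof (rule separable_space_continuous_map_image[OF _ fc])
    show "separable_space (mtopology_of m)" using X by (simp add: mm_space_def)
    show "f ` topspace (mtopology_of m) = topspace (mtopology_of ?s)"
      unfolding topspace_mtopology_of ms ..
  qed
  moreover have "measure (distr \<mu> (metric_borel ?s) f) U > 0" 
    if U: "openin (mtopology_of ?s) U" "U \<noteq> {}" for U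
  proof -
    have "openin (mtopology_of m) {x \<in> mspace m. f x \<in> U}"
      using openin_continuous_map_preimage[OF fc U(1)] by simp
    moreover have "{x \<in> mspace m. f x \<in> U} \<noteq> {}"
    proof -
      obtain y where y: "y \<in> U" using U(2) by blast
      have "U \<subseteq> f ` mspace m" using openin_subset[OF U(1)] unfolding topspace_mtopology_of ms .
      with y show ?thesis by blast
    qed
    ultimately have "measure \<mu> {x \<in> mspace m. f x \<in> U} > 0" using X by (simp add: mm_space_def)
    moreover have "{x \<in> mspace m. f x \<in> U} = f -` U \<inter> space \<mu>"
      using mm_space_space[OF X] by auto
    ultimately show ?thesis 
      using measure_distr[OF fmeas openin_metric_borel[OF U(1)]] by simp
  qed
  ultimately show "mm_space (mm_retract (m, \<mu>) f)"
    using P.prob_space_distr[OF fmeas] by (simp add: mm_retract_def mm_space_def)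
qed

section \<open>Splittings and their common refinement\<close>

text \<open>
  A decomposition of a space into two summands, seen from a base point \<open>e\<close>: \<open>\<alpha>\<close> replaces the
  second coordinate of a point by that of \<open>e\<close>, and \<open>\<beta>\<close> the first one.
\<close>

locale splitting =
  fixes m :: "'a metric" and \<mu> :: "'a measure" and e :: 'a and \<alpha> \<beta> :: "'a \<Rightarrow> 'a"
  assumes X: "mm_space (m, \<mu>)" and e: "e \<in> mspace m"
    and maps: "\<alpha> \<in> mspace m \<rightarrow> mspace m" "\<beta> \<in> mspace m \<rightarrow> mspace m"
    and dist: "\<And>x y. x \<in> mspace m \<Longrightarrow> y \<in> mspace m \<Longrightarrow>
      mdist m x y = mdist m (\<alpha> x) (\<alpha> y) + mdist m (\<beta> x) (\<beta> y)"
    and idem: "\<And>x. x \<in> mspace m \<Longrightarrow> \<alpha> (\<alpha> x) = \<alpha> x" "\<And>x. x \<in> mspace m \<Longrightarrow> \<beta> (\<beta> x) = \<beta> x"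
    and zero: "\<And>x. x \<in> mspace m \<Longrightarrow> \<alpha> (\<beta> x) = e" "\<And>x. x \<in> mspace m \<Longrightarrow> \<beta> (\<alpha> x) = e"
    and onto: "\<And>p q. p \<in> mspace m \<Longrightarrow> q \<in> mspace m \<Longrightarrow> \<exists>x\<in>mspace m. \<alpha> x = \<alpha> p \<and> \<beta> x = \<beta> q"
    and indep: "\<And>V W. V \<in> sets (metric_borel m) \<Longrightarrow> W \<in> sets (metric_borel m) \<Longrightarrow> 
      measure \<mu> {x \<in> mspace m. \<alpha> x \<in> V \<and> \<beta> x \<in> W} = 
      measure \<mu> {x \<in> mspace m. \<alpha> x \<in> V} * measure \<mu> {x \<in> mspace m. \<beta> x \<in> W}"
begin

lemma swap: "splitting m \<mu> e \<beta> \<alpha>"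
proof
  show "\<exists>x\<in>mspace m. \<beta> x = \<beta> p \<and> \<alpha> x = \<alpha> q" if "p \<in> mspace m" "q \<in> mspace m" for p q
    using onto[OF that(2,1)] by blast
  show "measure \<mu> {x \<in> mspace m. \<beta> x \<in> V \<and> \<alpha> x \<in> W} = 
      measure \<mu> {x \<in> mspace m. \<beta> x \<in> V} * measure \<mu> {x \<in> mspace m. \<alpha> x \<in> W}"
    if "V \<in> sets (metric_borel m)" "W \<in> sets (metric_borel m)" for V W
    using indep[OF that(2,1)] by (simp add: conj_commute mult.commute)
qed (use X e maps dist idem zero in \<open>auto simp: add.commute\<close>)

lemma retraction: "short_retraction m \<alpha>" "short_retraction m \<beta>"
  using maps idem dist by (auto simp: short_retraction_def short_map_def)

text \<open>
  The image of \<open>\<alpha>\<close> is a gated set with gate map \<open>\<alpha>\<close>: whoever goes from \<open>x\<close> to a point of the fibre loses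
  nothing by passing through \<open>\<alpha> x\<close>. This is where the $\ell_1$ form of the metric on a sum enters.
\<close>

lemma gate:
  assumes "x \<in> mspace m" "y \<in> mspace m" "\<alpha> y = y"
  shows "mdist m x y = mdist m x (\<alpha> x) + mdist m (\<alpha> x) y"
proof -
  have ax: "\<alpha> x \<in> mspace m" using assms maps by auto
  have "\<beta> y = e" using zero(2)[OF assms(2)] assms(3) by simp
  then have "mdist m x y = mdist m (\<alpha> x) y + mdist m (\<beta> x) e"
    using dist[OF assms(1,2)] assms(3) by simp
  moreover have "mdist m x (\<alpha> x) = mdist m (\<beta> x) e"
    using dist[OF assms(1) ax] idem(1)[OF assms(1)] zero(2)[OF assms(1)] ax by simp
  ultimately show ?thesis by simp
qed

lemma base: "\<alpha> e = e" "\<beta> e = e"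
  using zero[OF e] idem(1)[of "\<beta> e"] idem(2)[of "\<alpha> e"] maps e by (metis PiE)+

end

text \<open>
  Both composites are the gate map of the intersection of the two fibres. A point \<open>y\<close> that \<open>\<gamma>\<close> fixes is
  sent by \<open>\<alpha>\<close> to a point with the same property: otherwise the shortest way from \<open>y\<close> to \<open>e\<close>, which may pass
  through \<open>\<alpha> y\<close>, could be shortened by passing through \<open>\<gamma> (\<alpha> y)\<close> instead. Hence \<open>\<alpha> (\<gamma> x)\<close> and \<open>\<gamma> (\<alpha> x)\<close> lie in both
  fibres, and applying both gate maps in turn shows that each of them is farther from \<open>x\<close> than
  the other by their mutual distance, which is therefore 0.
\<close>

lemma splitting_commute:
  assumes "splitting m \<mu> e \<alpha> \<beta>" "splitting m \<mu> e \<gamma> \<delta>" and x: "x \<in> mspace m"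
  shows "\<alpha> (\<gamma> x) = \<gamma> (\<alpha> x)"
proof -
  interpret A: splitting m \<mu> e \<alpha> \<beta> by fact
  interpret C: splitting m \<mu> e \<gamma> \<delta> by fact
  have mem: "\<alpha> y \<in> mspace m" "\<gamma> y \<in> mspace m" if "y \<in> mspace m" for y
    using that A.maps C.maps by auto
  have fixed: "\<gamma> (\<alpha> y) = \<alpha> y"
    if st: "splitting m \<mu> e \<alpha> \<beta>" "splitting m \<mu> e \<gamma> \<delta>" 
      and y: "y \<in> mspace m" "\<gamma> y = y" for y \<alpha> \<beta> \<gamma> \<delta>
  proof -
    interpret A: splitting m \<mu> e \<alpha> \<beta> by fact
    interpret C: splitting m \<mu> e \<gamma> \<delta> by fact
    have ay: "\<alpha> y \<in> mspace m" and cay: "\<gamma> (\<alpha> y) \<in> mspace m" using A.maps C.maps y by auto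
    have "mdist m y e = mdist m y (\<alpha> y) + mdist m (\<alpha> y) e"
      using A.gate[OF y(1) A.e] A.base by simp
    moreover have "mdist m (\<alpha> y) e = mdist m (\<alpha> y) (\<gamma> (\<alpha> y)) + mdist m (\<gamma> (\<alpha> y)) e"
      using C.gate[OF ay C.e] C.base by simp
    moreover have "mdist m (\<alpha> y) y = mdist m (\<alpha> y) (\<gamma> (\<alpha> y)) + mdist m (\<gamma> (\<alpha> y)) y"
      using C.gate[OF ay y(1,2)] by simp
    moreover have "mdist m y e \<le> mdist m y (\<gamma> (\<alpha> y)) + mdist m (\<gamma> (\<alpha> y)) e"
      using y cay A.e by (intro mdist_triangle) auto
    ultimately have "mdist m (\<alpha> y) (\<gamma> (\<alpha> y)) = 0"
      using mdist_nonneg[of m "\<alpha> y" "\<gamma> (\<alpha> y)"] by (simp add: mdist_commute)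
    then show ?thesis using ay cay by simp
  qed
  let ?p = "\<alpha> (\<gamma> x)" and ?q = "\<gamma> (\<alpha> x)"
  have pm: "?p \<in> mspace m" "?q \<in> mspace m" using mem x by auto
  have p: "\<gamma> ?p = ?p" "\<alpha> ?p = ?p"
    using fixed[OF assms(1,2), of "\<gamma> x"] mem x C.idem(1)[OF x] A.idem(1)[of "\<gamma> x"] by auto
  have q: "\<alpha> ?q = ?q" "\<gamma> ?q = ?q"
    using fixed[OF assms(2,1), of "\<alpha> x"] mem x A.idem(1)[OF x] C.idem(1)[of "\<alpha> x"] by auto
  have "mdist m x ?q = mdist m x (\<gamma> x) + mdist m (\<gamma> x) ?p + mdist m ?p ?q"
    using C.gate[OF x pm(2) q(2)] A.gate[OF mem(2)[OF x] pm(2) q(1)] by simp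
  moreover have "mdist m x ?p \<le> mdist m x (\<gamma> x) + mdist m (\<gamma> x) ?p"
    using x mem pm by (intro mdist_triangle) auto
  moreover have "mdist m x ?p = mdist m x (\<alpha> x) + mdist m (\<alpha> x) ?q + mdist m ?q ?p"
    using A.gate[OF x pm(1) p(2)] C.gate[OF mem(1)[OF x] pm(1) p(1)] by simp
  moreover have "mdist m x ?q \<le> mdist m x (\<alpha> x) + mdist m (\<alpha> x) ?q"
    using x mem pm by (intro mdist_triangle) auto
  ultimately have "mdist m ?p ?q = 0"
    using mdist_nonneg[of m ?p ?q] mdist_commute[of m ?p ?q] by linarith
  then show ?thesis using pm by simp
qed

lemma short_retraction_compose:
  assumes "short_retraction m f" "short_retraction m g" "\<And>x. x \<in> mspace m \<Longrightarrow> f (g x) = g (f x)"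
  shows "short_retraction m (\<lambda>x. f (g x))"
proof -
  have mem: "f x \<in> mspace m" "g x \<in> mspace m" if "x \<in> mspace m" for x
    using assms that by (auto simp: short_retraction_def short_map_def)
  have le: "mdist m (f x) (f y) \<le> mdist m x y" "mdist m (g x) (g y) \<le> mdist m x y"
    if "x \<in> mspace m" "y \<in> mspace m" for x y
    using assms that by (auto simp: short_retraction_def short_map_def)
  have "mdist m (f (g x)) (f (g y)) \<le> mdist m x y" if "x \<in> mspace m" "y \<in> mspace m" for x y
    using le(1)[OF mem(2) mem(2), OF that] le(2)[OF that] by simp
  moreover have "f (g (f (g x))) = f (g x)" if "x \<in> mspace m" for x
    using assms mem that by (simp add: short_retraction_def flip: assms(3))
  ultimately show ?thesis using mem by (auto simp: short_retraction_def short_map_def)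
qed

text \<open>
  With \<open>f\<close> a projection of another splitting, this cuts the summand given by \<open>f\<close> into two pieces. The
  restrictions of \<open>\<gamma>\<close> and \<open>\<delta>\<close> to the image of \<open>f\<close> remain independent, since commutation makes
  \<open>\<gamma> (f x)\<close> a function of \<open>\<gamma> x\<close> and \<open>\<delta> (f x)\<close> a function of \<open>\<delta> x\<close>.
\<close>

lemma mm_retract_splitting:
  assumes S: "splitting m \<mu> e \<gamma> \<delta>" and f: "short_retraction m f"
    and c: "\<And>x. x \<in> mspace m \<Longrightarrow> f (\<gamma> x) = \<gamma> (f x)" "\<And>x. x \<in> mspace m \<Longrightarrow> f (\<delta> x) = \<delta> (f x)"
  shows "mm_class_of (mm_retract (m, \<mu>) f) = 
    mm_class_of (mm_retract (m, \<mu>) (\<lambda>x. f (\<gamma> x))) + mm_class_of (mm_retract (m, \<mu>) (\<lambda>x. f (\<delta> x)))"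
proof -
  interpret S: splitting m \<mu> e \<gamma> \<delta> by fact
  let ?fg = "\<lambda>x. f (\<gamma> x)" and ?fd = "\<lambda>x. f (\<delta> x)"
  have rg: "short_retraction m ?fg" and rd: "short_retraction m ?fd"
    using short_retraction_compose[OF f S.retraction(1) c(1)] 
      short_retraction_compose[OF f S.retraction(2) c(2)] by auto
  let ?s = "submetric m (f ` mspace m)" and ?sg = "submetric m (?fg ` mspace m)" 
    and ?sd = "submetric m (?fd ` mspace m)"
  note im = short_retraction_image[OF f] and img = short_retraction_image[OF rg] 
    and imd = short_retraction_image[OF rd]
  have ms: "mspace ?s = f ` mspace m" "mspace ?sg = ?fg ` mspace m" "mspace ?sd = ?fd ` mspace m"
    using im(1) img(1) imd(1) by auto
  have mem: "f x \<in> mspace m" "\<gamma> x \<in> mspace m" "\<delta> x \<in> mspace m" "f (f x) = f x" if "x \<in> mspace m" for x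
    using that f S.maps by (auto simp: short_retraction_def short_map_def)
  have F: "short_map m m f" using f by (simp add: short_retraction_def)
  note shg = mm_space_retract(2)[OF S.X rg] and shd = mm_space_retract(2)[OF S.X rd] 
    and sh = mm_space_retract(2)[OF S.X f]
  note meas = short_map_measurable[OF S.X]
  have distr: "measure (distr \<mu> (metric_borel m') h) V = measure \<mu> {x \<in> mspace m. h x \<in> V}"
    if "short_map m m' h" "V \<in> sets (metric_borel m')" for m' h V
    using measure_distr[OF meas[OF that(1)] that(2)] mm_space_space[OF S.X] 
    by (simp add: vimage_def Int_def conj_commute)
  have "mm_iso (mm_retract (m, \<mu>) f) (mm_sum (mm_retract (m, \<mu>) ?fg) (mm_retract (m, \<mu>) ?fd))"
    unfolding mm_retract_def prod.case
  proof (rule mm_sum_criterion[where f = \<gamma> and g = \<delta>])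
    show "mm_space (?s, distr \<mu> (metric_borel ?s) f)"
      "mm_space (?sg, distr \<mu> (metric_borel ?sg) ?fg)" "mm_space (?sd, distr \<mu> (metric_borel ?sd) ?fd)"
      using mm_space_retract(1)[OF S.X] f rg rd by (simp_all add: mm_retract_def)
    show "\<gamma> \<in> mspace ?s \<rightarrow> mspace ?sg" "\<delta> \<in> mspace ?s \<rightarrow> mspace ?sd"
      unfolding ms using c by (auto simp flip: c)
    show "mdist ?s x y = mdist ?sg (\<gamma> x) (\<gamma> y) + mdist ?sd (\<delta> x) (\<delta> y)"
      if "x \<in> mspace ?s" "y \<in> mspace ?s" for x y
      using S.dist[of x y] that by simp
    show "\<exists>x\<in>mspace ?s. \<gamma> x = p \<and> \<delta> x = q" if pq: "p \<in> mspace ?sg" "q \<in> mspace ?sd" for p q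
    proof -
      obtain a b where a: "a \<in> mspace m" "p = f (\<gamma> a)" and b: "b \<in> mspace m" "q = f (\<delta> b)"
        using pq unfolding ms by blast
      obtain x where x: "x \<in> mspace m" "\<gamma> x = \<gamma> a" "\<delta> x = \<delta> b" using S.onto[OF a(1) b(1)] by blast
      have "\<gamma> (f x) = p" "\<delta> (f x) = q" using c[OF x(1)] a b x by simp_all
      then show ?thesis using x(1) unfolding ms by blast
    qed
    fix V W assume V: "openin (mtopology_of ?sg) V" and W: "openin (mtopology_of ?sd) W"
    have Vm: "{x \<in> mspace m. f (\<gamma> x) \<in> V} \<in> sets (metric_borel m)" 
      and Wm: "{x \<in> mspace m. f (\<delta> x) \<in> W} \<in> sets (metric_borel m)"
      using openin_metric_borel[OF short_map_open_preimage] shg V shd W by blast+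
    let ?R = "{x \<in> mspace ?s. \<gamma> x \<in> V \<and> \<delta> x \<in> W}"
    have "short_map ?s ?sg \<gamma>" "short_map ?s ?sd \<delta>"
      unfolding short_map_def ms using c im(1) S.dist by (auto simp: subset_iff simp flip: c)
    then have "openin (mtopology_of ?s) ({x \<in> mspace ?s. \<gamma> x \<in> V} \<inter> {x \<in> mspace ?s. \<delta> x \<in> W})"
      using V W by (intro openin_Int short_map_open_preimage)
    moreover have "{x \<in> mspace ?s. \<gamma> x \<in> V} \<inter> {x \<in> mspace ?s. \<delta> x \<in> W} = ?R" by blast
    ultimately have "?R \<in> sets (metric_borel ?s)" by (metis openin_metric_borel)
    then have "measure (distr \<mu> (metric_borel ?s) f) ?R = measure \<mu> {x \<in> mspace m. f x \<in> ?R}"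
      by (rule distr[OF sh])
    also have "{x \<in> mspace m. f x \<in> ?R} = 
        {x \<in> mspace m. \<gamma> x \<in> {x \<in> mspace m. f (\<gamma> x) \<in> V} \<and> \<delta> x \<in> {x \<in> mspace m. f (\<delta> x) \<in> W}}"
      using ms(1) mem S.idem c by auto
    also have "measure \<mu> \<dots> = measure \<mu> {x \<in> mspace m. \<gamma> x \<in> {x \<in> mspace m. f (\<gamma> x) \<in> V}} *
        measure \<mu> {x \<in> mspace m. \<delta> x \<in> {x \<in> mspace m. f (\<delta> x) \<in> W}}"
      by (rule S.indep[OF Vm Wm])
    also have "{x \<in> mspace m. \<gamma> x \<in> {x \<in> mspace m. f (\<gamma> x) \<in> V}} = {x \<in> mspace m. f (\<gamma> x) \<in> V}"
      using mem S.idem by auto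
    also have "{x \<in> mspace m. \<delta> x \<in> {x \<in> mspace m. f (\<delta> x) \<in> W}} = {x \<in> mspace m. f (\<delta> x) \<in> W}"
      using mem S.idem by auto
    also have "measure \<mu> {x \<in> mspace m. f (\<gamma> x) \<in> V} = measure (distr \<mu> (metric_borel ?sg) ?fg) V"
      using distr[OF shg openin_metric_borel[OF V]] by simp
    also have "measure \<mu> {x \<in> mspace m. f (\<delta> x) \<in> W} = measure (distr \<mu> (metric_borel ?sd) ?fd) W"
      using distr[OF shd openin_metric_borel[OF W]] by simp
    finally show "measure (distr \<mu> (metric_borel ?s) f) ?R = 
      measure (distr \<mu> (metric_borel ?sg) ?fg) V * measure (distr \<mu> (metric_borel ?sd) ?fd) W" .
  qed
  then show ?thesis
    using mm_class_of_eq_iff[OF mm_space_retract(1)[OF S.X f] mm_sum_space] 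
      mm_class_of_sum mm_space_retract(1)[OF S.X rg] mm_space_retract(1)[OF S.X rd] by metis
qed

text \<open>
  Here \<open>p\<close> is to be thought of as a coordinate of a sum and \<open>i\<close> as the inclusion of the corresponding fibre.
\<close>

lemma mm_retract_factor:
  assumes X: "mm_space (m, \<mu>)" and C: "mm_space (c, \<kappa>)" and i: "isometric_embedding c m i"
    and p: "p \<in> measurable \<mu> (metric_borel c)" "p ` mspace m = mspace c" 
      "distr \<mu> (metric_borel c) p = \<kappa>"
    and h: "\<And>x. x \<in> mspace m \<Longrightarrow> h x = i (p x)"
  shows "mm_iso (c, \<kappa>) (mm_retract (m, \<mu>) h)"
proof -
  let ?s = "submetric m (h ` mspace m)"
  have im: "h ` mspace m = i ` mspace c" using p(2) h by force
  then have "h ` mspace m \<subseteq> mspace m" using i by (auto simp: isometric_embedding_def)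
  then have ms: "mspace ?s = i ` mspace c" using im by auto
  have emb: "isometric_embedding c ?s i" 
    using i ms by (auto simp: isometric_embedding_def)
  have "distr \<kappa> (metric_borel ?s) i = distr \<mu> (metric_borel ?s) (i \<circ> p)"
    unfolding p(3)[symmetric] by (rule distr_distr[OF isometric_embedding_measurable[OF emb] p(1)])
  also have "\<dots> = distr \<mu> (metric_borel ?s) h"
    using h mm_space_space[OF X] by (intro distr_cong) auto
  finally show ?thesis 
    using emb ms unfolding mm_iso_def mm_retract_def by auto
qed

lemma splitting_of_sum:
  assumes X: "mm_space (m, \<mu>)" and A: "mm_space (a, \<kappa>)" and B: "mm_space (b, \<nu>)"
    and iso: "mm_iso (m, \<mu>) (mm_sum (a, \<kappa>) (b, \<nu>))" and e: "e \<in> mspace m"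
  obtains \<alpha> \<beta> where "splitting m \<mu> e \<alpha> \<beta>"
    "mm_class_of (mm_retract (m, \<mu>) \<alpha>) = mm_class_of (a, \<kappa>)" 
    "mm_class_of (mm_retract (m, \<mu>) \<beta>) = mm_class_of (b, \<nu>)"
proof -
  let ?l = "l1_metric a b"
  interpret P: prob_space \<kappa> by (rule mm_space_prob[OF A])
  interpret Q: prob_space \<nu> by (rule mm_space_prob[OF B])
  interpret PQ: pair_prob_space \<kappa> \<nu> ..
  note sA = mm_space_sets[OF A] and sB = mm_space_sets[OF B]
  obtain k where k: "isometric_embedding m ?l k" "k ` mspace m = mspace ?l" 
    and km: "distr \<mu> (metric_borel ?l) k = \<kappa> \<Otimes>\<^sub>M \<nu>"
    using iso by (auto simp: mm_iso_def mm_sum_def)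
  define j where "j = inv_into (mspace m) k"
  note j = isometric_embedding_inv[OF k, folded j_def]
  have jk: "j (k x) = x" if "x \<in> mspace m" for x
    using that isometric_embedding_inj_on[OF k(1)] by (simp add: j_def)
  have kj: "k (j (p, q)) = (p, q)" if "p \<in> mspace a" "q \<in> mspace b" for p q
    using that k(2) by (simp add: j_def f_inv_into_f)
  have jm: "j (p, q) \<in> mspace m" if "p \<in> mspace a" "q \<in> mspace b" for p q
    using that j(1) by (auto simp: isometric_embedding_def)
  \<comment> \<open>\<open>k1\<close> and \<open>k2\<close> are the coordinates; \<open>j\<close> recovers a point from them.\<close>
  define k1 where "k1 = (\<lambda>x. fst (k x))" 
  define k2 where "k2 = (\<lambda>x. snd (k x))"
  have k12: "k1 x \<in> mspace a" "k2 x \<in> mspace b" "k x = (k1 x, k2 x)" if "x \<in> mspace m" for x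
    using that k(1) by (auto simp: isometric_embedding_def k1_def k2_def Pi_iff mem_Times_iff)
  have kd: "mdist m x y = mdist a (k1 x) (k1 y) + mdist b (k2 x) (k2 y)" 
    if "x \<in> mspace m" "y \<in> mspace m" for x y
  proof -
    have "mdist ?l (k x) (k y) = mdist m x y" using k(1) that by (simp add: isometric_embedding_def)
    then show ?thesis using k12[OF that(1)] k12[OF that(2)] by simp
  qed
  have k1j [simp]: "k1 (j (p, q)) = p" and k2j [simp]: "k2 (j (p, q)) = q" 
    if "p \<in> mspace a" "q \<in> mspace b" for p q
    using kj[OF that] by (simp_all add: k1_def k2_def)
  let ?p = "k1 e" and ?q = "k2 e"
  note e12 = k12[OF e]
  define \<alpha> where "\<alpha> = (\<lambda>x. j (k1 x, ?q))"
  define \<beta> where "\<beta> = (\<lambda>x. j (?p, k2 x))"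
  have i1: "isometric_embedding a m (\<lambda>p. j (p, ?q))" and i2: "isometric_embedding b m (\<lambda>q. j (?p, q))"
    using e12 by (auto simp: isometric_embedding_def jm kd)
  have meas: "k \<in> measurable \<mu> (metric_borel ?l)" by (rule mm_space_measurable[OF X k(1)])
  have mu: "measure \<mu> {x \<in> mspace m. k1 x \<in> V \<and> k2 x \<in> W} = measure \<kappa> V * measure \<nu> W"
    if V: "V \<in> sets (metric_borel a)" and W: "W \<in> sets (metric_borel b)" for V W
  proof -
    have "V \<times> W \<in> sets (\<kappa> \<Otimes>\<^sub>M \<nu>)" using V W sA sB by simp
    then have "V \<times> W \<in> sets (metric_borel ?l)" using km by (metis sets_distr)
    then have "measure (\<kappa> \<Otimes>\<^sub>M \<nu>) (V \<times> W) = measure \<mu> (k -` (V \<times> W) \<inter> space \<mu>)"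
      unfolding km[symmetric] by (rule measure_distr[OF meas])
    also have "k -` (V \<times> W) \<inter> space \<mu> = {x \<in> mspace m. k1 x \<in> V \<and> k2 x \<in> W}"
      using mm_space_space[OF X] by (auto simp: k1_def k2_def mem_Times_iff)
    finally show ?thesis 
      using Q.emeasure_pair_measure_Times[of V \<kappa> W] V W sA sB 
      by (simp add: measure_def enn2real_mult)
  qed
  have top: "mspace a \<in> sets (metric_borel a)" "mspace b \<in> sets (metric_borel b)"
    using sets.top[of "metric_borel a"] sets.top[of "metric_borel b"] by simp_all
  have whole: "measure \<kappa> (mspace a) = 1" "measure \<nu> (mspace b) = 1"
    using P.prob_space Q.prob_space mm_space_space[OF A] mm_space_space[OF B] by simp_all
  have "splitting m \<mu> e \<alpha> \<beta>"
  proof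
    show "\<alpha> \<in> mspace m \<rightarrow> mspace m" "\<beta> \<in> mspace m \<rightarrow> mspace m"
      using k12 e by (auto simp: \<alpha>_def \<beta>_def intro!: jm)
    show "mdist m x y = mdist m (\<alpha> x) (\<alpha> y) + mdist m (\<beta> x) (\<beta> y)"
      if "x \<in> mspace m" "y \<in> mspace m" for x y
    proof -
      have "mdist m (\<alpha> x) (\<alpha> y) = mdist a (k1 x) (k1 y)" "mdist m (\<beta> x) (\<beta> y) = mdist b (k2 x) (k2 y)"
        using k12[OF that(1)] k12[OF that(2)] e12 by (simp_all add: \<alpha>_def \<beta>_def kd[OF jm jm])
      then show ?thesis using kd[OF that] by simp
    qed
    show "\<alpha> (\<alpha> x) = \<alpha> x" "\<beta> (\<beta> x) = \<beta> x" if "x \<in> mspace m" for x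
      using k12[OF that] e12 by (simp_all add: \<alpha>_def \<beta>_def)
    have "j (?p, ?q) = e" using e12 jk[OF e] by simp
    then show "\<alpha> (\<beta> x) = e" "\<beta> (\<alpha> x) = e" if "x \<in> mspace m" for x
      using k12[OF that] e12 by (simp_all add: \<alpha>_def \<beta>_def)
    show "\<exists>x\<in>mspace m. \<alpha> x = \<alpha> p \<and> \<beta> x = \<beta> q" if "p \<in> mspace m" "q \<in> mspace m" for p q
      using k12[OF that(1)] k12[OF that(2)] 
      by (intro bexI[of _ "j (k1 p, k2 q)"] jm) (simp_all add: \<alpha>_def \<beta>_def)
    fix V W assume V: "V \<in> sets (metric_borel m)" and W: "W \<in> sets (metric_borel m)"
    define V1 where "V1 = (\<lambda>p. j (p, ?q)) -` V \<inter> mspace a"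
    define W1 where "W1 = (\<lambda>q. j (?p, q)) -` W \<inter> mspace b"
    have V1: "V1 \<in> sets (metric_borel a)" and W1: "W1 \<in> sets (metric_borel b)"
      using measurable_sets[OF isometric_embedding_measurable[OF i1] V] 
        measurable_sets[OF isometric_embedding_measurable[OF i2] W] by (simp_all add: V1_def W1_def)
    have "{x \<in> mspace m. \<alpha> x \<in> V \<and> \<beta> x \<in> W} = {x \<in> mspace m. k1 x \<in> V1 \<and> k2 x \<in> W1}"
      "{x \<in> mspace m. \<alpha> x \<in> V} = {x \<in> mspace m. k1 x \<in> V1 \<and> k2 x \<in> mspace b}"
      "{x \<in> mspace m. \<beta> x \<in> W} = {x \<in> mspace m. k1 x \<in> mspace a \<and> k2 x \<in> W1}"
      using k12 by (auto simp: \<alpha>_def \<beta>_def V1_def W1_def)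
    then show "measure \<mu> {x \<in> mspace m. \<alpha> x \<in> V \<and> \<beta> x \<in> W} = 
        measure \<mu> {x \<in> mspace m. \<alpha> x \<in> V} * measure \<mu> {x \<in> mspace m. \<beta> x \<in> W}"
      using mu[OF V1 W1] mu[OF V1 top(2)] mu[OF top(1) W1] whole by simp
  qed (use X e in auto)
  have "short_map m a k1" "short_map m b k2"
    using k12 kd by (auto simp: short_map_def)
  note k12m = this[THEN short_map_measurable[OF X]]
  have law: "distr \<mu> (metric_borel a) k1 = \<kappa>" "distr \<mu> (metric_borel b) k2 = \<nu>"
  proof -
    interpret D1: prob_space "distr \<mu> (metric_borel a) k1"
      by (rule prob_space.prob_space_distr[OF mm_space_prob[OF X] k12m(1)])
    interpret D2: prob_space "distr \<mu> (metric_borel b) k2"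
      by (rule prob_space.prob_space_distr[OF mm_space_prob[OF X] k12m(2)])
    show "distr \<mu> (metric_borel a) k1 = \<kappa>"
    proof (rule measure_eqI)
      fix V assume "V \<in> sets (distr \<mu> (metric_borel a) k1)"
      then have V: "V \<in> sets (metric_borel a)" by simp
      have "k1 -` V \<inter> space \<mu> = {x \<in> mspace m. k1 x \<in> V \<and> k2 x \<in> mspace b}"
        using mm_space_space[OF X] k12 by auto
      then show "emeasure (distr \<mu> (metric_borel a) k1) V = emeasure \<kappa> V"
        using mu[OF V top(2)] whole measure_distr[OF k12m(1) V] 
        by (simp add: D1.emeasure_eq_measure P.emeasure_eq_measure)
    qed (simp add: sA)
    show "distr \<mu> (metric_borel b) k2 = \<nu>"
    proof (rule measure_eqI)
      fix V assume "V \<in> sets (distr \<mu> (metric_borel b) k2)"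
      then have V: "V \<in> sets (metric_borel b)" by simp
      have "k2 -` V \<inter> space \<mu> = {x \<in> mspace m. k1 x \<in> mspace a \<and> k2 x \<in> V}"
        using mm_space_space[OF X] k12 by auto
      then show "emeasure (distr \<mu> (metric_borel b) k2) V = emeasure \<nu> V"
        using mu[OF top(1) V] whole measure_distr[OF k12m(2) V] 
        by (simp add: D2.emeasure_eq_measure Q.emeasure_eq_measure)
    qed (simp add: sB)
  qed
  have im: "k1 ` mspace m = mspace a" "k2 ` mspace m = mspace b"
  proof -
    have "p \<in> k1 ` mspace m" if "p \<in> mspace a" for p
      using that e12 jm[of p ?q] k1j[of p ?q] by (metis imageI)
    then show "k1 ` mspace m = mspace a" using k12 by auto
    have "q \<in> k2 ` mspace m" if "q \<in> mspace b" for q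
      using that e12 jm[of ?p q] k2j[of ?p q] by (metis imageI)
    then show "k2 ` mspace m = mspace b" using k12 by auto
  qed
  interpret S: splitting m \<mu> e \<alpha> \<beta> by fact
  have "mm_iso (a, \<kappa>) (mm_retract (m, \<mu>) \<alpha>)" "mm_iso (b, \<nu>) (mm_retract (m, \<mu>) \<beta>)"
    by (rule mm_retract_factor[OF X A i1 k12m(1) im(1) law(1)], simp add: \<alpha>_def)
      (rule mm_retract_factor[OF X B i2 k12m(2) im(2) law(2)], simp add: \<beta>_def)
  then show ?thesis
    using that \<open>splitting m \<mu> e \<alpha> \<beta>\<close> mm_class_of_eq_iff[OF A mm_space_retract(1)[OF X S.retraction(1)]]
      mm_class_of_eq_iff[OF B mm_space_retract(1)[OF X S.retraction(2)]] by metis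
qed

text \<open>
  The four pieces are the images of the composites of a projection of the first decomposition with one
  of the second. Commutation makes each of them a piece of a summand on either side.
\<close>

proposition refinement:
  fixes A B C D :: mm_class
  assumes "A + B = C + D"
  obtains P Q R S where "A = P + Q" "B = R + S" "C = P + R" "D = Q + S"
proof -
  obtain a \<kappa> where a: "rep_mm_class A = (a, \<kappa>)" by fastforce
  obtain b \<nu> where b: "rep_mm_class B = (b, \<nu>)" by fastforce
  obtain c \<rho> where c: "rep_mm_class C = (c, \<rho>)" by fastforce
  obtain d \<sigma> where d: "rep_mm_class D = (d, \<sigma>)" by fastforce
  have ab: "mm_space (a, \<kappa>)" "mm_space (b, \<nu>)" and cd: "mm_space (c, \<rho>)" "mm_space (d, \<sigma>)"
    using mm_space_rep a b c d by metis+
  have cl: "mm_class_of (a, \<kappa>) = A" "mm_class_of (b, \<nu>) = B" "mm_class_of (c, \<rho>) = C" "mm_class_of (d, \<sigma>) = D"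
    using mm_class_of_rep a b c d by metis+
  obtain m \<mu> where m: "mm_sum (a, \<kappa>) (b, \<nu>) = (m, \<mu>)" by fastforce
  have X: "mm_space (m, \<mu>)" using mm_sum_space[OF ab] m by simp
  have iso1: "mm_iso (m, \<mu>) (mm_sum (a, \<kappa>) (b, \<nu>))" using mm_iso_refl[OF X] m by simp
  have "mm_class_of (m, \<mu>) = mm_class_of (mm_sum (c, \<rho>) (d, \<sigma>))"
    unfolding m[symmetric] using assms cl ab cd by (simp add: mm_class_of_sum)
  then have iso2: "mm_iso (m, \<mu>) (mm_sum (c, \<rho>) (d, \<sigma>))"
    using mm_class_of_eq_iff[OF X mm_sum_space[OF cd]] by simp
  obtain e where e: "e \<in> mspace m"
    using prob_space.not_empty[OF mm_space_prob[OF X]] mm_space_space[OF X] by auto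
  obtain \<alpha> \<beta> where S1: "splitting m \<mu> e \<alpha> \<beta>" 
    and AB: "mm_class_of (mm_retract (m, \<mu>) \<alpha>) = A" "mm_class_of (mm_retract (m, \<mu>) \<beta>) = B"
    using splitting_of_sum[OF X ab iso1 e] cl by metis
  obtain \<gamma> \<delta> where S2: "splitting m \<mu> e \<gamma> \<delta>" 
    and CD: "mm_class_of (mm_retract (m, \<mu>) \<gamma>) = C" "mm_class_of (mm_retract (m, \<mu>) \<delta>) = D"
    using splitting_of_sum[OF X cd iso2 e] cl by metis
  note S1' = splitting.swap[OF S1] and S2' = splitting.swap[OF S2]
  note retr = splitting.retraction[OF S1] splitting.retraction[OF S2]
  note comm = splitting_commute[OF S1 S2] splitting_commute[OF S1 S2'] 
    splitting_commute[OF S1' S2] splitting_commute[OF S1' S2']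
  have swap: "mm_retract (m, \<mu>) (\<lambda>x. \<alpha> (\<gamma> x)) = mm_retract (m, \<mu>) (\<lambda>x. \<gamma> (\<alpha> x))"
    "mm_retract (m, \<mu>) (\<lambda>x. \<alpha> (\<delta> x)) = mm_retract (m, \<mu>) (\<lambda>x. \<delta> (\<alpha> x))"
    "mm_retract (m, \<mu>) (\<lambda>x. \<beta> (\<gamma> x)) = mm_retract (m, \<mu>) (\<lambda>x. \<gamma> (\<beta> x))"
    "mm_retract (m, \<mu>) (\<lambda>x. \<beta> (\<delta> x)) = mm_retract (m, \<mu>) (\<lambda>x. \<delta> (\<beta> x))"
    by (intro mm_retract_cong[OF X] comm; assumption)+
  show ?thesis
  proof (rule that)
    show "A = mm_class_of (mm_retract (m, \<mu>) (\<lambda>x. \<alpha> (\<gamma> x))) + mm_class_of (mm_retract (m, \<mu>) (\<lambda>x. \<alpha> (\<delta> x)))"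
      using mm_retract_splitting[OF S2 retr(1) comm(1,2)] AB by simp
    show "B = mm_class_of (mm_retract (m, \<mu>) (\<lambda>x. \<beta> (\<gamma> x))) + mm_class_of (mm_retract (m, \<mu>) (\<lambda>x. \<beta> (\<delta> x)))"
      using mm_retract_splitting[OF S2 retr(2) comm(3,4)] AB by simp
    show "C = mm_class_of (mm_retract (m, \<mu>) (\<lambda>x. \<alpha> (\<gamma> x))) + mm_class_of (mm_retract (m, \<mu>) (\<lambda>x. \<beta> (\<gamma> x)))"
      unfolding swap using mm_retract_splitting[OF S1 retr(3) comm(1,3)[symmetric]] CD by simp
    show "D = mm_class_of (mm_retract (m, \<mu>) (\<lambda>x. \<alpha> (\<delta> x))) + mm_class_of (mm_retract (m, \<mu>) (\<lambda>x. \<beta> (\<delta> x)))"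
      unfolding swap using mm_retract_splitting[OF S1 retr(4) comm(2,4)[symmetric]] CD by simp
  qed
qed

proposition irreducible_imp_prime:
  assumes "mm_irreducible X" shows "mm_prime X"
  unfolding mm_prime_def
proof (intro conjI allI impI)
  show "X \<noteq> 0" using assms by (simp add: mm_irreducible_def)
  fix Y Z assume "X \<preceq> Y + Z"
  then obtain W where "Y + Z = X + W" by (auto simp: mm_le_def)
  then obtain P Q R S where *: "Y = P + Q" "Z = R + S" "X = P + R" "W = Q + S"
    by (rule refinement)
  then have "P = 0 \<or> P = X" using assms by (auto simp: mm_irreducible_def mm_le_def)
  then show "X \<preceq> Y \<or> X \<preceq> Z" using * by (auto simp: mm_le_def)
qed

section \<open>Limits along ultrafilters\<close>

definition ultrafilter :: "'i filter \<Rightarrow> bool" where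
  "ultrafilter U \<longleftrightarrow> U \<noteq> bot \<and> (\<forall>P. eventually P U \<or> eventually (\<lambda>i. \<not> P i) U)"

text \<open>
  A minimal proper filter below \<open>F\<close> exists by Zorn's lemma. It is not changed by adding to it
  a set whose complement it does not contain.
\<close>

lemma ultrafilter_exists:
  fixes F :: "'i filter"
  assumes "F \<noteq> bot" obtains U where "ultrafilter U" "U \<le> F"
proof -
  let ?A = "{G. G \<le> F \<and> G \<noteq> bot}"
  have "\<exists>G\<in>?A. \<forall>H\<in>?A. G \<ge> H \<longrightarrow> H = G"
  proof (rule predicate_Zorn)
    show "partial_order_on ?A (relation_of (\<ge>) ?A)"
      by (rule partial_order_on_relation_ofI) auto
    fix C assume C: "C \<in> Chains (relation_of (\<ge>) ?A)"
    then have sub: "C \<subseteq> ?A" and tot: "\<And>G H. G \<in> C \<Longrightarrow> H \<in> C \<Longrightarrow> G \<le> H \<or> H \<le> G"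
      by (auto simp: Chains_def relation_of_def)
    show "\<exists>G\<in>?A. \<forall>H\<in>C. H \<ge> G"
    proof (cases "C = {}")
      case False
      have "eventually P (Inf C) \<longleftrightarrow> (\<exists>G\<in>C. eventually P G)" for P
      proof (rule eventually_Inf_base[OF False])
        fix G H assume "G \<in> C" "H \<in> C"
        then show "\<exists>K\<in>C. K \<le> inf G H"
          using tot[of G H] by (metis inf.absorb1 inf.absorb2 order_refl)
      qed
      then have "Inf C \<noteq> bot" using sub unfolding trivial_limit_def by blast
      moreover have "Inf C \<le> F" using False sub by (auto intro: Inf_lower2)
      ultimately show ?thesis by (auto intro: Inf_lower)
    qed (use assms in auto)
  qed
  then obtain U where U: "U \<le> F" "U \<noteq> bot" "\<And>H. H \<le> F \<Longrightarrow> H \<noteq> bot \<Longrightarrow> H \<le> U \<Longrightarrow> H = U" by auto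
  have "eventually P U" if "\<not> eventually (\<lambda>i. \<not> P i) U" for P
  proof -
    have "inf U (principal {i. P i}) \<noteq> bot"
      using that by (auto simp: trivial_limit_def eventually_inf_principal)
    then have "inf U (principal {i. P i}) = U" using U(1) by (intro U(3)) (auto intro: le_infI1)
    then have "U \<le> principal {i. P i}" by (metis inf_le2)
    then show ?thesis by (simp add: le_principal)
  qed
  then show ?thesis using U(1,2) that unfolding ultrafilter_def by blast
qed

text \<open>
  This takes the place of the extraction of subsequences.
\<close>

lemma ultrafilter_finite:
  assumes "ultrafilter U" "finite C" "eventually (\<lambda>i. \<exists>y\<in>C. P i y) U"
  shows "\<exists>y\<in>C. eventually (\<lambda>i. P i y) U"
proof (rule ccontr)
  assume "\<not> ?thesis"
  then have "\<forall>y\<in>C. eventually (\<lambda>i. \<not> P i y) U" using assms(1) by (auto simp: ultrafilter_def)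
  then have "eventually (\<lambda>i. \<forall>y\<in>C. \<not> P i y) U" using assms(2) by (simp add: eventually_ball_finite)
  with assms(3) have "eventually (\<lambda>i. False) U" by eventually_elim blast
  then show False using assms(1) by (simp add: ultrafilter_def trivial_limit_def)
qed

lemma real_tendsto_dominated:
  fixes f g :: "'i \<Rightarrow> real"
  assumes "\<And>i. \<bar>f i - l\<bar> \<le> g i" "(g \<longlongrightarrow> 0) F" shows "(f \<longlongrightarrow> l) F"
proof -
  have "((\<lambda>i. f i - l) \<longlongrightarrow> 0) F"
    using Lim_null_comparison[OF _ assms(2), of "\<lambda>i. f i - l"] assms(1) by simp
  then show ?thesis by (simp flip: Lim_null)
qed

text \<open>
  The number \<open>D i y\<close> stands for the distance from \<open>y\<close> to an \<open>i\<close>-th point that may lie outside the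
  space. Points chosen at the scales $1/(n+1)$ form a Cauchy sequence, whose limit is the point sought.
\<close>

lemma complete_filter_limit:
  assumes complete: "mcomplete_of m" and U: "U \<noteq> bot"
    and tri: "\<And>i x y. x \<in> mspace m \<Longrightarrow> y \<in> mspace m \<Longrightarrow> mdist m x y \<le> D i x + D i y"
      "\<And>i x y. x \<in> mspace m \<Longrightarrow> y \<in> mspace m \<Longrightarrow> D i y \<le> D i x + mdist m x y"
    and close: "\<And>r. r > 0 \<Longrightarrow> \<exists>y\<in>mspace m. eventually (\<lambda>i. D i y < (r :: real)) U"
  shows "\<exists>y\<in>mspace m. ((\<lambda>i. D i y) \<longlongrightarrow> 0) U"
proof -
  interpret M: Metric_space "mspace m" "mdist m" by simp
  have "\<forall>n. \<exists>y\<in>mspace m. eventually (\<lambda>i. D i y < 1 / real (Suc n)) U"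
    using close by simp
  then obtain y where y: "\<And>n. y n \<in> mspace m" 
    "\<And>n. eventually (\<lambda>i. D i (y n) < 1 / real (Suc n)) U" by metis
  have lt: "mdist m (y n) (y k) < 1 / real (Suc n) + 1 / real (Suc k)" for n k
  proof -
    have "eventually (\<lambda>i. mdist m (y n) (y k) < 1 / real (Suc n) + 1 / real (Suc k)) U"
      using y(2)[of n] y(2)[of k]
    proof eventually_elim
      case (elim i)
      then show ?case using tri(1)[OF y(1)[of n] y(1)[of k], of i] by simp
    qed
    then show ?thesis using U eventually_const by blast
  qed
  have "M.MCauchy y"
    unfolding M.MCauchy_def
  proof (intro conjI allI impI)
    show "range y \<subseteq> mspace m" using y(1) by auto
    fix r :: real assume "r > 0"
    then obtain N where N: "N \<noteq> 0" "1 / real N < r / 2" 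
      using real_arch_inverse[of "r / 2"] by (auto simp: inverse_eq_divide)
    have "mdist m (y n) (y k) < r" if "N \<le> n" "N \<le> k" for n k
    proof -
      have "1 / real (Suc n) \<le> 1 / real N" "1 / real (Suc k) \<le> 1 / real N"
        using that N(1) by (auto simp: frac_le)
      then show ?thesis using lt[of n k] N(2) by linarith
    qed
    then show "\<exists>N. \<forall>n n'. N \<le> n \<longrightarrow> N \<le> n' \<longrightarrow> mdist m (y n) (y n') < r" by blast
  qed
  then obtain x where "limitin M.mtopology y x sequentially"
    using complete by (auto simp: mcomplete_of_def M.mcomplete_def)
  then have x: "x \<in> mspace m" "\<And>r. r > 0 \<Longrightarrow> eventually (\<lambda>n. mdist m (y n) x < r) sequentially"
    by (auto simp: M.limitin_metric elim: eventually_mono)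
  have "((\<lambda>i. D i x) \<longlongrightarrow> 0) U"
  proof (rule tendstoI)
    fix r :: real assume r: "r > 0"
    obtain N where N: "N \<noteq> 0" "1 / real N < r / 2" 
      using real_arch_inverse[of "r / 2"] r by (auto simp: inverse_eq_divide)
    have "eventually (\<lambda>n. mdist m (y n) x < r / 2 \<and> n \<ge> N) sequentially"
      using x(2)[of "r / 2"] eventually_ge_at_top[of N] r by (intro eventually_conj) auto
    then obtain n where n: "mdist m (y n) x < r / 2" "n \<ge> N" 
      by (auto simp: eventually_sequentially)
    have "1 / real (Suc n) \<le> 1 / real N" using n(2) N(1) by (auto simp: frac_le)
    then have "1 / real (Suc n) < r / 2" using N(2) by linarith
    show "eventually (\<lambda>i. dist (D i x) 0 < r) U"
      using y(2)[of n]
    proof eventually_elim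
      case (elim i)
      have "D i x \<ge> 0" using tri(1)[OF x(1) x(1), of i] mdist_nonneg[of m x x] by linarith
      then show ?case using elim tri(2)[OF y(1)[of n] x(1), of i] n(1) \<open>1 / real (Suc n) < r / 2\<close>
        by simp
    qed
  qed
  then show ?thesis using x(1) by blast
qed

section \<open>Tightness\<close>

lemma mball_of_borel: "mball_of m x r \<in> sets (metric_borel m)"
  using Metric_space.openin_mball[OF Metric_space_mspace_mdist[of m]]
  by (intro openin_metric_borel) (simp add: mball_of_def mtopology_of_def)

lemma mm_space_ball_pos:
  assumes "mm_space (m, \<mu>)" "x \<in> mspace m" "r > 0" shows "measure \<mu> (mball_of m x r) > 0"
proof -
  have "openin (mtopology_of m) (mball_of m x r)"
    using Metric_space.openin_mball[OF Metric_space_mspace_mdist[of m]]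
    by (simp add: mball_of_def mtopology_of_def)
  moreover have "x \<in> mball_of m x r" using assms(2,3) mdist_self[OF assms(2)] by (simp only: in_mball_of)
  then have "mball_of m x r \<noteq> {}" by blast
  ultimately show ?thesis using assms(1) by (simp add: mm_space_def)
qed

text \<open>
  The balls of radius \<open>r\<close> around a dense sequence cover the space, so finitely many of
  them carry almost all of the mass.
\<close>

lemma mm_space_tight:
  assumes X: "mm_space (m, \<mu>)" and r: "r > 0" "c > 0"
  obtains C where "finite C" "C \<subseteq> mspace m" "measure \<mu> (\<Union>y\<in>C. mball_of m y r) > 1 - c"
proof -
  interpret P: prob_space \<mu> by (rule mm_space_prob[OF X])
  obtain C where C: "countable C" "C \<subseteq> mspace m"
    and dense: "\<And>x e. x \<in> mspace m \<Longrightarrow> e > 0 \<Longrightarrow> \<exists>c\<in>C. mdist m x c < e"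
    using metric_separable_dense[of m] X by (auto simp: mm_space_def)
  obtain x where "x \<in> mspace m" using P.not_empty mm_space_space[OF X] by auto
  then have "C \<noteq> {}" using dense[of x r] r(1) by auto
  define q where "q = from_nat_into C"
  have q: "range q = C" unfolding q_def by (rule range_from_nat_into[OF \<open>C \<noteq> {}\<close> C(1)])
  let ?B = "\<lambda>n. \<Union>y\<in>q ` {..n}. mball_of m y r"
  have "(\<Union>n. ?B n) = space \<mu>"
  proof
    have "mball_of m y r \<subseteq> space \<mu>" for y unfolding mm_space_space[OF X] by (auto simp: in_mball_of)
    then show "(\<Union>n. ?B n) \<subseteq> space \<mu>" by blast
    show "space \<mu> \<subseteq> (\<Union>n. ?B n)"
    proof
      fix x assume "x \<in> space \<mu>"
      then have x: "x \<in> mspace m" using mm_space_space[OF X] by simp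
      obtain k where "mdist m x (q k) < r" using dense[OF x r(1)] q by blast
      moreover have "q k \<in> mspace m" using q C(2) by blast
      ultimately have "x \<in> mball_of m (q k) r" using x by (simp add: mdist_commute)
      then show "x \<in> (\<Union>n. ?B n)" by blast
    qed
  qed
  moreover have "(\<lambda>n. measure \<mu> (?B n)) \<longlonglongrightarrow> measure \<mu> (\<Union>n. ?B n)"
  proof (rule P.finite_Lim_measure_incseq)
    have "?B n \<in> sets \<mu>" for n
      by (rule sets.finite_UN) (simp_all only: finite_imageI finite_atMost mm_space_sets[OF X] mball_of_borel)
    then show "range ?B \<subseteq> sets \<mu>" by blast
    show "incseq ?B"
    proof (rule monoI)
      fix k n :: nat assume "k \<le> n"
      then have "q ` {..k} \<subseteq> q ` {..n}" by (simp add: image_mono)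
      then show "?B k \<subseteq> ?B n" by (rule UN_mono) simp
    qed
  qed
  ultimately have "(\<lambda>n. measure \<mu> (?B n)) \<longlonglongrightarrow> 1" using P.prob_space by simp
  then have "eventually (\<lambda>n. measure \<mu> (?B n) > 1 - c) sequentially"
    using r(2) by (intro order_tendstoD) auto
  then obtain n where "measure \<mu> (?B n) > 1 - c" by (auto simp: eventually_sequentially)
  moreover have "q ` {..n} \<subseteq> mspace m" using q C(2) by blast
  ultimately show ?thesis by (intro that[of "q ` {..n}"]) auto
qed

section \<open>Short real-valued functions\<close>

definition short_fun :: "'a metric \<Rightarrow> ('a \<Rightarrow> real) \<Rightarrow> bool" where
  "short_fun m u \<longleftrightarrow> (\<forall>x\<in>mspace m. \<forall>y\<in>mspace m. u x \<le> u y + mdist m x y)"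

lemma short_fun_abs:
  assumes "short_fun m u" "x \<in> mspace m" "y \<in> mspace m" shows "\<bar>u x - u y\<bar> \<le> mdist m x y"
proof -
  have "u x \<le> u y + mdist m x y" "u y \<le> u x + mdist m y x" using assms by (auto simp: short_fun_def)
  then show ?thesis using mdist_commute[of m x y] by linarith
qed

lemma short_fun_superlevel_open:
  assumes "short_fun m u" shows "openin (mtopology_of m) {x \<in> mspace m. u x > c}"
proof -
  interpret M: Metric_space "mspace m" "mdist m" by simp
  have "\<exists>r>0. M.mball x r \<subseteq> {x \<in> mspace m. u x > c}" if x: "x \<in> mspace m" "u x > c" for x
  proof (intro exI[of _ "u x - c"] conjI subsetI)
    fix y assume "y \<in> M.mball x (u x - c)"
    then show "y \<in> {x \<in> mspace m. u x > c}"
      using short_fun_abs[OF assms x(1), of y] by auto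
  qed (use x in simp)
  then show ?thesis by (auto simp: mtopology_of_def M.openin_mtopology)
qed

text \<open>
  The function is the distance to the complement of \<open>V\<close>. If the complement is empty, the infimum
  defining this distance is meaningless, and a positive constant is used instead.
\<close>

lemma open_superlevel:
  assumes "openin (mtopology_of m) V"
  obtains u where "short_fun m u" "{x \<in> mspace m. u x > 0} = V"
proof (cases "V = mspace m")
  case True
  then show ?thesis using that[of "\<lambda>_. 1"] by (auto simp: short_fun_def)
next
  case False
  interpret M: Metric_space "mspace m" "mdist m" by simp
  have V: "V \<subseteq> mspace m" using openin_subset[OF assms] by simp
  let ?C = "mspace m - V"
  have C: "?C \<noteq> {}" using False V by blast
  define u where "u x = (INF y\<in>?C. mdist m x y)" for x
  have bdd: "bdd_below (mdist m x ` ?C)" for x by (auto intro!: bdd_belowI[of _ 0])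
  have "short_fun m u"
    unfolding short_fun_def
  proof (intro ballI)
    fix x y assume xy: "x \<in> mspace m" "y \<in> mspace m"
    have "u x - mdist m x y \<le> mdist m y z" if "z \<in> ?C" for z
    proof -
      have "u x \<le> mdist m x z" unfolding u_def by (rule cINF_lower[OF bdd that])
      also have "\<dots> \<le> mdist m x y + mdist m y z" using xy that by (intro mdist_triangle) auto
      finally show ?thesis by simp
    qed
    then have "u x - mdist m x y \<le> u y" unfolding u_def[of y] by (intro cINF_greatest[OF C])
    then show "u x \<le> u y + mdist m x y" by simp
  qed
  moreover have "u x > 0 \<longleftrightarrow> x \<in> V" if x: "x \<in> mspace m" for x
  proof
    assume "u x > 0"
    show "x \<in> V"
    proof (rule ccontr)
      assume "x \<notin> V"
      then have "u x \<le> mdist m x x" unfolding u_def using x by (intro cINF_lower[OF bdd]) auto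
      then show False using \<open>u x > 0\<close> x by simp
    qed
  next
    assume "x \<in> V"
    then obtain r where r: "r > 0" "M.mball x r \<subseteq> V"
      using assms by (auto simp: mtopology_of_def M.openin_mtopology)
    have "r \<le> mdist m x y" if y: "y \<in> ?C" for y
    proof (rule ccontr)
      assume "\<not> r \<le> mdist m x y"
      then have "y \<in> M.mball x r" using x y by simp
      then show False using r(2) y by blast
    qed
    then have "r \<le> u x" unfolding u_def by (intro cINF_greatest[OF C])
    then show "u x > 0" using r(1) by simp
  qed
  then have "{x \<in> mspace m. u x > 0} = V" using V by auto
  ultimately show ?thesis by (rule that)
qed

section \<open>Points of a Gromov--Prohorov limit\<close>

text \<open>
  The number \<open>d s x\<close> is the distance between \<open>s\<close> and \<open>x\<close> in some ambient space that contains both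
  spaces isometrically. The last two clauses are the two halves of the Prohorov condition with
  parameter \<open>e\<close>. They speak of arbitrary Borel sets \<open>F\<close> that contain the \<open>e\<close>-neighbourhood of \<open>E\<close>, and
  conversely, so that the measurability of neighbourhoods is not an issue.
\<close>

definition bridge :: "'s metric \<Rightarrow> 's measure \<Rightarrow> 'c metric \<Rightarrow> 'c measure \<Rightarrow> ('s \<Rightarrow> 'c \<Rightarrow> real) \<Rightarrow> real \<Rightarrow> bool" 
  where "bridge m \<mu> m' \<mu>' d e \<longleftrightarrow>
    (\<forall>s\<in>mspace m. \<forall>t\<in>mspace m. \<forall>x\<in>mspace m'. 
      d s x \<le> mdist m s t + d t x \<and> mdist m s t \<le> d s x + d t x) \<and>
    (\<forall>s\<in>mspace m. \<forall>x\<in>mspace m'. \<forall>y\<in>mspace m'. 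
      d s x \<le> d s y + mdist m' y x \<and> mdist m' x y \<le> d s x + d s y) \<and>
    (\<forall>E\<in>sets (metric_borel m). \<forall>F\<in>sets (metric_borel m'). 
      (\<forall>s\<in>E. \<forall>x\<in>mspace m'. d s x < e \<longrightarrow> x \<in> F) \<longrightarrow> measure \<mu> E \<le> measure \<mu>' F + e) \<and>
    (\<forall>E\<in>sets (metric_borel m). \<forall>F\<in>sets (metric_borel m'). 
      (\<forall>x\<in>F. \<forall>s\<in>mspace m. d s x < e \<longrightarrow> s \<in> E) \<longrightarrow> measure \<mu>' F \<le> measure \<mu> E + e)"

locale mm_limit =
  fixes U :: "nat filter" and M :: "nat \<Rightarrow> 's metric" and \<kappa> :: "nat \<Rightarrow> 's measure"
    and m :: "'c metric" and \<mu> :: "'c measure" and d :: "nat \<Rightarrow> 's \<Rightarrow> 'c \<Rightarrow> real" and e :: "nat \<Rightarrow> real"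
  assumes ultra: "ultrafilter U"
    and spaces: "\<And>i. mm_space (M i, \<kappa> i)" and limit_space: "mm_space (m, \<mu>)"
    and bridge: "\<And>i. bridge (M i) (\<kappa> i) m \<mu> (d i) (e i)"
    and e_pos: "\<And>i. e i > 0" and e_lim: "(e \<longlongrightarrow> 0) U"
begin

lemma cross:
  shows "s \<in> mspace (M i) \<Longrightarrow> s' \<in> mspace (M i) \<Longrightarrow> x \<in> mspace m \<Longrightarrow> 
      d i s x \<le> mdist (M i) s s' + d i s' x"
    and "s \<in> mspace (M i) \<Longrightarrow> x \<in> mspace m \<Longrightarrow> x' \<in> mspace m \<Longrightarrow> 
      d i s x \<le> d i s x' + mdist m x' x"
    and "s \<in> mspace (M i) \<Longrightarrow> s' \<in> mspace (M i) \<Longrightarrow> x \<in> mspace m \<Longrightarrow> 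
      mdist (M i) s s' \<le> d i s x + d i s' x"
    and "s \<in> mspace (M i) \<Longrightarrow> x \<in> mspace m \<Longrightarrow> x' \<in> mspace m \<Longrightarrow> 
      mdist m x x' \<le> d i s x + d i s x'"
  using bridge[of i, unfolded bridge_def, THEN conjunct1]
    bridge[of i, unfolded bridge_def, THEN conjunct2, THEN conjunct1] by simp_all

lemma transfer:
  assumes "E \<in> sets (metric_borel (M i))" "F \<in> sets (metric_borel m)"
  shows "(\<And>s x. s \<in> E \<Longrightarrow> x \<in> mspace m \<Longrightarrow> d i s x < e i \<Longrightarrow> x \<in> F) \<Longrightarrow> 
      measure (\<kappa> i) E \<le> measure \<mu> F + e i"
    and "(\<And>s x. x \<in> F \<Longrightarrow> s \<in> mspace (M i) \<Longrightarrow> d i s x < e i \<Longrightarrow> s \<in> E) \<Longrightarrow> 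
      measure \<mu> F \<le> measure (\<kappa> i) E + e i"
proof -
  note conj = bridge[of i, unfolded bridge_def, THEN conjunct2, THEN conjunct2]
  show "measure (\<kappa> i) E \<le> measure \<mu> F + e i"
    if "\<And>s x. s \<in> E \<Longrightarrow> x \<in> mspace m \<Longrightarrow> d i s x < e i \<Longrightarrow> x \<in> F"
    using conj[THEN conjunct1, rule_format, OF assms] that by blast
  show "measure \<mu> F \<le> measure (\<kappa> i) E + e i"
    if "\<And>s x. x \<in> F \<Longrightarrow> s \<in> mspace (M i) \<Longrightarrow> d i s x < e i \<Longrightarrow> s \<in> E"
    using conj[THEN conjunct2, rule_format, OF assms] that by blast
qed

lemma U_nontrivial: "U \<noteq> bot" using ultra by (simp add: ultrafilter_def)

lemma eventually_U_const: "eventually (\<lambda>i. P) U \<longleftrightarrow> P"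
  using U_nontrivial by simp

lemma e_small: "r > 0 \<Longrightarrow> eventually (\<lambda>i. e i < r) U"
  using e_lim by (rule order_tendstoD)

lemma cross_nonneg: "s \<in> mspace (M i) \<Longrightarrow> x \<in> mspace m \<Longrightarrow> d i s x \<ge> 0"
  using cross(3)[of s i s x] by simp

sublocale P: prob_space \<mu> by (rule mm_space_prob[OF limit_space])

lemma prob_M: "prob_space (\<kappa> i)" by (rule mm_space_prob[OF spaces])

definition conv :: "(nat \<Rightarrow> 's) \<Rightarrow> 'c \<Rightarrow> bool" where
  "conv s x \<longleftrightarrow> (\<forall>i. s i \<in> mspace (M i)) \<and> x \<in> mspace m \<and> ((\<lambda>i. d i (s i) x) \<longlongrightarrow> 0) U"

text \<open>
  Being solid characterises the sequences that converge to some point of the limit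
  (\<open>conv_imp_solid\<close> and \<open>solid_imp_conv\<close>), without mentioning the limit.
\<close>

definition solid :: "(nat \<Rightarrow> 's) \<Rightarrow> bool" where
  "solid s \<longleftrightarrow> (\<forall>i. s i \<in> mspace (M i)) \<and>
     (\<forall>r>0. \<exists>c>0. eventually (\<lambda>i. measure (\<kappa> i) (mball_of (M i) (s i) r) \<ge> c) U)"

lemma conv_mem: "conv s x \<Longrightarrow> s i \<in> mspace (M i)" "conv s x \<Longrightarrow> x \<in> mspace m"
  by (auto simp: conv_def)

lemma conv_small: "conv s x \<Longrightarrow> r > 0 \<Longrightarrow> eventually (\<lambda>i. d i (s i) x < r) U"
  unfolding conv_def by (auto intro: order_tendstoD)

lemma convI:
  assumes "\<And>i. s i \<in> mspace (M i)" "x \<in> mspace m" "\<And>r. r > 0 \<Longrightarrow> eventually (\<lambda>i. d i (s i) x < r) U"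
  shows "conv s x"
proof -
  have "((\<lambda>i. d i (s i) x) \<longlongrightarrow> 0) U"
  proof (rule tendstoI)
    fix r :: real assume "r > 0"
    from assms(3)[OF this] show "eventually (\<lambda>i. dist (d i (s i) x) 0 < r) U"
      by eventually_elim (use cross_nonneg assms in auto)
  qed
  then show ?thesis using assms by (simp add: conv_def)
qed

text \<open>
  A ball around \<open>x\<close> has positive mass, which forces points of the approximating spaces close to it. The
  sequence is chosen nearly optimal at each index, up to \<open>e i\<close>, so that one choice serves all scales.
\<close>

lemma conv_exists: assumes x: "x \<in> mspace m" shows "\<exists>s. conv s x"
proof -
  have near: "eventually (\<lambda>i. \<exists>s\<in>mspace (M i). d i s x < r) U" if r: "r > 0" for r
  proof -
    have pos: "measure \<mu> (mball_of m x (r / 2)) > 0" using mm_space_ball_pos[OF limit_space x] r by simp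
    have "eventually (\<lambda>i. e i < r / 2) U" using e_small[of "r / 2"] r by simp
    with e_small[OF pos] show ?thesis
    proof eventually_elim
      case (elim i)
      show ?case
      proof (rule ccontr)
        assume none: "\<not> ?case"
        have "measure \<mu> (mball_of m x (r / 2)) \<le> measure (\<kappa> i) {} + e i"
        proof (rule transfer(2)[OF _ mball_of_borel])
          fix s x' assume x': "x' \<in> mball_of m x (r / 2)" and s: "s \<in> mspace (M i)" "d i s x' < e i"
          have "d i s x \<le> d i s x' + mdist m x' x" using cross(2)[OF s(1) x] x' by simp
          then have "d i s x < r" using s(2) elim(2) x' by (simp add: mdist_commute)
          then show "s \<in> {}" using none s(1) by blast
        qed simp
        then show False using elim(1) by simp
      qed
    qed
  qed
  have "\<exists>s\<in>mspace (M i). \<forall>s'\<in>mspace (M i). d i s x < d i s' x + e i" for i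
  proof -
    let ?D = "(\<lambda>s. d i s x) ` mspace (M i)"
    have ne: "?D \<noteq> {}" using prob_space.not_empty[OF prob_M[of i]] mm_space_space[OF spaces[of i]] by auto
    have bdd: "bdd_below ?D" using cross_nonneg x by (auto intro!: bdd_belowI[of _ 0])
    have "Inf ?D < Inf ?D + e i" using e_pos by simp
    then obtain s where s: "s \<in> mspace (M i)" "d i s x < Inf ?D + e i"
      using cInf_lessD[OF ne] by blast
    have "Inf ?D \<le> d i s' x" if "s' \<in> mspace (M i)" for s' using cInf_lower[OF _ bdd] that by simp
    then show ?thesis using s by (intro bexI[of _ s]) (auto intro: less_le_trans)
  qed
  then obtain s where s: "\<And>i. s i \<in> mspace (M i)" 
    "\<And>i s'. s' \<in> mspace (M i) \<Longrightarrow> d i (s i) x < d i s' x + e i" by metis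
  have "conv s x"
  proof (rule convI[OF s(1) x])
    fix r :: real assume "r > 0"
    then have "eventually (\<lambda>i. \<exists>s\<in>mspace (M i). d i s x < r / 2) U" "eventually (\<lambda>i. e i < r / 2) U"
      using near[of "r / 2"] e_small[of "r / 2"] by simp_all
    then show "eventually (\<lambda>i. d i (s i) x < r) U"
    proof eventually_elim
      case (elim i)
      then show ?case using s(2) by fastforce
    qed
  qed
  then show ?thesis by blast
qed

text \<open>
  The mass of a small ball around \<open>x\<close> is transferred to the balls around the members of the sequence.
\<close>

lemma conv_imp_solid: assumes "conv s x" shows "solid s"
  unfolding solid_def
proof (intro conjI allI impI)
  note mem = conv_mem[OF assms]
  show "s i \<in> mspace (M i)" for i by (rule mem)
  fix r :: real assume r: "r > 0"
  let ?p = "measure \<mu> (mball_of m x (r / 3))"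
  have pos: "?p > 0" using mm_space_ball_pos[OF limit_space mem(2)] r by simp
  have "eventually (\<lambda>i. e i < ?p / 2) U" "eventually (\<lambda>i. e i < r / 3) U" 
    "eventually (\<lambda>i. d i (s i) x < r / 3) U"
    using pos r e_small[of "?p / 2"] e_small[of "r / 3"] conv_small[OF assms, of "r / 3"] by simp_all
  then have "eventually (\<lambda>i. ?p / 2 \<le> measure (\<kappa> i) (mball_of (M i) (s i) r)) U"
  proof eventually_elim
    case (elim i)
    have "?p \<le> measure (\<kappa> i) (mball_of (M i) (s i) r) + e i"
    proof (rule transfer(2)[OF mball_of_borel mball_of_borel])
      fix t y assume y: "y \<in> mball_of m x (r / 3)" and t: "t \<in> mspace (M i)" "d i t y < e i"
      have "mdist (M i) (s i) t \<le> d i (s i) y + d i t y" using cross(3) mem t y by simp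
      moreover have "d i (s i) y \<le> d i (s i) x + mdist m x y" using cross(2) mem y by simp
      ultimately show "t \<in> mball_of (M i) (s i) r" using y t mem elim by simp
    qed
    then show ?case using elim(1) by simp
  qed
  then show "\<exists>c>0. eventually (\<lambda>i. c \<le> measure (\<kappa> i) (mball_of (M i) (s i) r)) U"
    using pos by (intro exI[of _ "?p / 2"]) simp
qed

text \<open>
  The mass around \<open>s i\<close>, transferred to the limit, cannot avoid a finite union of balls that carries almost
  all mass. So one of these balls is close to \<open>s i\<close> for almost all \<open>i\<close>, and this at every scale.
\<close>

lemma solid_imp_conv: assumes "solid s" shows "\<exists>x. conv s x"
proof -
  have mem: "s i \<in> mspace (M i)" for i using assms by (simp add: solid_def)
  have "\<exists>x\<in>mspace m. ((\<lambda>i. d i (s i) x) \<longlongrightarrow> 0) U"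
  proof (rule complete_filter_limit[OF _ U_nontrivial])
    show "mcomplete_of m" using limit_space by (simp add: mm_space_def)
    show "mdist m x y \<le> d i (s i) x + d i (s i) y" "d i (s i) y \<le> d i (s i) x + mdist m x y"
      if "x \<in> mspace m" "y \<in> mspace m" for i x y
      using cross(2,4) mem that by blast+
    fix r :: real assume r: "r > 0"
    obtain c where c: "c > 0" "eventually (\<lambda>i. c \<le> measure (\<kappa> i) (mball_of (M i) (s i) (r / 3))) U"
      using assms r unfolding solid_def by (metis divide_pos_pos zero_less_numeral)
    have "0 < r / 3" "0 < c / 2" using r c by simp_all
    then obtain C where C: "finite C" "C \<subseteq> mspace m" 
      "measure \<mu> (\<Union>y\<in>C. mball_of m y (r / 3)) > 1 - c / 2" by (rule mm_space_tight[OF limit_space])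
    let ?K = "\<Union>y\<in>C. mball_of m y (r / 3)"
    have K: "?K \<in> sets \<mu>" 
      unfolding mm_space_sets[OF limit_space] by (intro sets.finite_UN[OF C(1)] mball_of_borel)
    have sp: "space \<mu> = mspace m" by (rule mm_space_space[OF limit_space])
    have "eventually (\<lambda>i. e i < c / 2) U" "eventually (\<lambda>i. e i < r / 3) U" 
      using e_small[of "c / 2"] e_small[of "r / 3"] r c by simp_all
    with c(2) have "eventually (\<lambda>i. \<exists>y\<in>C. d i (s i) y < r) U"
    proof eventually_elim
      case (elim i)
      show ?case
      proof (rule ccontr)
        assume none: "\<not> ?case"
        have "measure (\<kappa> i) (mball_of (M i) (s i) (r / 3)) \<le> measure \<mu> (space \<mu> - ?K) + e i"
        proof (rule transfer(1)[OF mball_of_borel])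
          show "space \<mu> - ?K \<in> sets (metric_borel m)" 
            using sets.compl_sets[OF K] mm_space_sets[OF limit_space] by simp
          fix t x assume t: "t \<in> mball_of (M i) (s i) (r / 3)" and x: "x \<in> mspace m" "d i t x < e i"
          have "x \<notin> mball_of m y (r / 3)" if y: "y \<in> C" for y
          proof
            assume xy: "x \<in> mball_of m y (r / 3)"
            have ym: "y \<in> mspace m" using y C by auto
            have "d i (s i) y \<le> d i (s i) x + mdist m x y" using cross(2) mem x ym by blast
            moreover have "d i (s i) x \<le> mdist (M i) (s i) t + d i t x" using cross(1) mem x t by simp
            ultimately have "d i (s i) y < r" using t x xy elim by (simp add: mdist_commute)
            then show False using none y by blast
          qed
          then show "x \<in> space \<mu> - ?K" using x sp by blast
        qed
        moreover have "measure \<mu> (space \<mu> - ?K) < c / 2" using P.prob_compl[OF K] C(3) by simp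
        ultimately show False using elim by linarith
      qed
    qed
    from ultrafilter_finite[OF ultra C(1) this]
    show "\<exists>y\<in>mspace m. eventually (\<lambda>i. d i (s i) y < r) U" using C(2) by blast
  qed
  then show ?thesis using mem by (auto simp: conv_def)
qed

lemma conv_dist:
  assumes "conv s x" "conv t y" shows "((\<lambda>i. mdist (M i) (s i) (t i)) \<longlongrightarrow> mdist m x y) U"
proof -
  note s = conv_mem[OF assms(1)] and t = conv_mem[OF assms(2)]
  show ?thesis
  proof (rule real_tendsto_dominated)
    show "((\<lambda>i. d i (s i) x + d i (t i) y) \<longlongrightarrow> 0) U"
      using assms tendsto_add[of "\<lambda>i. d i (s i) x" 0 U "\<lambda>i. d i (t i) y" 0] by (simp add: conv_def)
    fix i
    have "mdist (M i) (s i) (t i) \<le> d i (s i) x + d i (t i) x" using cross(3) s t by blast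
    moreover have "d i (t i) x \<le> d i (t i) y + mdist m y x" using cross(2) s t by blast
    moreover have "mdist m x y \<le> d i (s i) x + d i (s i) y" using cross(4) s t by blast
    moreover have "d i (s i) y \<le> mdist (M i) (s i) (t i) + d i (t i) y" using cross(1) s t by blast
    ultimately show "\<bar>mdist (M i) (s i) (t i) - mdist m x y\<bar> \<le> d i (s i) x + d i (t i) y"
      by (simp add: mdist_commute)
  qed
qed

lemma conv_unique: assumes "conv s x" "conv s y" shows "x = y"
proof -
  note s = conv_mem[OF assms(1)] and t = conv_mem[OF assms(2)]
  have "((\<lambda>i. 0) \<longlongrightarrow> mdist m x y) U" using conv_dist[OF assms] s by simp
  then have "mdist m x y = 0" using tendsto_unique[OF U_nontrivial tendsto_const] by metis
  then show ?thesis using s t by simp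
qed

lemma conv_move:
  assumes "conv s x" "\<And>i. t i \<in> mspace (M i)" "((\<lambda>i. mdist (M i) (t i) (s i)) \<longlongrightarrow> 0) U"
  shows "conv t x"
proof (rule convI[OF assms(2)])
  note s = conv_mem[OF assms(1)]
  show "x \<in> mspace m" by (rule s)
  fix r :: real assume "r > 0"
  then have "eventually (\<lambda>i. d i (s i) x < r / 2) U" "eventually (\<lambda>i. mdist (M i) (t i) (s i) < r / 2) U"
    using conv_small[OF assms(1), of "r / 2"] order_tendstoD(2)[OF assms(3), of "r / 2"] by simp_all
  then show "eventually (\<lambda>i. d i (t i) x < r) U"
  proof eventually_elim
    case (elim i)
    then show ?case using cross(1)[OF assms(2) s, of i] by linarith
  qed
qed

text \<open>
  Pointwise convergence is made uniform on a set of almost full mass by checking it at the finitely many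
  centres of balls that cover this set; the Lipschitz bounds do the rest.
\<close>

lemma conv_uniform:
  assumes short: "\<And>i. short_fun (M i) (\<phi> i)" "short_fun m \<psi>"
    and lim: "\<And>s x. conv s x \<Longrightarrow> ((\<lambda>i. \<phi> i (s i)) \<longlongrightarrow> \<psi> x) U" and \<eta>: "\<eta> > 0"
  obtains K where "K \<in> sets (metric_borel m)" "measure \<mu> (space \<mu> - K) < \<eta>"
    "eventually (\<lambda>i. \<forall>x\<in>K. \<forall>s\<in>mspace (M i). d i s x < \<eta> \<longrightarrow> \<bar>\<phi> i s - \<psi> x\<bar> < 5 * \<eta>) U"
proof -
  obtain C where C: "finite C" "C \<subseteq> mspace m" 
    "measure \<mu> (\<Union>y\<in>C. mball_of m y \<eta>) > 1 - \<eta>" by (rule mm_space_tight[OF limit_space \<eta> \<eta>])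
  let ?K = "\<Union>y\<in>C. mball_of m y \<eta>"
  have K: "?K \<in> sets (metric_borel m)" by (intro sets.finite_UN[OF C(1)] mball_of_borel)
  then have "measure \<mu> (space \<mu> - ?K) < \<eta>"
    using P.prob_compl[of ?K] C(3) mm_space_sets[OF limit_space] by simp
  have "\<forall>y\<in>C. \<exists>s. conv s y" using conv_exists C(2) by blast
  then obtain \<sigma> where \<sigma>: "\<And>y. y \<in> C \<Longrightarrow> conv (\<sigma> y) y" by metis
  have "eventually (\<lambda>i. d i (\<sigma> y i) y < \<eta> \<and> \<bar>\<phi> i (\<sigma> y i) - \<psi> y\<bar> < \<eta>) U" if "y \<in> C" for y
    using conv_small[OF \<sigma>[OF that] \<eta>] tendstoD[OF lim[OF \<sigma>[OF that]] \<eta>] 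
    by eventually_elim (simp add: dist_real_def)
  then have "eventually (\<lambda>i. \<forall>y\<in>C. d i (\<sigma> y i) y < \<eta> \<and> \<bar>\<phi> i (\<sigma> y i) - \<psi> y\<bar> < \<eta>) U"
    using C(1) by (simp add: eventually_ball_finite)
  then have "eventually (\<lambda>i. \<forall>x\<in>?K. \<forall>s\<in>mspace (M i). d i s x < \<eta> \<longrightarrow> \<bar>\<phi> i s - \<psi> x\<bar> < 5 * \<eta>) U"
  proof eventually_elim
    case (elim i)
    show ?case
    proof (intro ballI impI)
      fix x s assume x: "x \<in> ?K" and s: "s \<in> mspace (M i)" "d i s x < \<eta>"
      then obtain y where y: "y \<in> C" "x \<in> mball_of m y \<eta>" by blast
      have xm: "x \<in> mspace m" and ym: "y \<in> mspace m" and xy: "mdist m y x < \<eta>" using y by auto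
      have t: "\<sigma> y i \<in> mspace (M i)" by (rule conv_mem[OF \<sigma>[OF y(1)]])
      have "mdist (M i) s (\<sigma> y i) \<le> d i s x + d i (\<sigma> y i) x" using cross(3) s t xm by blast
      moreover have "d i (\<sigma> y i) x \<le> d i (\<sigma> y i) y + mdist m y x" using cross(2) t xm ym by blast
      ultimately have "mdist (M i) s (\<sigma> y i) < 3 * \<eta>" using elim y(1) s(2) xy by force
      moreover have "\<bar>\<phi> i (\<sigma> y i) - \<psi> y\<bar> < \<eta>" using elim y(1) by blast
      ultimately show "\<bar>\<phi> i s - \<psi> x\<bar> < 5 * \<eta>"
        using short_fun_abs[OF short(1) s(1) t] short_fun_abs[OF short(2) ym xm] xy by linarith
    qed
  qed
  with K \<open>measure \<mu> (space \<mu> - ?K) < \<eta>\<close> show ?thesis by (rule that)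
qed

text \<open>
  A substitute for weak convergence of the laws of \<open>\<phi> i\<close> to the law of \<open>\<psi>\<close>, in which the loss \<open>\<eta>\<close> appears both in the
  level and in the mass.
\<close>

lemma superlevel_limit:
  assumes short: "\<And>i. short_fun (M i) (\<phi> i)" "short_fun m \<psi>"
    and lim: "\<And>s x. conv s x \<Longrightarrow> ((\<lambda>i. \<phi> i (s i)) \<longlongrightarrow> \<psi> x) U" and \<eta>: "\<eta> > 0"
  shows "eventually (\<lambda>i. measure \<mu> {x \<in> mspace m. \<psi> x > c} \<le> 
      measure (\<kappa> i) {s \<in> mspace (M i). \<phi> i s > c - \<eta>} + \<eta>) U"
    and "eventually (\<lambda>i. measure (\<kappa> i) {s \<in> mspace (M i). \<phi> i s > c} \<le> 
      measure \<mu> {x \<in> mspace m. \<psi> x > c - \<eta>} + \<eta>) U"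
proof -
  define \<delta> where "\<delta> = \<eta> / 5"
  have \<delta>: "\<delta> > 0" "5 * \<delta> = \<eta>" using \<eta> by (simp_all add: \<delta>_def)
  obtain K where K: "K \<in> sets (metric_borel m)" "measure \<mu> (space \<mu> - K) < \<delta>"
    "eventually (\<lambda>i. \<forall>x\<in>K. \<forall>s\<in>mspace (M i). d i s x < \<delta> \<longrightarrow> \<bar>\<phi> i s - \<psi> x\<bar> < 5 * \<delta>) U"
    by (rule conv_uniform[OF short lim \<delta>(1)])
  note sets = mm_space_sets[OF limit_space] and sp = mm_space_space[OF limit_space]
  have "K \<in> sets \<mu>" using K(1) sets by simp
  then have Kc: "space \<mu> - K \<in> sets \<mu>" by (rule sets.compl_sets)
  have lev: "{x \<in> mspace m. \<psi> x > c} \<in> sets (metric_borel m)" for c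
    by (rule openin_metric_borel[OF short_fun_superlevel_open[OF short(2)]])
  have lev': "{s \<in> mspace (M i). \<phi> i s > c} \<in> sets (metric_borel (M i))" for c i
    by (rule openin_metric_borel[OF short_fun_superlevel_open[OF short(1)]])
  show "eventually (\<lambda>i. measure \<mu> {x \<in> mspace m. \<psi> x > c} \<le> 
      measure (\<kappa> i) {s \<in> mspace (M i). \<phi> i s > c - \<eta>} + \<eta>) U"
    using K(3) e_small[OF \<delta>(1)]
  proof eventually_elim
    case (elim i)
    let ?F = "{x \<in> mspace m. \<psi> x > c}" and ?E = "{s \<in> mspace (M i). \<phi> i s > c - \<eta>}"
    have FK: "?F \<inter> K \<in> sets \<mu>" unfolding sets by (intro sets.Int lev K(1))
    have "?F \<subseteq> (?F \<inter> K) \<union> (space \<mu> - K)" using sp by blast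
    then have "measure \<mu> ?F \<le> measure \<mu> ((?F \<inter> K) \<union> (space \<mu> - K))"
      by (rule P.finite_measure_mono) (intro sets.Un FK Kc)
    also have "\<dots> \<le> measure \<mu> (?F \<inter> K) + measure \<mu> (space \<mu> - K)"
      by (rule measure_Un_le[OF FK Kc])
    also have "measure \<mu> (?F \<inter> K) \<le> measure (\<kappa> i) ?E + e i"
    proof (rule transfer(2)[OF lev'])
      show "?F \<inter> K \<in> sets (metric_borel m)" using lev K(1) by blast
      fix s x assume x: "x \<in> ?F \<inter> K" and s: "s \<in> mspace (M i)" "d i s x < e i"
      have "\<bar>\<phi> i s - \<psi> x\<bar> < \<eta>" using elim x s \<delta> by force
      then show "s \<in> ?E" using x s(1) by auto
    qed
    finally show ?case using K(2) elim(2) \<delta> by linarith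
  qed
  show "eventually (\<lambda>i. measure (\<kappa> i) {s \<in> mspace (M i). \<phi> i s > c} \<le> 
      measure \<mu> {x \<in> mspace m. \<psi> x > c - \<eta>} + \<eta>) U"
    using K(3) e_small[OF \<delta>(1)]
  proof eventually_elim
    case (elim i)
    let ?F = "{x \<in> mspace m. \<psi> x > c - \<eta>}" and ?E = "{s \<in> mspace (M i). \<phi> i s > c}"
    have "measure (\<kappa> i) ?E \<le> measure \<mu> (?F \<union> (space \<mu> - K)) + e i"
    proof (rule transfer(1)[OF lev'])
      show "?F \<union> (space \<mu> - K) \<in> sets (metric_borel m)" using lev Kc sets by blast
      fix s x assume s: "s \<in> ?E" and x: "x \<in> mspace m" "d i s x < e i"
      show "x \<in> ?F \<union> (space \<mu> - K)"
      proof (cases "x \<in> K")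
        case True
        then have "\<bar>\<phi> i s - \<psi> x\<bar> < \<eta>" using elim x s \<delta> by force
        then show ?thesis using x(1) s by auto
      qed (use x sp in auto)
    qed
    also have "measure \<mu> (?F \<union> (space \<mu> - K)) \<le> measure \<mu> ?F + measure \<mu> (space \<mu> - K)"
      using sets lev Kc by (intro measure_Un_le) simp_all
    finally show ?case using K(2) elim(2) \<delta> by linarith
  qed
qed

end

lemma superlevel_tendsto:
  assumes X: "mm_space (m, \<mu>)" and \<psi>: "short_fun m \<psi>"
  shows "(\<lambda>n. measure \<mu> {x \<in> mspace m. \<psi> x > 2 / real (Suc n)}) \<longlonglongrightarrow> measure \<mu> {x \<in> mspace m. \<psi> x > 0}"
proof -
  interpret P: prob_space \<mu> by (rule mm_space_prob[OF X])
  let ?L = "\<lambda>n. {x \<in> mspace m. \<psi> x > 2 / real (Suc n)}"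
  have "?L n \<in> sets \<mu>" for n
    unfolding mm_space_sets[OF X] by (rule openin_metric_borel[OF short_fun_superlevel_open[OF \<psi>]])
  then have "range ?L \<subseteq> sets \<mu>" by blast
  moreover have "incseq ?L"
  proof (rule incseq_SucI)
    fix n
    have "2 / real (Suc (Suc n)) \<le> 2 / real (Suc n)" by (simp add: frac_le)
    then show "?L n \<subseteq> ?L (Suc n)" by (auto intro: le_less_trans)
  qed
  ultimately have "(\<lambda>n. measure \<mu> (?L n)) \<longlonglongrightarrow> measure \<mu> (\<Union>n. ?L n)"
    by (rule P.finite_Lim_measure_incseq)
  moreover have "(\<Union>n. ?L n) = {x \<in> mspace m. \<psi> x > 0}"
  proof (intro subset_antisym subsetI)
    fix x assume "x \<in> (\<Union>n. ?L n)"
    then obtain n where "x \<in> mspace m" "\<psi> x > 2 / real (Suc n)" by blast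
    moreover have "2 / real (Suc n) > 0" by simp
    ultimately show "x \<in> {x \<in> mspace m. \<psi> x > 0}" using less_trans by blast
  next
    fix x assume x: "x \<in> {x \<in> mspace m. \<psi> x > 0}"
    then obtain n where "inverse (real (Suc n)) < \<psi> x / 2" using reals_Archimedean[of "\<psi> x / 2"] by auto
    then have "2 / real (Suc n) < \<psi> x" by (simp add: field_simps)
    then show "x \<in> (\<Union>n. ?L n)" using x by blast
  qed
  ultimately show ?thesis by simp
qed

text \<open>
  McShane's formula, with the distance in the ambient space: the infimum of
  \<open>v x + d i s x\<close> over \<open>x\<close>. It differs from \<open>v x\<close> by at most \<open>d i s x\<close>, hence converges along every
  sequence that converges to \<open>x\<close>.
\<close>

lemma (in mm_limit) McShane_extension:
  assumes v: "short_fun m v"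
  obtains w where "\<And>i. short_fun (M i) (w i)" "\<And>s x. conv s x \<Longrightarrow> ((\<lambda>i. w i (s i)) \<longlongrightarrow> v x) U"
proof -
  define w where "w i s = (INF x\<in>mspace m. v x + d i s x)" for i s
  have ne: "mspace m \<noteq> {}" using P.not_empty mm_space_space[OF limit_space] by simp
  then obtain x0 where x0: "x0 \<in> mspace m" by blast
  have lower: "v x - d i s x \<le> v y + d i s y" if "s \<in> mspace (M i)" "x \<in> mspace m" "y \<in> mspace m" for i s x y
    using cross(4)[OF that] short_fun_abs[OF v that(2,3)] by linarith
  have bdd: "bdd_below ((\<lambda>x. v x + d i s x) ` mspace m)" if "s \<in> mspace (M i)" for i s
    by (rule bdd_belowI2[of _ "v x0 - d i s x0"]) (rule lower[OF that x0])
  have w_le: "w i s \<le> v x + d i s x" if "s \<in> mspace (M i)" "x \<in> mspace m" for i s x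
    unfolding w_def by (rule cINF_lower[OF bdd[OF that(1)] that(2)])
  have w_ge: "v x - d i s x \<le> w i s" if "s \<in> mspace (M i)" "x \<in> mspace m" for i s x
    unfolding w_def by (rule cINF_greatest[OF ne lower[OF that]])
  have "short_fun (M i) (w i)" for i
    unfolding short_fun_def
  proof (intro ballI)
    fix s t assume st: "s \<in> mspace (M i)" "t \<in> mspace (M i)"
    have "w i s - mdist (M i) s t \<le> v x + d i t x" if "x \<in> mspace m" for x
      using w_le[OF st(1) that] cross(1)[OF st that] by linarith
    then have "w i s - mdist (M i) s t \<le> w i t" unfolding w_def[of i t] by (rule cINF_greatest[OF ne])
    then show "w i s \<le> w i t + mdist (M i) s t" by simp
  qed
  moreover have "((\<lambda>i. w i (s i)) \<longlongrightarrow> v x) U" if c: "conv s x" for s x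
  proof -
    note mem = conv_mem[OF c]
    show ?thesis
    proof (rule real_tendsto_dominated)
      show "\<bar>w i (s i) - v x\<bar> \<le> d i (s i) x" for i
        using w_le[OF mem] w_ge[OF mem] by (simp add: abs_le_iff algebra_simps)
      show "((\<lambda>i. d i (s i) x) \<longlongrightarrow> 0) U" using c by (simp add: conv_def)
    qed
  qed
  ultimately show ?thesis by (rule that)
qed

section \<open>Limits of sums with a fixed summand\<close>

text \<open>
  The point \<open>z\<close> is a base point; the complement of the fixed summand in the limit will be the fibre over it.
\<close>

locale mm_sum_limit = mm_limit U "\<lambda>i. l1_metric a (b i)" "\<lambda>i. \<nu> \<Otimes>\<^sub>M \<tau> i" m \<mu> d e
  for U :: "nat filter" and a :: "'a metric" and \<nu> :: "'a measure" 
    and b :: "nat \<Rightarrow> 'b metric" and \<tau> :: "nat \<Rightarrow> 'b measure"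
    and m :: "'c metric" and \<mu> :: "'c measure" and d :: "nat \<Rightarrow> 'a \<times> 'b \<Rightarrow> 'c \<Rightarrow> real" and e :: "nat \<Rightarrow> real" +
  fixes z :: 'a
  assumes summands: "mm_space (a, \<nu>)" "\<And>i. mm_space (b i, \<tau> i)" and z: "z \<in> mspace a"
begin

lemma prob_A: "prob_space \<nu>" and prob_B: "prob_space (\<tau> i)"
  using summands mm_space_prob by blast+

lemma measure_rectangle:
  assumes "V \<in> sets (metric_borel a)" "W \<in> sets (metric_borel (b i))"
  shows "measure (\<nu> \<Otimes>\<^sub>M \<tau> i) (V \<times> W) = measure \<nu> V * measure (\<tau> i) W"
proof -
  interpret B: prob_space "\<tau> i" by (rule prob_B)
  show ?thesis
    using B.emeasure_pair_measure_Times[of V \<nu> W] assms mm_space_sets[OF summands(1)] 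
      mm_space_sets[OF summands(2)] by (simp add: measure_def enn2real_mult)
qed

lemma measure_whole: "measure \<nu> (mspace a) = 1" "measure (\<tau> i) (mspace (b i)) = 1"
  using prob_space.prob_space[OF prob_A] prob_space.prob_space[OF prob_B]
  by (simp_all add: mm_space_space[OF summands(1)] mm_space_space[OF summands(2)])

lemma mspace_borel: "mspace m' \<in> sets (metric_borel m')"
  using sets.top[of "metric_borel m'"] by simp

lemma conv_components: "conv s x \<Longrightarrow> fst (s i) \<in> mspace a" "conv s x \<Longrightarrow> snd (s i) \<in> mspace (b i)"
  using conv_mem(1)[of s x i] by auto

lemma mono_pair:
  assumes "R \<subseteq> R'" "R' \<in> sets (metric_borel (l1_metric a (b i)))"
  shows "measure (\<nu> \<Otimes>\<^sub>M \<tau> i) R \<le> measure (\<nu> \<Otimes>\<^sub>M \<tau> i) R'"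
  using finite_measure.finite_measure_mono[OF prob_space.finite_measure[OF prob_M[of i]] assms(1)]
    assms(2) mm_space_sets[OF spaces[of i]] by simp

lemma rectangle_borel:
  assumes "V \<in> sets (metric_borel a)" "W \<in> sets (metric_borel (b i))"
  shows "V \<times> W \<in> sets (metric_borel (l1_metric a (b i)))"
  unfolding mm_space_sets[OF spaces[of i], symmetric]
  using assms mm_space_sets[OF summands(1)] mm_space_sets[OF summands(2)] by simp

lemma solid_components:
  assumes "solid s" "r > 0"
  shows "\<exists>c>0. eventually (\<lambda>i. measure \<nu> (mball_of a (fst (s i)) r) \<ge> c) U"
    and "\<exists>c>0. eventually (\<lambda>i. measure (\<tau> i) (mball_of (b i) (snd (s i)) r) \<ge> c) U"
proof -
  obtain c where c: "c > 0" 
    "eventually (\<lambda>i. c \<le> measure (\<nu> \<Otimes>\<^sub>M \<tau> i) (mball_of (l1_metric a (b i)) (s i) r)) U"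
    using assms unfolding solid_def by blast
  have bound: "measure (\<nu> \<Otimes>\<^sub>M \<tau> i) (mball_of (l1_metric a (b i)) (s i) r) \<le> measure \<nu> (mball_of a (fst (s i)) r)"
      "measure (\<nu> \<Otimes>\<^sub>M \<tau> i) (mball_of (l1_metric a (b i)) (s i) r) \<le> measure (\<tau> i) (mball_of (b i) (snd (s i)) r)" for i
  proof -
    have lt: "p + q < r \<Longrightarrow> q \<ge> 0 \<Longrightarrow> p < r" "p + q < r \<Longrightarrow> p \<ge> 0 \<Longrightarrow> q < r" for p q :: real by linarith+
    have sub: "mball_of (l1_metric a (b i)) (s i) r \<subseteq> mball_of a (fst (s i)) r \<times> mspace (b i)"
      "mball_of (l1_metric a (b i)) (s i) r \<subseteq> mspace a \<times> mball_of (b i) (snd (s i)) r"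
      by (auto simp: case_prod_beta intro: lt(1)[OF _ mdist_nonneg] lt(2)[OF _ mdist_nonneg])
    show "measure (\<nu> \<Otimes>\<^sub>M \<tau> i) (mball_of (l1_metric a (b i)) (s i) r) \<le> measure \<nu> (mball_of a (fst (s i)) r)"
      using mono_pair[OF sub(1) rectangle_borel[OF mball_of_borel mspace_borel]] 
        measure_rectangle[where i = i, OF mball_of_borel mspace_borel] measure_whole by simp
    show "measure (\<nu> \<Otimes>\<^sub>M \<tau> i) (mball_of (l1_metric a (b i)) (s i) r) \<le> measure (\<tau> i) (mball_of (b i) (snd (s i)) r)"
      using mono_pair[OF sub(2) rectangle_borel[OF mspace_borel mball_of_borel]] 
        measure_rectangle[where i = i, OF mspace_borel mball_of_borel] measure_whole by simp
  qed
  show "\<exists>c>0. eventually (\<lambda>i. measure \<nu> (mball_of a (fst (s i)) r) \<ge> c) U"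
  proof (intro exI[of _ c] conjI c(1))
    show "eventually (\<lambda>i. measure \<nu> (mball_of a (fst (s i)) r) \<ge> c) U"
      using c(2) by eventually_elim (rule order_trans[OF _ bound(1)])
  qed
  show "\<exists>c>0. eventually (\<lambda>i. measure (\<tau> i) (mball_of (b i) (snd (s i)) r) \<ge> c) U"
  proof (intro exI[of _ c] conjI c(1))
    show "eventually (\<lambda>i. measure (\<tau> i) (mball_of (b i) (snd (s i)) r) \<ge> c) U"
      using c(2) by eventually_elim (rule order_trans[OF _ bound(2)])
  qed
qed

text \<open>
  In a sum, a sequence is solid if both of its coordinates keep mass around them. The second coordinate
  does so because \<open>s\<close> is solid, and the constant \<open>p\<close> does so by full support.
\<close>

lemma conv_replace:
  assumes s: "conv s x" and p: "p \<in> mspace a"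
  shows "\<exists>y. conv (\<lambda>i. (p, snd (s i))) y"
proof (rule solid_imp_conv)
  note mem = conv_components[OF s]
  show "solid (\<lambda>i. (p, snd (s i)))"
    unfolding solid_def
  proof (intro conjI allI impI)
    show "(p, snd (s i)) \<in> mspace (l1_metric a (b i))" for i using p mem by simp
    fix r :: real assume "r > 0"
    then have r: "r / 2 > 0" by simp
    obtain c where c: "c > 0" "eventually (\<lambda>i. measure (\<tau> i) (mball_of (b i) (snd (s i)) (r / 2)) \<ge> c) U"
      using solid_components(2)[OF conv_imp_solid[OF s] r] by blast
    let ?c = "measure \<nu> (mball_of a p (r / 2))"
    have pos: "?c > 0" by (rule mm_space_ball_pos[OF summands(1) p r])
    have "eventually (\<lambda>i. ?c * c \<le> measure (\<nu> \<Otimes>\<^sub>M \<tau> i) (mball_of (l1_metric a (b i)) (p, snd (s i)) r)) U"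
      using c(2)
    proof eventually_elim
      case (elim i)
      have "?c * c \<le> ?c * measure (\<tau> i) (mball_of (b i) (snd (s i)) (r / 2))"
        using elim pos by simp
      also have "\<dots> = measure (\<nu> \<Otimes>\<^sub>M \<tau> i) (mball_of a p (r / 2) \<times> mball_of (b i) (snd (s i)) (r / 2))"
        by (rule measure_rectangle[OF mball_of_borel mball_of_borel, symmetric])
      also have "\<dots> \<le> measure (\<nu> \<Otimes>\<^sub>M \<tau> i) (mball_of (l1_metric a (b i)) (p, snd (s i)) r)"
        by (rule mono_pair[OF _ mball_of_borel]) auto
      finally show ?case .
    qed
    then show "\<exists>c>0. eventually (\<lambda>i. c \<le> measure (\<nu> \<Otimes>\<^sub>M \<tau> i) (mball_of (l1_metric a (b i)) (p, snd (s i)) r)) U"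
      using pos c(1) by (intro exI[of _ "?c * c"]) simp
  qed
qed

text \<open>
  The first coordinates keep mass around them in a fixed space, so they stay, up to any
  error, within a finite set of centres of balls that carry most of that mass.
\<close>

lemma fst_converges:
  assumes s: "conv s x"
  shows "\<exists>p\<in>mspace a. ((\<lambda>i. mdist a (fst (s i)) p) \<longlongrightarrow> 0) U"
proof (rule complete_filter_limit[OF _ U_nontrivial])
  interpret A: prob_space \<nu> by (rule prob_A)
  note mem = conv_components[OF s]
  show "mcomplete_of a" using summands(1) by (simp add: mm_space_def)
  show "mdist a p q \<le> mdist a (fst (s i)) p + mdist a (fst (s i)) q"
      "mdist a (fst (s i)) q \<le> mdist a (fst (s i)) p + mdist a p q"
    if "p \<in> mspace a" "q \<in> mspace a" for i p q
  proof -
    have "mdist a p q \<le> mdist a p (fst (s i)) + mdist a (fst (s i)) q" 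
      "mdist a (fst (s i)) q \<le> mdist a (fst (s i)) p + mdist a p q"
      by (intro mdist_triangle that mem(1))+
    then show "mdist a p q \<le> mdist a (fst (s i)) p + mdist a (fst (s i)) q"
      "mdist a (fst (s i)) q \<le> mdist a (fst (s i)) p + mdist a p q"
      using mdist_commute[of a p "fst (s i)"] by linarith+
  qed
  fix r :: real assume "r > 0"
  then have r: "r / 2 > 0" by simp
  obtain c where c: "c > 0" "eventually (\<lambda>i. measure \<nu> (mball_of a (fst (s i)) (r / 2)) \<ge> c) U"
    using solid_components(1)[OF conv_imp_solid[OF s] r] by blast
  obtain C where C: "finite C" "C \<subseteq> mspace a" 
    "measure \<nu> (\<Union>y\<in>C. mball_of a y (r / 2)) > 1 - c" by (rule mm_space_tight[OF summands(1) r c(1)])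
  let ?K = "\<Union>y\<in>C. mball_of a y (r / 2)"
  have K: "?K \<in> sets \<nu>" 
    unfolding mm_space_sets[OF summands(1)] by (intro sets.finite_UN[OF C(1)] mball_of_borel)
  have "eventually (\<lambda>i. \<exists>y\<in>C. mdist a (fst (s i)) y < r) U"
    using c(2)
  proof eventually_elim
    case (elim i)
    show ?case
    proof (rule ccontr)
      assume none: "\<not> ?case"
      have "q \<notin> ?K" if q: "q \<in> mball_of a (fst (s i)) (r / 2)" for q
      proof
        assume "q \<in> ?K"
        then obtain y where y: "y \<in> C" "q \<in> mball_of a y (r / 2)" by blast
        have "mdist a (fst (s i)) y \<le> mdist a (fst (s i)) q + mdist a q y"
          using q y C(2) by (intro mdist_triangle) auto
        also have "\<dots> < r" using q y by (simp add: mdist_commute)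
        finally show False using none y(1) by blast
      qed
      then have "mball_of a (fst (s i)) (r / 2) \<subseteq> space \<nu> - ?K"
        using mm_space_space[OF summands(1)] by auto
      then have "measure \<nu> (mball_of a (fst (s i)) (r / 2)) \<le> measure \<nu> (space \<nu> - ?K)"
        by (rule A.finite_measure_mono[OF _ sets.compl_sets[OF K]])
      then show False using elim C(3) A.prob_compl[OF K] by linarith
    qed
  qed
  then have "\<exists>y\<in>C. eventually (\<lambda>i. mdist a (fst (s i)) y < r) U"
    by (rule ultrafilter_finite[OF ultra C(1)])
  then obtain y where y: "y \<in> C" "eventually (\<lambda>i. mdist a (fst (s i)) y < r) U" by (rule bexE)
  show "\<exists>y\<in>mspace a. eventually (\<lambda>i. mdist a (fst (s i)) y < r) U"
    by (rule bexI[of _ y]) (rule y(2), rule subsetD[OF C(2) y(1)])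
qed

definition approx :: "'c \<Rightarrow> nat \<Rightarrow> 'a \<times> 'b" where
  "approx x = (SOME s. conv s x)"

definition proj :: "'c \<Rightarrow> 'a" where
  "proj x = (SOME p. p \<in> mspace a \<and> ((\<lambda>i. mdist a (fst (approx x i)) p) \<longlongrightarrow> 0) U)"

text \<open>
  The limit that a sequence converging to \<open>x\<close> acquires when its first coordinates are replaced by \<open>z\<close>.
\<close>

definition retr :: "'c \<Rightarrow> 'c" where
  "retr x = (SOME y. conv (\<lambda>i. (z, snd (approx x i))) y)"

lemma approx: "x \<in> mspace m \<Longrightarrow> conv (approx x) x"
  unfolding approx_def by (rule someI_ex[OF conv_exists])

lemma proj:
  assumes s: "conv s x"
  shows "proj x \<in> mspace a" "((\<lambda>i. mdist a (fst (s i)) (proj x)) \<longlongrightarrow> 0) U"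
proof -
  let ?t = "approx x"
  have t: "conv ?t x" by (rule approx[OF conv_mem(2)[OF s]])
  have *: "proj x \<in> mspace a \<and> ((\<lambda>i. mdist a (fst (?t i)) (proj x)) \<longlongrightarrow> 0) U"
    using someI_ex[OF fst_converges[OF t, unfolded Bex_def]] unfolding proj_def .
  then show px: "proj x \<in> mspace a" by simp
  have st: "((\<lambda>i. mdist (l1_metric a (b i)) (s i) (?t i)) \<longlongrightarrow> 0) U"
    using conv_dist[OF s t] conv_mem(2)[OF s] by simp
  show "((\<lambda>i. mdist a (fst (s i)) (proj x)) \<longlongrightarrow> 0) U"
  proof (rule real_tendsto_dominated)
    show "((\<lambda>i. mdist (l1_metric a (b i)) (s i) (?t i) + mdist a (fst (?t i)) (proj x)) \<longlongrightarrow> 0) U"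
      using tendsto_add[OF st conjunct2[OF *]] by simp
    fix i
    have "mdist a (fst (s i)) (proj x) \<le> mdist a (fst (s i)) (fst (?t i)) + mdist a (fst (?t i)) (proj x)"
      by (intro mdist_triangle conv_components(1)[OF s] conv_components(1)[OF t] px)
    moreover have "mdist (l1_metric a (b i)) (s i) (?t i) = 
        mdist a (fst (s i)) (fst (?t i)) + mdist (b i) (snd (s i)) (snd (?t i))"
      by (simp add: case_prod_beta)
    ultimately show "\<bar>mdist a (fst (s i)) (proj x) - 0\<bar> \<le> 
        mdist (l1_metric a (b i)) (s i) (?t i) + mdist a (fst (?t i)) (proj x)"
      using mdist_nonneg[of "b i" "snd (s i)" "snd (?t i)"] mdist_nonneg[of a "fst (s i)" "proj x"] by linarith
  qed
qed

lemma proj_eqI: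
  assumes s: "conv s x" and p: "p \<in> mspace a" "((\<lambda>i. mdist a (fst (s i)) p) \<longlongrightarrow> 0) U"
  shows "proj x = p"
proof -
  have "((\<lambda>i. mdist a (proj x) p) \<longlongrightarrow> 0) U"
  proof (rule real_tendsto_dominated)
    show "((\<lambda>i. mdist a (fst (s i)) (proj x) + mdist a (fst (s i)) p) \<longlongrightarrow> 0) U"
      using tendsto_add[OF proj(2)[OF s] p(2)] by simp
    fix i
    have "mdist a (proj x) p \<le> mdist a (proj x) (fst (s i)) + mdist a (fst (s i)) p"
      by (intro mdist_triangle conv_components(1)[OF s] proj(1)[OF s] p(1))
    then show "\<bar>mdist a (proj x) p - 0\<bar> \<le> mdist a (fst (s i)) (proj x) + mdist a (fst (s i)) p"
      using mdist_commute[of a "proj x" "fst (s i)"] mdist_nonneg[of a "proj x" p] by linarith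
  qed
  then have "mdist a (proj x) p = 0" using tendsto_unique[OF U_nontrivial tendsto_const] by metis
  then show ?thesis using proj(1)[OF s] p by simp
qed

lemma retr:
  assumes s: "conv s x" shows "conv (\<lambda>i. (z, snd (s i))) (retr x)"
proof -
  let ?t = "approx x"
  have t: "conv ?t x" by (rule approx[OF conv_mem(2)[OF s]])
  have *: "conv (\<lambda>i. (z, snd (?t i))) (retr x)"
    unfolding retr_def by (rule someI_ex[OF conv_replace[OF t z]])
  show ?thesis
  proof (rule conv_move[OF *])
    show "(z, snd (s i)) \<in> mspace (l1_metric a (b i))" for i using z conv_components(2)[OF s] by simp
    show "((\<lambda>i. mdist (l1_metric a (b i)) (z, snd (s i)) (z, snd (?t i))) \<longlongrightarrow> 0) U"
    proof (rule real_tendsto_dominated)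
      show "((\<lambda>i. mdist (l1_metric a (b i)) (s i) (?t i)) \<longlongrightarrow> 0) U"
        using conv_dist[OF s t] conv_mem(2)[OF s] by simp
      fix i
      have "mdist (l1_metric a (b i)) (z, snd (s i)) (z, snd (?t i)) = mdist (b i) (snd (s i)) (snd (?t i))"
        using z by simp
      moreover have "mdist (l1_metric a (b i)) (s i) (?t i) = 
          mdist a (fst (s i)) (fst (?t i)) + mdist (b i) (snd (s i)) (snd (?t i))"
        by (simp add: case_prod_beta)
      ultimately show "\<bar>mdist (l1_metric a (b i)) (z, snd (s i)) (z, snd (?t i)) - 0\<bar> 
          \<le> mdist (l1_metric a (b i)) (s i) (?t i)"
        using mdist_nonneg[of a "fst (s i)" "fst (?t i)"] mdist_nonneg[of "b i" "snd (s i)" "snd (?t i)"]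
        by linarith
    qed
  qed
qed

lemma retr_mem: "x \<in> mspace m \<Longrightarrow> retr x \<in> mspace m"
  by (rule conv_mem(2)[OF retr[OF approx]])

lemma proj_mem: "x \<in> mspace m \<Longrightarrow> proj x \<in> mspace a"
  by (rule proj(1)[OF approx])

lemma dist_split:
  assumes x: "x \<in> mspace m" and y: "y \<in> mspace m"
  shows "mdist m x y = mdist a (proj x) (proj y) + mdist m (retr x) (retr y)"
proof -
  let ?s = "approx x" and ?t = "approx y"
  note s = approx[OF x] and t = approx[OF y]
  note mem = conv_components[OF s] conv_components[OF t]
  have "((\<lambda>i. mdist a (fst (?s i)) (fst (?t i))) \<longlongrightarrow> mdist a (proj x) (proj y)) U"
  proof (rule real_tendsto_dominated)
    show "((\<lambda>i. mdist a (fst (?s i)) (proj x) + mdist a (fst (?t i)) (proj y)) \<longlongrightarrow> 0) U"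
      using tendsto_add[OF proj(2)[OF s] proj(2)[OF t]] by simp
    fix i
    let ?p = "fst (?s i)" and ?q = "fst (?t i)" and ?p' = "proj x" and ?q' = "proj y"
    note pts = mem(1)[of i] mem(3)[of i] proj_mem[OF x] proj_mem[OF y]
    have "mdist a ?p ?q \<le> mdist a ?p ?p' + mdist a ?p' ?q" "mdist a ?p' ?q \<le> mdist a ?p' ?q' + mdist a ?q' ?q"
      "mdist a ?p' ?q' \<le> mdist a ?p' ?p + mdist a ?p ?q'" "mdist a ?p ?q' \<le> mdist a ?p ?q + mdist a ?q ?q'"
      by (intro mdist_triangle pts)+
    then show "\<bar>mdist a ?p ?q - mdist a ?p' ?q'\<bar> \<le> mdist a ?p ?p' + mdist a ?q ?q'"
      using mdist_commute[of a ?q ?q'] mdist_commute[of a ?p ?p'] by linarith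
  qed
  moreover have "((\<lambda>i. mdist (b i) (snd (?s i)) (snd (?t i))) \<longlongrightarrow> mdist m (retr x) (retr y)) U"
    using conv_dist[OF retr[OF s] retr[OF t]] z by simp
  ultimately have "((\<lambda>i. mdist (l1_metric a (b i)) (?s i) (?t i)) \<longlongrightarrow> 
      mdist a (proj x) (proj y) + mdist m (retr x) (retr y)) U"
    by (simp add: case_prod_beta tendsto_add)
  then show ?thesis using tendsto_unique[OF U_nontrivial conv_dist[OF s t]] by simp
qed

lemma point_exists:
  assumes p: "p \<in> mspace a" and x: "x \<in> mspace m"
  shows "\<exists>y\<in>mspace m. proj y = p \<and> retr y = retr x"
proof -
  obtain y where y: "conv (\<lambda>i. (p, snd (approx x i))) y" using conv_replace[OF approx[OF x] p] by blast
  have "proj y = p" by (rule proj_eqI[OF y p]) (use p in simp)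
  moreover have "retr y = retr x"
    using retr[OF y] retr[OF approx[OF x]] conv_unique by simp
  ultimately show ?thesis using conv_mem(2)[OF y] by blast
qed

lemma retr_retraction: "short_retraction m retr"
proof -
  have "retr (retr x) = retr x" if "x \<in> mspace m" for x
    using retr[OF retr[OF approx[OF that]]] retr[OF approx[OF that]] conv_unique by simp
  moreover have "mdist m (retr x) (retr y) \<le> mdist m x y" if "x \<in> mspace m" "y \<in> mspace m" for x y
    using dist_split[OF that] mdist_nonneg[of a] by simp
  ultimately show ?thesis using retr_mem by (auto simp: short_retraction_def short_map_def)
qed

text \<open>
  On the approximating spaces the two events are independent: \<open>u\<close> is applied to the first coordinate, and the
  McShane extension of \<open>v\<close> is evaluated with first coordinate \<open>z\<close>, so that it depends on the second one only. Taking
  the minimum of the two functions turns the joint event into a superlevel set of one short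
  function, to which \<open>superlevel_limit\<close> applies. The errors in the level disappear since the
  superlevel sets increase to the one at level 0.
\<close>

lemma independence:
  assumes u: "short_fun a u" and v: "short_fun m v"
  shows "measure \<mu> {x \<in> mspace m. u (proj x) > 0 \<and> v (retr x) > 0} =
    measure \<nu> {p \<in> mspace a. u p > 0} * measure \<mu> {x \<in> mspace m. v (retr x) > 0}"
proof -
  obtain w0 where w0: "\<And>i. short_fun (l1_metric a (b i)) (w0 i)" 
    "\<And>s x. conv s x \<Longrightarrow> ((\<lambda>i. w0 i (s i)) \<longlongrightarrow> v x) U"
    using McShane_extension[OF v] by blast
  define w where "w i s = w0 i (z, snd s)" for i and s :: "'a \<times> 'b"
  define \<phi> where "\<phi> i s = min (u (fst s)) (w i s)" for i s
  define \<psi> where "\<psi> x = min (u (proj x)) (v (retr x))" for x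
  have uf: "short_fun m (\<lambda>x. u (proj x))"
    unfolding short_fun_def
  proof (intro ballI)
    fix x y assume xy: "x \<in> mspace m" "y \<in> mspace m"
    show "u (proj x) \<le> u (proj y) + mdist m x y"
      using short_fun_abs[OF u proj_mem[OF xy(1)] proj_mem[OF xy(2)]] dist_split[OF xy] 
        mdist_nonneg[of m "retr x" "retr y"] by linarith
  qed
  have vg: "short_fun m (\<lambda>x. v (retr x))"
    unfolding short_fun_def
  proof (intro ballI)
    fix x y assume xy: "x \<in> mspace m" "y \<in> mspace m"
    show "v (retr x) \<le> v (retr y) + mdist m x y"
      using short_fun_abs[OF v retr_mem[OF xy(1)] retr_mem[OF xy(2)]] dist_split[OF xy] 
        mdist_nonneg[of a "proj x" "proj y"] by linarith
  qed
  have \<psi>: "short_fun m \<psi>"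
    using uf vg unfolding short_fun_def \<psi>_def by (fastforce simp: min_def)
  have w: "short_fun (l1_metric a (b i)) (w i)" for i
    unfolding short_fun_def w_def
  proof (intro ballI)
    fix s t assume "s \<in> mspace (l1_metric a (b i))" "t \<in> mspace (l1_metric a (b i))"
    then have st: "snd s \<in> mspace (b i)" "snd t \<in> mspace (b i)" 
      "mdist (b i) (snd s) (snd t) \<le> mdist (l1_metric a (b i)) s t" by (auto simp: case_prod_beta)
    have "\<bar>w0 i (z, snd s) - w0 i (z, snd t)\<bar> \<le> mdist (l1_metric a (b i)) (z, snd s) (z, snd t)"
      by (rule short_fun_abs[OF w0(1)]) (use st z in simp_all)
    also have "\<dots> = mdist (b i) (snd s) (snd t)" using z by simp
    finally show "w0 i (z, snd s) \<le> w0 i (z, snd t) + mdist (l1_metric a (b i)) s t" using st(3) by linarith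
  qed
  have ufst: "short_fun (l1_metric a (b i)) (\<lambda>s. u (fst s))" for i
    unfolding short_fun_def
  proof (intro ballI)
    fix s t assume "s \<in> mspace (l1_metric a (b i))" "t \<in> mspace (l1_metric a (b i))"
    then have st: "fst s \<in> mspace a" "fst t \<in> mspace a" 
      "mdist a (fst s) (fst t) \<le> mdist (l1_metric a (b i)) s t" by (auto simp: case_prod_beta)
    then show "u (fst s) \<le> u (fst t) + mdist (l1_metric a (b i)) s t"
      using short_fun_abs[OF u st(1,2)] by linarith
  qed
  have \<phi>: "short_fun (l1_metric a (b i)) (\<phi> i)" for i
    using ufst[of i] w[of i] unfolding short_fun_def \<phi>_def by (fastforce simp: min_def)
  have w_lim: "((\<lambda>i. w i (s i)) \<longlongrightarrow> v (retr x)) U" if "conv s x" for s x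
    using w0(2)[OF retr[OF that]] by (simp add: w_def)
  have u_lim: "((\<lambda>i. u (fst (s i))) \<longlongrightarrow> u (proj x)) U" if s: "conv s x" for s x
  proof -
    show ?thesis
      by (rule real_tendsto_dominated[OF _ proj(2)[OF s]])
        (rule short_fun_abs[OF u conv_components(1)[OF s] proj(1)[OF s]])
  qed
  have \<phi>_lim: "((\<lambda>i. \<phi> i (s i)) \<longlongrightarrow> \<psi> x) U" if "conv s x" for s x
    unfolding \<phi>_def \<psi>_def by (intro tendsto_min u_lim w_lim that)
  define A where "A c = measure \<nu> {p \<in> mspace a. u p > c}" for c
  define G where "G c = measure \<mu> {x \<in> mspace m. v (retr x) > c}" for c
  define H where "H c = measure \<mu> {x \<in> mspace m. \<psi> x > c}" for c
  define B where "B i c = measure (\<nu> \<Otimes>\<^sub>M \<tau> i) {s \<in> mspace (l1_metric a (b i)). w i s > c}" for i c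
  interpret A: prob_space \<nu> by (rule prob_A)
  have A01: "0 \<le> A c" "A c \<le> 1" for c unfolding A_def by (simp_all add: A.prob_le_1)
  have A_lev: "{p \<in> mspace a. u p > c} \<in> sets (metric_borel a)" for c
    by (rule openin_metric_borel[OF short_fun_superlevel_open[OF u]])
  have A_mono: "A c \<le> A c'" if "c' \<le> c" for c c'
    unfolding A_def using that A_lev mm_space_sets[OF summands(1)] by (intro A.finite_measure_mono) auto
  have B0: "B i c \<ge> 0" for i c by (simp add: B_def)
  have \<phi>_lev: "measure (\<nu> \<Otimes>\<^sub>M \<tau> i) {s \<in> mspace (l1_metric a (b i)). \<phi> i s > c} = A c * B i c" for i c
  proof -
    let ?W = "{q \<in> mspace (b i). w0 i (z, q) > c}"
    have "short_fun (b i) (\<lambda>q. w0 i (z, q))"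
      using w0(1)[of i] z unfolding short_fun_def by fastforce
    then have W: "?W \<in> sets (metric_borel (b i))"
      by (intro openin_metric_borel short_fun_superlevel_open)
    have "{s \<in> mspace (l1_metric a (b i)). w i s > c} = mspace a \<times> ?W" 
      "{s \<in> mspace (l1_metric a (b i)). \<phi> i s > c} = {p \<in> mspace a. u p > c} \<times> ?W"
      by (auto simp: w_def \<phi>_def)
    then show ?thesis
      using measure_rectangle[OF mspace_borel W] measure_rectangle[OF A_lev W] measure_whole(1)
      by (simp add: A_def B_def)
  qed
  \<comment> \<open>One loss of \<open>\<eta>\<close> comes from the joint function and one from \<open>w\<close> alone.\<close>
  have up: "H c \<le> A (c - 2 * \<eta>) * G (c - 2 * \<eta>) + 2 * \<eta>" if \<eta>: "\<eta> > 0" for c \<eta>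
  proof -
    have "eventually (\<lambda>i. H c \<le> A (c - \<eta>) * B i (c - \<eta>) + \<eta>) U"
      using superlevel_limit(1)[OF \<phi> \<psi> \<phi>_lim \<eta>, of c] by (simp only: H_def \<phi>_lev)
    moreover have "eventually (\<lambda>i. B i (c - \<eta>) \<le> G (c - 2 * \<eta>) + \<eta>) U"
      using superlevel_limit(2)[OF w vg w_lim \<eta>, of "c - \<eta>"] by (simp add: B_def G_def algebra_simps)
    ultimately have "eventually (\<lambda>i. H c \<le> A (c - 2 * \<eta>) * G (c - 2 * \<eta>) + 2 * \<eta>) U"
    proof eventually_elim
      case (elim i)
      have "A (c - \<eta>) * B i (c - \<eta>) \<le> A (c - 2 * \<eta>) * (G (c - 2 * \<eta>) + \<eta>)"
        using \<eta> elim A01 B0 by (intro mult_mono A_mono) auto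
      also have "\<dots> \<le> A (c - 2 * \<eta>) * G (c - 2 * \<eta>) + \<eta>"
        using A01(2)[of "c - 2 * \<eta>"] \<eta> by (simp add: distrib_left)
      finally show ?case using elim(1) by linarith
    qed
    then show ?thesis by (simp add: eventually_U_const)
  qed
  have down: "A c * G c \<le> H (c - 2 * \<eta>) + 2 * \<eta>" if \<eta>: "\<eta> > 0" for c \<eta>
  proof -
    have "eventually (\<lambda>i. A (c - \<eta>) * B i (c - \<eta>) \<le> H (c - 2 * \<eta>) + \<eta>) U"
      using superlevel_limit(2)[OF \<phi> \<psi> \<phi>_lim \<eta>, of "c - \<eta>"] 
      by (simp only: H_def \<phi>_lev diff_diff_eq mult_2)
    moreover have "eventually (\<lambda>i. G c \<le> B i (c - \<eta>) + \<eta>) U"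
      using superlevel_limit(1)[OF w vg w_lim \<eta>, of c] by (simp add: B_def G_def)
    ultimately have "eventually (\<lambda>i. A c * G c \<le> H (c - 2 * \<eta>) + 2 * \<eta>) U"
    proof eventually_elim
      case (elim i)
      have "A c * G c \<le> A c * (B i (c - \<eta>) + \<eta>)" using elim(2) A01 by (intro mult_left_mono) auto
      also have "\<dots> \<le> A c * B i (c - \<eta>) + \<eta>" using A01(2)[of c] \<eta> by (simp add: distrib_left)
      also have "A c * B i (c - \<eta>) \<le> A (c - \<eta>) * B i (c - \<eta>)" 
        using \<eta> B0 by (intro mult_right_mono A_mono) auto
      finally show ?case using elim(1) by linarith
    qed
    then show ?thesis by (simp add: eventually_U_const)
  qed
  have lim: "(\<lambda>n. H (2 / real (Suc n))) \<longlonglongrightarrow> H 0" 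
    "(\<lambda>n. A (2 / real (Suc n)) * G (2 / real (Suc n))) \<longlonglongrightarrow> A 0 * G 0"
    unfolding H_def A_def G_def
    by (intro tendsto_mult superlevel_tendsto limit_space summands \<psi> u vg)+
  have lim0: "(\<lambda>n. 2 / real (Suc n)) \<longlonglongrightarrow> 0"
    using tendsto_mult_right_zero[OF LIMSEQ_inverse_real_of_nat, of 2] by (simp add: divide_inverse)
  have "H 0 \<le> A 0 * G 0 + 0"
  proof (rule LIMSEQ_le[OF lim(1) tendsto_add[OF tendsto_const lim0]])
    show "\<exists>N. \<forall>n\<ge>N. H (2 / real (Suc n)) \<le> A 0 * G 0 + 2 / real (Suc n)"
    proof (intro exI allI impI)
      fix n show "H (2 / real (Suc n)) \<le> A 0 * G 0 + 2 / real (Suc n)"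
        using up[of "1 / real (Suc n)" "2 / real (Suc n)"] by simp
    qed
  qed
  moreover have "A 0 * G 0 \<le> H 0 + 0"
  proof (rule LIMSEQ_le[OF lim(2) tendsto_add[OF tendsto_const lim0]])
    show "\<exists>N. \<forall>n\<ge>N. A (2 / real (Suc n)) * G (2 / real (Suc n)) \<le> H 0 + 2 / real (Suc n)"
    proof (intro exI allI impI)
      fix n show "A (2 / real (Suc n)) * G (2 / real (Suc n)) \<le> H 0 + 2 / real (Suc n)"
        using down[of "1 / real (Suc n)" "2 / real (Suc n)"] by simp
    qed
  qed
  ultimately show ?thesis by (simp add: H_def A_def G_def \<psi>_def)
qed

end

proposition (in mm_sum_limit) limit_decomposition:
  "mm_iso (m, \<mu>) (mm_sum (a, \<nu>) (mm_retract (m, \<mu>) retr))"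
  unfolding mm_retract_def prod.case
proof (rule mm_sum_criterion[where f = proj and g = retr])
  let ?s = "submetric m (retr ` mspace m)"
  note im = short_retraction_image[OF retr_retraction]
  have ms: "mspace ?s = retr ` mspace m" using im(1) by auto
  show "mm_space (m, \<mu>)" "mm_space (a, \<nu>)" by (rule limit_space, rule summands(1))
  show "mm_space (?s, distr \<mu> (metric_borel ?s) retr)"
    using mm_space_retract(1)[OF limit_space retr_retraction] by (simp add: mm_retract_def)
  show "proj \<in> mspace m \<rightarrow> mspace a" using proj_mem by blast
  show "retr \<in> mspace m \<rightarrow> mspace ?s" unfolding ms by blast
  show "mdist m x y = mdist a (proj x) (proj y) + mdist ?s (retr x) (retr y)" 
    if "x \<in> mspace m" "y \<in> mspace m" for x y
    using dist_split[OF that] by simp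
  show "\<exists>x\<in>mspace m. proj x = p \<and> retr x = q" if pq: "p \<in> mspace a" "q \<in> mspace ?s" for p q
  proof -
    obtain x where "x \<in> mspace m" "q = retr x" using pq(2) unfolding ms by blast
    then show ?thesis using point_exists[OF pq(1)] by blast
  qed
  fix V W assume V: "openin (mtopology_of a) V" and W: "openin (mtopology_of ?s) W"
  obtain W' where W': "openin (mtopology_of m) W'" "W = W' \<inter> retr ` mspace m"
    using W unfolding mtopology_of_submetric openin_subtopology by blast
  obtain u where u: "short_fun a u" "{p \<in> mspace a. u p > 0} = V" by (rule open_superlevel[OF V])
  obtain v where v: "short_fun m v" "{x \<in> mspace m. v x > 0} = W'" by (rule open_superlevel[OF W'(1)])
  have VW: "proj x \<in> V \<longleftrightarrow> u (proj x) > 0" "retr x \<in> W \<longleftrightarrow> v (retr x) > 0" if "x \<in> mspace m" for x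
    using u(2) v(2) W'(2) proj_mem[OF that] retr_mem[OF that] that by auto
  have "measure (distr \<mu> (metric_borel ?s) retr) W = measure \<mu> {x \<in> mspace m. retr x \<in> W}"
    using measure_distr[OF short_map_measurable[OF limit_space mm_space_retract(2)[OF limit_space retr_retraction]]
        openin_metric_borel[OF W]] mm_space_space[OF limit_space]
    by (simp add: vimage_def Int_def conj_commute)
  moreover have "{x \<in> mspace m. retr x \<in> W} = {x \<in> mspace m. v (retr x) > 0}"
    "{x \<in> mspace m. proj x \<in> V \<and> retr x \<in> W} = {x \<in> mspace m. u (proj x) > 0 \<and> v (retr x) > 0}"
    using VW by auto
  ultimately show "measure \<mu> {x \<in> mspace m. proj x \<in> V \<and> retr x \<in> W} = 
      measure \<nu> V * measure (distr \<mu> (metric_borel ?s) retr) W"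
    using independence[OF u(1) v(1)] u(2) by simp
qed

section \<open>Summands of limits\<close>

text \<open>
  Both the Gromov--Prohorov and the Prohorov distance are infima of nonempty sets of
  numbers; for the former the $\ell_1$ sum of the two spaces provides a common ambient space.
\<close>

lemma gpr_triple_bridge:
  fixes m :: "'a metric" and m' :: "'b metric"
  assumes A: "mm_space (m, \<mu>)" and B: "mm_space (m', \<mu>')" and r: "gpr_triple (m, \<mu>) (m', \<mu>') < r"
  shows "\<exists>d e. 0 < e \<and> e < r \<and> bridge m \<mu> m' \<mu>' d e"
proof -
  interpret P: prob_space \<mu> by (rule mm_space_prob[OF A])
  interpret P': prob_space \<mu>' by (rule mm_space_prob[OF B])
  let ?G = "{prohorov_dist z (distr \<mu> (metric_borel z) \<phi>) (distr \<mu>' (metric_borel z) \<psi>) 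
       | (z :: (nat \<Rightarrow> real) metric) \<phi> \<psi>. isometric_embedding m z \<phi> \<and> isometric_embedding m' z \<psi>}"
  obtain x0 where x0: "x0 \<in> mspace m" using P.not_empty mm_space_space[OF A] by auto
  obtain y0 where y0: "y0 \<in> mspace m'" using P'.not_empty mm_space_space[OF B] by auto
  have "isometric_embedding m (l1_metric m m') (\<lambda>x. (x, y0))" 
    "isometric_embedding m' (l1_metric m m') (\<lambda>y. (x0, y))"
    using x0 y0 by (auto simp: isometric_embedding_def)
  then obtain z0 :: "(nat \<Rightarrow> real) metric" and \<phi>0 \<psi>0 where
    z0: "isometric_embedding m z0 \<phi>0" "isometric_embedding m' z0 \<psi>0"
    using prohorov_ambient[OF A B] by metis
  have "prohorov_dist z0 (distr \<mu> (metric_borel z0) \<phi>0) (distr \<mu>' (metric_borel z0) \<psi>0) \<in> ?G"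
    unfolding mem_Collect_eq using z0 by (intro exI[of _ z0] exI[of _ \<phi>0] exI[of _ \<psi>0]) simp
  then have "?G \<noteq> {}" by (metis equals0D)
  moreover have "Inf ?G < r" using r by (simp add: gpr_triple_def)
  ultimately obtain g where "g \<in> ?G" "g < r" using cInf_lessD[of ?G r] by (auto simp only:)
  then obtain z :: "(nat \<Rightarrow> real) metric" and \<phi> \<psi> where 
    emb: "isometric_embedding m z \<phi>" "isometric_embedding m' z \<psi>"
    and less: "prohorov_dist z (distr \<mu> (metric_borel z) \<phi>) (distr \<mu>' (metric_borel z) \<psi>) < r"
    by blast
  let ?\<mu> = "distr \<mu> (metric_borel z) \<phi>" and ?\<mu>' = "distr \<mu>' (metric_borel z) \<psi>"
  note meas = mm_space_measurable[OF A emb(1)] mm_space_measurable[OF B emb(2)]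
  interpret D: prob_space ?\<mu> by (rule P.prob_space_distr[OF meas(1)])
  interpret D': prob_space ?\<mu>' by (rule P'.prob_space_distr[OF meas(2)])
  let ?E = "{e. e > 0 \<and> (\<forall>A\<in>sets (metric_borel z). measure ?\<mu> A \<le> measure ?\<mu>' (thickening z e A) + e \<and>
     measure ?\<mu>' A \<le> measure ?\<mu> (thickening z e A) + e)}"
  have "1 \<in> ?E" 
    using D.prob_le_1 D'.prob_le_1 by (auto intro: add_increasing)
  then have "?E \<noteq> {}" by blast
  moreover have "Inf ?E < r" using less by (simp add: prohorov_dist_def)
  ultimately obtain e where e: "e \<in> ?E" "e < r" using cInf_lessD[of ?E r] by (auto simp only:)
  let ?d = "\<lambda>x y. mdist z (\<phi> x) (\<psi> y)"
  have mem: "\<phi> x \<in> mspace z" "\<psi> y \<in> mspace z" if "x \<in> mspace m" "y \<in> mspace m'" for x y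
    using emb that by (auto simp: isometric_embedding_def)
  have eq: "mdist m x y = mdist z (\<phi> x) (\<phi> y)" if "x \<in> mspace m" "y \<in> mspace m" for x y
    using emb that by (auto simp: isometric_embedding_def)
  have eq': "mdist m' x y = mdist z (\<psi> x) (\<psi> y)" if "x \<in> mspace m'" "y \<in> mspace m'" for x y
    using emb that by (auto simp: isometric_embedding_def)
  \<comment> \<open>Stated for two arbitrary spaces since it is used in both directions.\<close>
  have transfer: "measure \<kappa> E \<le> measure \<kappa>' F + e"
    if X: "mm_space (n, \<kappa>)" and Y: "mm_space (n', \<kappa>')" and f: "isometric_embedding n z f" 
      and g: "isometric_embedding n' z g" and E: "E \<in> sets (metric_borel n)" and F: "F \<in> sets (metric_borel n')"
      and imp: "\<And>x y. x \<in> E \<Longrightarrow> y \<in> mspace n' \<Longrightarrow> mdist z (f x) (g y) < e \<Longrightarrow> y \<in> F"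
      and pr: "\<And>A. A \<in> sets (metric_borel z) \<Longrightarrow> 
        measure (distr \<kappa> (metric_borel z) f) A \<le> measure (distr \<kappa>' (metric_borel z) g) (thickening z e A) + e"
    for n :: "'k metric" and \<kappa> f and n' :: "'l metric" and \<kappa>' g E F
  proof -
    interpret K': prob_space \<kappa>' by (rule mm_space_prob[OF Y])
    have sub: "E \<subseteq> mspace n" using sets.sets_into_space[OF E] by simp
    have fE: "f ` E \<in> sets (metric_borel z)"
      by (rule embedding_image_borel[OF f embedding_image_closed[OF X f] E])
    have "f -` (f ` E) \<inter> space \<kappa> = E"
      using isometric_embedding_inj_on[OF f] sub mm_space_space[OF X] by (auto dest: inj_onD)
    then have "measure \<kappa> E = measure (distr \<kappa> (metric_borel z) f) (f ` E)"
      using measure_distr[OF mm_space_measurable[OF X f] fE] by simp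
    also have "\<dots> \<le> measure (distr \<kappa>' (metric_borel z) g) (thickening z e (f ` E)) + e"
      by (rule pr[OF fE])
    also have "measure (distr \<kappa>' (metric_borel z) g) (thickening z e (f ` E)) = 
        measure \<kappa>' (g -` thickening z e (f ` E) \<inter> space \<kappa>')"
      by (rule measure_distr[OF mm_space_measurable[OF Y g] openin_metric_borel[OF openin_thickening]])
    also have "\<dots> \<le> measure \<kappa>' F"
    proof (rule K'.finite_measure_mono)
      show "F \<in> sets \<kappa>'" using F mm_space_sets[OF Y] by simp
      show "g -` thickening z e (f ` E) \<inter> space \<kappa>' \<subseteq> F"
      proof
        fix y assume y: "y \<in> g -` thickening z e (f ` E) \<inter> space \<kappa>'"
        then obtain x where x: "x \<in> E" "g y \<in> mball_of z (f x) e" unfolding thickening_def by blast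
        then have "mdist z (f x) (g y) < e" by simp
        then show "y \<in> F" using imp[OF x(1)] y mm_space_space[OF Y] by blast
      qed
    qed
    finally show ?thesis by simp
  qed
  have "bridge m \<mu> m' \<mu>' ?d e"
    unfolding bridge_def
  proof (intro conjI ballI impI)
    fix s t x assume p: "s \<in> mspace m" "t \<in> mspace m" "x \<in> mspace m'"
    show "?d s x \<le> mdist m s t + ?d t x" "mdist m s t \<le> ?d s x + ?d t x"
      using mdist_triangle[OF mem(1)[OF p(1,3)] mem(1)[OF p(2,3)] mem(2)[OF p(1,3)]]
        mdist_triangle[OF mem(1)[OF p(1,3)] mem(2)[OF p(1,3)] mem(1)[OF p(2,3)]]
        eq[OF p(1,2)] mdist_commute[of z "\<psi> x" "\<phi> t"] by linarith+
  next
    fix s x y assume p: "s \<in> mspace m" "x \<in> mspace m'" "y \<in> mspace m'"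
    show "?d s x \<le> ?d s y + mdist m' y x" "mdist m' x y \<le> ?d s x + ?d s y"
      using mdist_triangle[OF mem(1)[OF p(1,2)] mem(2)[OF p(1,3)] mem(2)[OF p(1,2)]]
        mdist_triangle[OF mem(2)[OF p(1,2)] mem(1)[OF p(1,2)] mem(2)[OF p(1,3)]]
        eq'[OF p(2,3)] mdist_commute[of z "\<psi> x" "\<phi> s"] mdist_commute[of z "\<psi> x" "\<psi> y"] eq'[OF p(3,2)] 
      by linarith+
  next
    fix E F assume EF: "E \<in> sets (metric_borel m)" "F \<in> sets (metric_borel m')"
      and "\<forall>s\<in>E. \<forall>x\<in>mspace m'. ?d s x < e \<longrightarrow> x \<in> F"
    then show "measure \<mu> E \<le> measure \<mu>' F + e"
      using e(1) by (intro transfer[OF A B emb EF]) blast+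
  next
    fix E F assume EF: "E \<in> sets (metric_borel m)" "F \<in> sets (metric_borel m')"
      and "\<forall>x\<in>F. \<forall>s\<in>mspace m. ?d s x < e \<longrightarrow> s \<in> E"
    then have "\<And>x s. x \<in> F \<Longrightarrow> s \<in> mspace m \<Longrightarrow> mdist z (\<psi> x) (\<phi> s) < e \<Longrightarrow> s \<in> E"
      by (metis mdist_commute)
    then show "measure \<mu>' F \<le> measure \<mu> E + e"
      using e(1) by (intro transfer[OF B A emb(2,1) EF(2,1)]) blast+
  qed
  then show ?thesis using e by blast
qed

lemma tendsto_bridges:
  assumes S: "\<And>n. mm_class_of (M n, \<kappa> n) = S n" "\<And>n. mm_space (M n, \<kappa> n)" 
    and L: "mm_class_of (m, \<mu>) = L" "mm_space (m, \<mu>)" and lim: "mm_tendsto S L"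
  obtains d e where "\<And>n. bridge (M n) (\<kappa> n) m \<mu> (d n) (e n)" "\<And>n. e n > (0::real)" "e \<longlonglongrightarrow> 0"
proof -
  let ?g = "\<lambda>n. gromov_prohorov (S n) L"
  have "gpr_triple (M n, \<kappa> n) (m, \<mu>) < ?g n + inverse (real (Suc n))" for n
    using gromov_prohorov_class_of[OF S(2) L(2), of n] S(1)[of n] L(1) by simp
  then have "\<forall>n. \<exists>d e. 0 < e \<and> e < ?g n + inverse (real (Suc n)) \<and> bridge (M n) (\<kappa> n) m \<mu> d e"
    using gpr_triple_bridge[OF S(2) L(2)] by blast
  then obtain d e where e: "\<And>n. 0 < e n" "\<And>n. e n < ?g n + inverse (real (Suc n))"
    "\<And>n. bridge (M n) (\<kappa> n) m \<mu> (d n) (e n)" by metis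
  \<comment> \<open>The infimum need not be attained; hence the term \<open>1 / (n + 1)\<close>.\<close>
  have bound: "(\<lambda>n. ?g n + inverse (real (Suc n))) \<longlonglongrightarrow> 0"
    using tendsto_add[OF lim[unfolded mm_tendsto_def] LIMSEQ_inverse_real_of_nat] by simp
  have "e \<longlonglongrightarrow> 0"
  proof (rule tendsto_sandwich[OF _ _ tendsto_const bound])
    show "eventually (\<lambda>n. 0 \<le> e n) sequentially" using e(1) by (simp add: less_imp_le)
    show "eventually (\<lambda>n. e n \<le> ?g n + inverse (real (Suc n))) sequentially" 
      using e(2) by (simp add: less_imp_le)
  qed
  with e show ?thesis by (intro that)
qed

text \<open>
  The complements of \<open>A\<close> in the spaces \<open>S n\<close> are not known to converge. Their limit is found inside \<open>L\<close>, as
  the fibre over a base point of \<open>A\<close>.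
\<close>

proposition summand_of_limit:
  assumes lim: "mm_tendsto S L" and le: "\<And>n. A \<preceq> S n"
  shows "A \<preceq> L"
proof -
  obtain T where T: "\<And>n. S n = A + T n" using le unfolding mm_le_def by metis
  obtain a \<nu> where a: "rep_mm_class A = (a, \<nu>)" by fastforce
  have "\<forall>n. \<exists>b \<tau>. rep_mm_class (T n) = (b, \<tau>)" by simp
  then obtain b \<tau> where b: "\<And>n. rep_mm_class (T n) = (b n, \<tau> n)" by metis
  obtain m \<mu> where m: "rep_mm_class L = (m, \<mu>)" by fastforce
  have A: "mm_space (a, \<nu>)" "mm_class_of (a, \<nu>) = A" using mm_space_rep[of A] mm_class_of_rep[of A] a by simp_all
  have B: "mm_space (b n, \<tau> n)" "mm_class_of (b n, \<tau> n) = T n" for n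
    using mm_space_rep[of "T n"] mm_class_of_rep[of "T n"] b by simp_all
  have M: "mm_space (m, \<mu>)" "mm_class_of (m, \<mu>) = L" using mm_space_rep[of L] mm_class_of_rep[of L] m by simp_all
  have AB: "mm_space (l1_metric a (b n), \<nu> \<Otimes>\<^sub>M \<tau> n)" "mm_class_of (l1_metric a (b n), \<nu> \<Otimes>\<^sub>M \<tau> n) = S n" for n
    using mm_sum_space[OF A(1) B(1)] mm_class_of_sum[OF A(1) B(1)] A(2) B(2) T by (simp_all add: mm_sum_def)
  obtain d e where de: "\<And>n. bridge (l1_metric a (b n)) (\<nu> \<Otimes>\<^sub>M \<tau> n) m \<mu> (d n) (e n)" 
    "\<And>n. e n > (0::real)" "e \<longlonglongrightarrow> 0"
    using tendsto_bridges[OF AB(2,1) M(2,1) lim] by blast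
  obtain U :: "nat filter" where U: "ultrafilter U" "U \<le> sequentially"
    using ultrafilter_exists[OF sequentially_bot] by blast
  obtain z where z: "z \<in> mspace a"
    using prob_space.not_empty[OF mm_space_prob[OF A(1)]] mm_space_space[OF A(1)] by auto
  interpret mm_sum_limit U a \<nu> b \<tau> m \<mu> d e z
    by unfold_locales (use U AB M A B de z tendsto_mono[OF U(2) de(3)] in auto)
  have R: "mm_space (mm_retract (m, \<mu>) retr)" by (rule mm_space_retract(1)[OF M(1) retr_retraction])
  have "mm_class_of (m, \<mu>) = mm_class_of (mm_sum (a, \<nu>) (mm_retract (m, \<mu>) retr))"
    using mm_class_of_eq_iff[OF M(1) mm_sum_space[OF A(1) R]] limit_decomposition by simp
  then have "L = A + mm_class_of (mm_retract (m, \<mu>) retr)"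
    using mm_class_of_sum[OF A(1) R] A M by simp
  then show ?thesis by (auto simp: mm_le_def)
qed

section \<open>The concentration function\<close>

text \<open>
  This is Levy's concentration function, with sets of diameter at most \<open>r\<close> in place of balls, because
  diameters, unlike centres, survive almost unchanged when a set is moved to another space.
\<close>

definition concentration :: "'a mm_triple \<Rightarrow> real \<Rightarrow> real" where
  "concentration = (\<lambda>(m, \<mu>) r. 
     Sup {measure \<mu> E | E. E \<in> sets (metric_borel m) \<and> (\<forall>x\<in>E. \<forall>y\<in>E. mdist m x y \<le> r)})"

lemma concentration_upper:
  assumes "mm_space (m, \<mu>)" "E \<in> sets (metric_borel m)" "\<And>x y. x \<in> E \<Longrightarrow> y \<in> E \<Longrightarrow> mdist m x y \<le> r"
  shows "measure \<mu> E \<le> concentration (m, \<mu>) r"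
proof -
  interpret prob_space \<mu> by (rule mm_space_prob[OF assms(1)])
  show ?thesis unfolding concentration_def prod.case
    using assms(2,3) by (intro cSup_upper bdd_aboveI[of _ 1]) auto
qed

lemma concentration_least:
  assumes "\<And>E. E \<in> sets (metric_borel m) \<Longrightarrow> (\<And>x y. x \<in> E \<Longrightarrow> y \<in> E \<Longrightarrow> mdist m x y \<le> r) \<Longrightarrow> measure \<mu> E \<le> c"
  shows "concentration (m, \<mu>) r \<le> c"
  unfolding concentration_def prod.case
proof (rule cSup_least)
  have "measure \<mu> {} \<in> {measure \<mu> E | E. E \<in> sets (metric_borel m) \<and> (\<forall>x\<in>E. \<forall>y\<in>E. mdist m x y \<le> r)}"
    by blast
  then show "{measure \<mu> E | E. E \<in> sets (metric_borel m) \<and> (\<forall>x\<in>E. \<forall>y\<in>E. mdist m x y \<le> r)} \<noteq> {}" by (metis equals0D)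
qed (use assms in auto)

lemma concentration_bounds:
  assumes "mm_space A" shows "0 \<le> concentration A r" "concentration A r \<le> 1"
proof -
  obtain m \<mu> where A: "A = (m, \<mu>)" by fastforce
  interpret prob_space \<mu> using assms mm_space_prob by (simp add: A)
  show "0 \<le> concentration A r" using concentration_upper[of m \<mu> "{}" r] assms by (simp add: A)
  show "concentration A r \<le> 1" unfolding A by (rule concentration_least) (rule prob_le_1)
qed

lemma concentration_mono:
  assumes "mm_space A" "r \<le> r'" shows "concentration A r \<le> concentration A r'"
proof -
  obtain m \<mu> where A: "A = (m, \<mu>)" by fastforce
  show ?thesis unfolding A
    using assms A by (intro concentration_least concentration_upper) (auto intro: order_trans)
qed

lemma concentration_pos:
  assumes "mm_space A" "r > 0" shows "concentration A r > 0"
proof -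
  obtain m \<mu> where A: "A = (m, \<mu>)" by fastforce
  have X: "mm_space (m, \<mu>)" using assms A by simp
  obtain x where x: "x \<in> mspace m" using prob_space.not_empty[OF mm_space_prob[OF X]] mm_space_space[OF X] by auto
  have "0 < measure \<mu> (mball_of m x (r / 2))" using mm_space_ball_pos[OF X x] assms(2) by simp
  also have "\<dots> \<le> concentration (m, \<mu>) r"
  proof (rule concentration_upper[OF X mball_of_borel])
    fix y z assume "y \<in> mball_of m x (r / 2)" "z \<in> mball_of m x (r / 2)"
    then show "mdist m y z \<le> r" 
      using mdist_triangle[of y m x z] mdist_commute[of m x y] x by simp
  qed
  finally show ?thesis by (simp add: A)
qed

lemma concentration_iso_le:
  assumes "mm_space A" "mm_space B" "mm_iso A B" shows "concentration B r \<le> concentration A r"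
proof -
  obtain m \<mu> where A: "A = (m, \<mu>)" by fastforce
  obtain m' \<mu>' where B: "B = (m', \<mu>')" by fastforce
  have X: "mm_space (m, \<mu>)" using assms A by simp
  obtain f where f: "isometric_embedding m m' f" "distr \<mu> (metric_borel m') f = \<mu>'"
    using assms(3) by (auto simp: A B mm_iso_def)
  show ?thesis unfolding A B
  proof (rule concentration_least)
    fix E assume E: "E \<in> sets (metric_borel m')" "\<And>x y. x \<in> E \<Longrightarrow> y \<in> E \<Longrightarrow> mdist m' x y \<le> r"
    have "measure \<mu>' E = measure \<mu> (f -` E \<inter> mspace m)"
      using measure_distr[OF mm_space_measurable[OF X f(1)] E(1)] f(2) mm_space_space[OF X] by simp
    also have "\<dots> \<le> concentration (m, \<mu>) r"
    proof (rule concentration_upper[OF X])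
      show "f -` E \<inter> mspace m \<in> sets (metric_borel m)"
        using measurable_sets[OF isometric_embedding_measurable[OF f(1)] E(1)] by simp
      fix x y assume "x \<in> f -` E \<inter> mspace m" "y \<in> f -` E \<inter> mspace m"
      then show "mdist m x y \<le> r" using E(2)[of "f x" "f y"] f(1) by (auto simp: isometric_embedding_def)
    qed
    finally show "measure \<mu>' E \<le> concentration (m, \<mu>) r" .
  qed
qed

lemma closure_diameter:
  assumes E: "\<And>x y. x \<in> E \<Longrightarrow> y \<in> E \<Longrightarrow> mdist m x y \<le> r"
    and xy: "x \<in> mtopology_of m closure_of E" "y \<in> mtopology_of m closure_of E"
  shows "mdist m x y \<le> r"
proof (rule field_le_epsilon)
  interpret M: Metric_space "mspace m" "mdist m" by simp
  fix t :: real assume "t > 0"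
  then have "t / 2 > 0" by simp
  then obtain x' y' where 1: "x' \<in> E" "x' \<in> M.mball x (t / 2)" "y' \<in> E" "y' \<in> M.mball y (t / 2)"
    using xy[unfolded mtopology_of_def M.metric_closure_of, THEN CollectD, THEN conjunct2, rule_format]
    by metis
  have "mdist m x y \<le> mdist m x x' + mdist m x' y" "mdist m x' y \<le> mdist m x' y' + mdist m y' y"
    using 1 by (simp_all add: mdist_triangle)
  moreover have "mdist m x x' < t / 2" "mdist m y y' < t / 2" using 1 by simp_all
  ultimately show "mdist m x y \<le> r + t" 
    using E[OF 1(1,3)] mdist_commute[of m y' y] by linarith
qed

text \<open>
  A set is contained in the product of its two projections, whose diameters are not larger. The closures of the
  projections are taken because projections of Borel sets need not be Borel.
\<close>

lemma concentration_sum_le: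
  assumes "mm_space A" "mm_space B"
  shows "concentration (mm_sum A B) r \<le> concentration A r * concentration B r"
proof -
  obtain m \<mu> where A: "A = (m, \<mu>)" by fastforce
  obtain n \<nu> where B: "B = (n, \<nu>)" by fastforce
  have X: "mm_space (m, \<mu>)" and Y: "mm_space (n, \<nu>)" using assms A B by simp_all
  have XY: "mm_space (l1_metric m n, \<mu> \<Otimes>\<^sub>M \<nu>)" using mm_sum_space[OF X Y] by (simp add: mm_sum_def)
  interpret Q: prob_space \<nu> by (rule mm_space_prob[OF Y])
  interpret PQ: prob_space "\<mu> \<Otimes>\<^sub>M \<nu>" by (rule mm_space_prob[OF XY])
  have "concentration (l1_metric m n, \<mu> \<Otimes>\<^sub>M \<nu>) r \<le> concentration (m, \<mu>) r * concentration (n, \<nu>) r"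
  proof (rule concentration_least)
    fix E assume E: "E \<in> sets (metric_borel (l1_metric m n))" 
      "\<And>x y. x \<in> E \<Longrightarrow> y \<in> E \<Longrightarrow> mdist (l1_metric m n) x y \<le> r"
    have sub: "E \<subseteq> mspace m \<times> mspace n" using sets.sets_into_space[OF E(1)] by simp
    let ?V = "mtopology_of m closure_of (fst ` E)" and ?W = "mtopology_of n closure_of (snd ` E)"
    have V: "?V \<in> sets (metric_borel m)" and W: "?W \<in> sets (metric_borel n)"
      by (intro closedin_metric_borel closedin_closure_of)+
    have le: "mdist m (fst x) (fst y) \<le> r" "mdist n (snd x) (snd y) \<le> r" if "x \<in> E" "y \<in> E" for x y
    proof -
      have "mdist m (fst x) (fst y) + mdist n (snd x) (snd y) \<le> r"
        using E(2)[OF that] by (simp add: case_prod_beta)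
      then show "mdist m (fst x) (fst y) \<le> r" "mdist n (snd x) (snd y) \<le> r"
        using mdist_nonneg[of m "fst x" "fst y"] mdist_nonneg[of n "snd x" "snd y"] by linarith+
    qed
    have V_diam: "mdist m p q \<le> r" if "p \<in> ?V" "q \<in> ?V" for p q
      by (rule closure_diameter[OF _ that]) (elim imageE, simp only: le)
    have W_diam: "mdist n p q \<le> r" if "p \<in> ?W" "q \<in> ?W" for p q
      by (rule closure_diameter[OF _ that]) (elim imageE, simp only: le)
    have "fst ` E \<subseteq> ?V" "snd ` E \<subseteq> ?W"
      using sub by (auto intro!: closure_of_subset)
    then have "E \<subseteq> ?V \<times> ?W" by force
    then have "measure (\<mu> \<Otimes>\<^sub>M \<nu>) E \<le> measure (\<mu> \<Otimes>\<^sub>M \<nu>) (?V \<times> ?W)"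
      using V W mm_space_sets[OF X] mm_space_sets[OF Y] by (intro PQ.finite_measure_mono) auto
    also have "\<dots> = measure \<mu> ?V * measure \<nu> ?W"
      using Q.emeasure_pair_measure_Times[of ?V \<mu> ?W] V W mm_space_sets[OF X] mm_space_sets[OF Y]
      by (simp add: measure_def enn2real_mult)
    also have "\<dots> \<le> concentration (m, \<mu>) r * concentration (n, \<nu>) r"
    proof (rule mult_mono)
      show "measure \<mu> ?V \<le> concentration (m, \<mu>) r"
        by (rule concentration_upper[OF X V V_diam])
      show "measure \<nu> ?W \<le> concentration (n, \<nu>) r"
        by (rule concentration_upper[OF Y W W_diam])
    qed (simp_all add: concentration_bounds[OF X])
    finally show "measure (\<mu> \<Otimes>\<^sub>M \<nu>) E \<le> concentration (m, \<mu>) r * concentration (n, \<nu>) r" .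
  qed
  then show ?thesis by (simp add: A B mm_sum_def)
qed

lemma concentration_bridge:
  assumes X: "mm_space (m, \<mu>)" and Y: "mm_space (m', \<mu>')" and br: "bridge m \<mu> m' \<mu>' d e"
  shows "concentration (m, \<mu>) r \<le> concentration (m', \<mu>') (r + 2 * e) + e"
proof (rule concentration_least)
  interpret M': Metric_space "mspace m'" "mdist m'" by simp
  note b1 = br[unfolded bridge_def, THEN conjunct1] 
    and b2 = br[unfolded bridge_def, THEN conjunct2, THEN conjunct1]
    and b3 = br[unfolded bridge_def, THEN conjunct2, THEN conjunct2, THEN conjunct1]
  fix E assume E: "E \<in> sets (metric_borel m)" "\<And>x y. x \<in> E \<Longrightarrow> y \<in> E \<Longrightarrow> mdist m x y \<le> r"
  have sub: "E \<subseteq> mspace m" using sets.sets_into_space[OF E(1)] by simp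
  let ?F = "{x \<in> mspace m'. \<exists>s\<in>E. d s x < e}"
  have "openin M'.mtopology ?F"
    unfolding M'.openin_mtopology
  proof (intro conjI allI impI)
    fix x assume "x \<in> ?F"
    then obtain s where s: "s \<in> E" "d s x < e" "x \<in> mspace m'" by blast
    have "M'.mball x (e - d s x) \<subseteq> ?F"
    proof
      fix y assume y: "y \<in> M'.mball x (e - d s x)"
      then have ym: "y \<in> mspace m'" by simp
      have "d s y \<le> d s x + mdist m' x y" using b2 s ym sub by blast
      moreover have "mdist m' x y < e - d s x" using y by simp
      ultimately have "d s y < e" by linarith
      then show "y \<in> ?F" using ym s(1) by blast
    qed
    then show "\<exists>r>0. M'.mball x r \<subseteq> ?F" using s(2) by (intro exI[of _ "e - d s x"]) simp
  qed blast
  then have F: "?F \<in> sets (metric_borel m')" by (intro openin_metric_borel) (simp add: mtopology_of_def)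
  have "measure \<mu> E \<le> measure \<mu>' ?F + e" by (rule b3[rule_format, OF E(1) F]) blast
  also have "measure \<mu>' ?F \<le> concentration (m', \<mu>') (r + 2 * e)"
  proof (rule concentration_upper[OF Y F])
    fix x y assume "x \<in> ?F" "y \<in> ?F"
    then obtain s t where st: "s \<in> E" "d s x < e" "t \<in> E" "d t y < e" and xy: "x \<in> mspace m'" "y \<in> mspace m'"
      by blast
    have "mdist m' x y \<le> d s x + d s y" using b2 st xy sub by blast
    moreover have "d s y \<le> mdist m s t + d t y" using b1 st xy sub by blast
    ultimately show "mdist m' x y \<le> r + 2 * e" using st E(2)[OF st(1,3)] by linarith
  qed
  finally show "measure \<mu> E \<le> concentration (m', \<mu>') (r + 2 * e) + e" by simp
qed

lemma mm_iso_point: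
  assumes X: "mm_space (m, \<mu>)" and one: "\<And>x y. x \<in> mspace m \<Longrightarrow> y \<in> mspace m \<Longrightarrow> x = y"
  shows "mm_iso (m, \<mu>) mm_point"
proof -
  interpret prob_space \<mu> by (rule mm_space_prob[OF X])
  obtain x where x: "x \<in> mspace m" using not_empty mm_space_space[OF X] by auto
  let ?p = "metric (UNIV :: unit set, \<lambda>_ _. 0)" and ?f = "\<lambda>_ :: 'a. ()"
  have f: "isometric_embedding m ?p ?f"
    using one by (auto simp: isometric_embedding_def)
  have meas: "?f \<in> measurable \<mu> (metric_borel ?p)" by (rule mm_space_measurable[OF X f])
  have sets: "sets (metric_borel ?p) = UNIV"
    using mm_space_sets[OF mm_point_space[unfolded mm_point_def]] by simp
  have "distr \<mu> (metric_borel ?p) ?f = return (count_space UNIV) ()"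
  proof (rule measure_eqI)
    fix V assume "V \<in> sets (distr \<mu> (metric_borel ?p) ?f)"
    then have "emeasure (distr \<mu> (metric_borel ?p) ?f) V = emeasure \<mu> (?f -` V \<inter> space \<mu>)"
      using emeasure_distr[OF meas] by simp
    also have "?f -` V \<inter> space \<mu> = (if () \<in> V then space \<mu> else {})" by auto
    finally show "emeasure (distr \<mu> (metric_borel ?p) ?f) V = emeasure (return (count_space UNIV) ()) V"
      using emeasure_space_1 by (simp add: indicator_def)
  qed (simp add: sets)
  moreover have "?f ` mspace m = mspace ?p" using x by auto
  ultimately show ?thesis using f by (auto simp: mm_iso_def mm_point_def)
qed

text \<open>
  Two distinct points have balls around them that no set of small diameter can meet simultaneously.
\<close>

lemma concentration_less_1:
  assumes "X \<noteq> 0" obtains r where "r > 0" "concentration (rep_mm_class X) r < 1"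
proof -
  obtain m \<mu> where m: "rep_mm_class X = (m, \<mu>)" by fastforce
  have X: "mm_space (m, \<mu>)" "mm_class_of (m, \<mu>) = X" using mm_space_rep[of X] mm_class_of_rep[of X] m by simp_all
  interpret P: prob_space \<mu> by (rule mm_space_prob[OF X(1)])
  have "\<not> mm_iso (m, \<mu>) mm_point"
    using mm_class_of_eq_iff[OF X(1) mm_point_space] assms X(2) by (simp add: zero_mm_class_def)
  then obtain x y where xy: "x \<in> mspace m" "y \<in> mspace m" "x \<noteq> y" using mm_iso_point[OF X(1)] by blast
  define r where "r = mdist m x y / 3"
  have r: "r > 0" using xy mdist_nonneg[of m x y] by (simp add: r_def less_le)
  let ?B = "mball_of m x r" and ?C = "mball_of m y r"
  let ?c = "min (measure \<mu> ?B) (measure \<mu> ?C)"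
  have "concentration (m, \<mu>) r \<le> 1 - ?c"
  proof (rule concentration_least)
    fix E assume E: "E \<in> sets (metric_borel m)" "\<And>x y. x \<in> E \<Longrightarrow> y \<in> E \<Longrightarrow> mdist m x y \<le> r"
    have BC: "?B \<in> sets \<mu>" "?C \<in> sets \<mu>" unfolding mm_space_sets[OF X(1)] by (rule mball_of_borel)+
    have sub: "E \<subseteq> space \<mu>" using sets.sets_into_space[OF E(1)] mm_space_space[OF X(1)] by simp
    have "E \<inter> ?B = {} \<or> E \<inter> ?C = {}"
    proof (rule ccontr)
      assume "\<not> ?thesis"
      then obtain p q where pq: "p \<in> E" "p \<in> ?B" "q \<in> E" "q \<in> ?C" by blast
      have "mdist m x y \<le> mdist m x p + mdist m p y" "mdist m p y \<le> mdist m p q + mdist m q y"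
        using xy pq by (auto intro!: mdist_triangle)
      then have "mdist m x y < 3 * r" using pq E(2)[OF pq(1,3)] mdist_commute[of m q y] by simp
      then show False by (simp add: r_def)
    qed
    then have "E \<subseteq> space \<mu> - ?B \<or> E \<subseteq> space \<mu> - ?C" using sub by blast
    then have "measure \<mu> E \<le> measure \<mu> (space \<mu> - ?B) \<or> measure \<mu> E \<le> measure \<mu> (space \<mu> - ?C)"
      using P.finite_measure_mono sets.compl_sets[OF BC(1)] sets.compl_sets[OF BC(2)] by blast
    then show "measure \<mu> E \<le> 1 - ?c" using P.prob_compl[OF BC(1)] P.prob_compl[OF BC(2)] by linarith
  qed
  also have "\<dots> < 1" using mm_space_ball_pos[OF X(1) xy(1) r] mm_space_ball_pos[OF X(1) xy(2) r] by simp
  finally show ?thesis using that[OF r] m by simp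
qed

lemma concentration_plus_le:
  "concentration (rep_mm_class (X + Y)) r \<le> concentration (rep_mm_class X) r * concentration (rep_mm_class Y) r"
proof -
  have "mm_iso (mm_sum (rep_mm_class X) (rep_mm_class Y)) (rep_mm_class (X + Y))"
    unfolding plus_mm_class_def by (intro mm_iso_rep mm_sum_space mm_space_rep)
  from concentration_iso_le[OF mm_sum_space[OF mm_space_rep mm_space_rep] mm_space_rep this]
  show ?thesis using concentration_sum_le[OF mm_space_rep mm_space_rep] order_trans by blast
qed

text \<open>
  If \<open>X\<close> is nontrivial, its concentration is some \<open>q < 1\<close> at a scale \<open>r0\<close>. Removing \<open>X\<close> from \<open>L\<close> then increases the
  concentration at least by the factor \<open>1 / q\<close> at all smaller scales, yet what remains still contains \<open>S n\<close>, which is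
  almost as spread out as \<open>L\<close>. So the concentration of \<open>L\<close> at \<open>r\<close> is at most \<open>q\<close> times that at any larger
  scale. Arbitrarily many scales fit between \<open>r0 / 2\<close> and \<open>r0\<close>, so the concentration of \<open>L\<close> at \<open>r0 / 2\<close>
  is 0.
\<close>

lemma constant_tail_zero:
  assumes lim: "mm_tendsto S L" and tail: "\<And>n. L = S n + (X + W n)"
  shows "X = 0"
proof (rule ccontr)
  assume "X \<noteq> 0"
  then obtain r0 where r0: "r0 > 0" "concentration (rep_mm_class X) r0 < 1" by (rule concentration_less_1)
  define q where "q = concentration (rep_mm_class X) r0"
  define c where "c Z r = concentration (rep_mm_class Z) r" for Z r
  have q: "0 \<le> q" "q < 1" using r0(2) concentration_bounds[OF mm_space_rep] by (simp_all add: q_def)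
  have c01: "0 \<le> c Z r" "c Z r \<le> 1" for Z r unfolding c_def by (intro concentration_bounds mm_space_rep)+
  have c_mono: "c Z r \<le> c Z r'" if "r \<le> r'" for Z r r' 
    unfolding c_def by (intro concentration_mono mm_space_rep that)
  have "\<forall>n. \<exists>k \<rho>. rep_mm_class (S n) = (k, \<rho>)" by simp
  then obtain M \<kappa> where M: "\<And>n. rep_mm_class (S n) = (M n, \<kappa> n)" by metis
  obtain m \<mu> where m: "rep_mm_class L = (m, \<mu>)" by fastforce
  have S: "mm_space (M n, \<kappa> n)" "mm_class_of (M n, \<kappa> n) = S n" for n
    using mm_space_rep[of "S n"] mm_class_of_rep[of "S n"] M by simp_all
  have L: "mm_space (m, \<mu>)" "mm_class_of (m, \<mu>) = L" using mm_space_rep[of L] mm_class_of_rep[of L] m by simp_all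
  obtain d e where de: "\<And>n. bridge (M n) (\<kappa> n) m \<mu> (d n) (e n)" "\<And>n. e n > (0::real)" "e \<longlonglongrightarrow> 0"
    using tendsto_bridges[OF S(2,1) L(2,1) lim] by blast
  have step: "c L r \<le> q * c L r'" if r: "r < r'" "r < r0" for r r'
  proof (rule LIMSEQ_le_const)
    show "(\<lambda>n. q * (c L r' + e n)) \<longlonglongrightarrow> q * c L r'"
      using tendsto_mult[OF tendsto_const[of q] tendsto_add[OF tendsto_const[of "c L r'"] de(3)]] by simp
    have "eventually (\<lambda>n. e n < (r' - r) / 2) sequentially"
      using r(1) by (intro order_tendstoD(2)[OF de(3)]) simp
    then obtain N where N: "\<And>n. n \<ge> N \<Longrightarrow> e n < (r' - r) / 2" by (auto simp: eventually_sequentially)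
    have "c L r \<le> q * (c L r' + e n)" if n: "n \<ge> N" for n
    proof -
      have "c L r \<le> c (S n) r * c (X + W n) r"
        using concentration_plus_le[of "S n" "X + W n" r] tail[of n] by (simp add: c_def)
      also have "\<dots> \<le> c (S n) r * (c X r * c (W n) r)"
        using concentration_plus_le[of X "W n" r] c01 by (intro mult_left_mono) (simp_all add: c_def)
      also have "\<dots> \<le> c (S n) r * (q * 1)"
        using c01 q c_mono[of r r0 X] r(2) by (intro mult_mono) (auto simp: q_def c_def)
      also have "\<dots> = q * c (S n) r" by simp
      also have "\<dots> \<le> q * (c L r' + e n)"
      proof (rule mult_left_mono[OF _ q(1)])
        have "c (S n) r \<le> c L (r + 2 * e n) + e n"
          using concentration_bridge[OF S(1) L(1) de(1)] by (simp add: c_def M m)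
        also have "c L (r + 2 * e n) \<le> c L r'" using N[OF n] by (intro c_mono) simp
        finally show "c (S n) r \<le> c L r' + e n" by simp
      qed
      finally show ?thesis .
    qed
    then show "\<exists>N. \<forall>n\<ge>N. c L r \<le> q * (c L r' + e n)" by blast
  qed
  have "\<forall>r<r0. c L r \<le> q ^ k" for k
  proof (induction k)
    case 0
    then show ?case using c01 by simp
  next
    case (Suc k)
    show ?case
    proof (intro allI impI)
      fix r assume r: "r < r0"
      then obtain r' where r': "r < r'" "r' < r0" using dense by blast
      have "c L r \<le> q * c L r'" by (rule step[OF r'(1) r])
      also have "\<dots> \<le> q * q ^ k" using Suc r'(2) q by (intro mult_left_mono) auto
      finally show "c L r \<le> q ^ Suc k" by simp
    qed
  qed
  then have "c L (r0 / 2) \<le> q ^ k" for k using r0(1) by simp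
  then have "c L (r0 / 2) \<le> 0"
    using LIMSEQ_le_const[OF LIMSEQ_power_zero[of q]] q by auto
  then show False using concentration_pos[OF mm_space_rep, of "r0 / 2" L] r0(1) by (simp add: c_def)
qed

section \<open>Irreducible summands of infinite sums\<close>

lemma prime_le_sum:
  assumes "mm_prime X" "X \<preceq> (\<Sum>i\<le>n. Y i)" shows "\<exists>i. X \<preceq> Y (i :: nat)"
  using assms(2)
proof (induction n)
  case (Suc n)
  then show ?case using assms(1) by (auto simp: mm_prime_def)
qed auto

proposition irreducible_le_infinite_sum:
  assumes lim: "mm_tendsto (\<lambda>n. \<Sum>i\<le>n. Y i) L" and irr: "mm_irreducible X" and le: "X \<preceq> L"
  shows "\<exists>n. X \<preceq> Y n"
proof (rule ccontr)
  assume none: "\<nexists>n. X \<preceq> Y n"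
  have prime: "mm_prime X" by (rule irreducible_imp_prime[OF irr])
  let ?S = "\<lambda>n. \<Sum>i\<le>n. Y i"
  have S_le: "?S n \<preceq> ?S (k + n)" for n k
    by (induction k) (auto simp: mm_le_def add.assoc intro: exI[of _ 0])
  have "?S n \<preceq> L" for n
  proof (rule summand_of_limit)
    show "mm_tendsto (\<lambda>k. ?S (k + n)) L"
      using lim unfolding mm_tendsto_def by (rule LIMSEQ_ignore_initial_segment)
  qed (rule S_le)
  then obtain T where T: "\<And>n. L = ?S n + T n" unfolding mm_le_def by metis
  have "X \<preceq> T n" for n
    using prime le T[of n] none prime_le_sum[OF prime] unfolding mm_prime_def by metis
  then obtain W where "\<And>n. T n = X + W n" unfolding mm_le_def by metis
  then have "X = 0" using constant_tail_zero[OF lim, of X W] T by simp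
  then show False using irr by (simp add: mm_irreducible_def)
qed

theorem proposition5p3:
  shows "(\<forall>X :: mm_class. mm_irreducible X \<longrightarrow> mm_prime X) \<and>
    (\<forall>(Y :: nat \<Rightarrow> mm_class) (L :: mm_class) (X :: mm_class).
       mm_tendsto (\<lambda>n. \<Sum>i\<le>n. Y i) L \<and> mm_irreducible X \<and> X \<preceq> L \<longrightarrow> (\<exists>n. X \<preceq> Y n))"
  using irreducible_imp_prime irreducible_le_infinite_sum by blast

end
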